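(* Almost minimizers for $J$ (or for $J^+$) in $\Omega$ are continuous in $\Omega$. Moreover, if $u$ is an almost minimizer for $J$ (or for $J^+$) in $\Omega$, there exists a constant $C>0$ such that if $B(x_0,2r_0)\subset\Omega$, then for $x,y\in B(x_0,r_0)$ $$|u(x)-u(y)|\le C\,|x-y|\Big(1+\log\frac{2r_0}{|x-y|}\Big).$$
   Context: Let $n\ge 2$, let $\Omega\subset\mathbb{R}^n$ be a domain (open set), let $q_+,q_-\in L^\infty(\Omega)$ be bounded real-valued functions, and let $\kappa\in(0,\infty)$, $\alpha\in(0,1]$. Set $K_{\mathrm{loc}}(\Omega)=\{u\in L^1_{\mathrm{loc}}(\Omega): \nabla u\in L^2(B(x,r))$ for every open ball $B(x,r)\subset\Omega\}$ and $K^+_{\mathrm{loc}}(\Omega)=\{u\in K_{\mathrm{loc}}(\Omega): u\ge 0$ a.e. on $\Omega\}$. Let $$J_{x,r}(v)=\int_{B(x,r)}|\nabla v|^2+q_+^2\,\chi_{\{v>0\}}+q_-^2\,\chi_{\{v<0\}},\qquad J^+_{x,r}(v)=\int_{B(x,r)}|\nabla v|^2+q_+^2\,\chi_{\{v>0\}}.$$ $u$ is an almost minimizer for $J$ in $\Omega$ (with constant $\kappa$ and exponent $\alpha$) if $u\in K_{\mathrm{loc}}(\Omega)$ and $J_{x,r}(u)\le(1+\kappa r^\alpha)J_{x,r}(v)$ for every ball $B(x,r)\subset\Omega$ and every $v\in L^1(B(x,r))$ with $\nabla v\in L^2(B(x,r))$ and $v=u$ on $\partial B(x,r)$ (equality of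 traces). $u$ is an almost minimizer for $J^+$ in $\Omega$ if $u\in K^+_{\mathrm{loc}}(\Omega)$ and $J^+_{x,r}(u)\le(1+\kappa r^\alpha)J^+_{x,r}(v)$ for every ball with $\overline B(x,r)\subset\Omega$ and every such $v$. Continuity is understood after modification of $u$ on a set of measure zero.
   Formalization: The constant C is chosen after the ball B(x_0,2r_0), so it may depend on u and on that ball; a single C for all balls in Ω is impossible, e.g. for the harmonic u = x_1^2 - x_2^2 on R^n with q_+ = q_- = 0. *)

theory Defs
  imports "HOL-Analysis.Analysis"
begin

section \<open>Function spaces\<close>

definition L_infinity :: "'a::euclidean_space set \<Rightarrow> ('a \<Rightarrow> real) \<Rightarrow> bool" where
  "L_infinity S q \<longleftrightarrow>
     q \<in> borel_measurable (lebesgue_on S) \<and> (\<exists>M. AE x in lebesgue_on S. \<bar>q x\<bar> \<le> M)"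

definition L1 :: "'a::euclidean_space set \<Rightarrow> ('a \<Rightarrow> real) \<Rightarrow> bool" where
  "L1 S v \<longleftrightarrow> integrable (lebesgue_on S) v"

definition L2 :: "'a::euclidean_space set \<Rightarrow> ('a \<Rightarrow> 'a) \<Rightarrow> bool" where
  "L2 S g \<longleftrightarrow> g \<in> borel_measurable (lebesgue_on S) \<and> integrable (lebesgue_on S) (\<lambda>x. (norm (g x))\<^sup>2)"

definition L1_loc ::
    "'a::euclidean_space set \<Rightarrow> ('a \<Rightarrow> 'b::{banach,second_countable_topology}) \<Rightarrow> bool" where
  "L1_loc S f \<longleftrightarrow> (\<forall>K. compact K \<and> K \<subseteq> S \<longrightarrow> integrable (lebesgue_on K) f)"

primrec C_k :: "nat \<Rightarrow> ('a::euclidean_space \<Rightarrow> real) \<Rightarrow> bool" where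
  "C_k 0 \<phi> \<longleftrightarrow> continuous_on UNIV \<phi>"
| "C_k (Suc k) \<phi> \<longleftrightarrow>
     (\<forall>x. \<phi> differentiable (at x)) \<and> (\<forall>i\<in>Basis. C_k k (\<lambda>x. frechet_derivative \<phi> (at x) i))"

definition C_infinity :: "('a::euclidean_space \<Rightarrow> real) \<Rightarrow> bool" where
  "C_infinity \<phi> \<longleftrightarrow> (\<forall>k. C_k k \<phi>)"

definition test_function :: "'a::euclidean_space set \<Rightarrow> ('a \<Rightarrow> real) \<Rightarrow> bool" where
  "test_function S \<phi> \<longleftrightarrow>
     C_infinity \<phi> \<and> compact (closure {x. \<phi> x \<noteq> 0}) \<and> closure {x. \<phi> x \<noteq> 0} \<subseteq> S"


section \<open>Weak gradients\<close>

definition has_weak_gradient ::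
    "'a::euclidean_space set \<Rightarrow> ('a \<Rightarrow> real) \<Rightarrow> ('a \<Rightarrow> 'a) \<Rightarrow> bool" where
  "has_weak_gradient S u g \<longleftrightarrow> L1_loc S u \<and> L1_loc S g \<and>
     (\<forall>\<phi>. test_function S \<phi> \<longrightarrow> (\<forall>i\<in>Basis.
        (\<integral>x. u x * frechet_derivative \<phi> (at x) i \<partial>lebesgue_on S)
          = - (\<integral>x. (g x \<bullet> i) * \<phi> x \<partial>lebesgue_on S)))"

text \<open>On an open set a weak gradient is unique up to a null set, so integrals involving
  the representative chosen here do not depend on the choice.\<close>

definition weak_gradient :: "'a::euclidean_space set \<Rightarrow> ('a \<Rightarrow> real) \<Rightarrow> 'a \<Rightarrow> 'a" where
  "weak_gradient S u = (SOME g. has_weak_gradient S u g)"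

definition gradient_in_L2 :: "'a::euclidean_space set \<Rightarrow> ('a \<Rightarrow> real) \<Rightarrow> bool" where
  "gradient_in_L2 S u \<longleftrightarrow> (\<exists>g. has_weak_gradient S u g \<and> L2 S g)"

definition K_loc :: "'a::euclidean_space set \<Rightarrow> ('a \<Rightarrow> real) \<Rightarrow> bool" where
  "K_loc \<Omega> u \<longleftrightarrow> L1_loc \<Omega> u \<and> (\<forall>x r. 0 < r \<and> ball x r \<subseteq> \<Omega> \<longrightarrow> gradient_in_L2 (ball x r) u)"

definition K_loc_plus :: "'a::euclidean_space set \<Rightarrow> ('a \<Rightarrow> real) \<Rightarrow> bool" where
  "K_loc_plus \<Omega> u \<longleftrightarrow> K_loc \<Omega> u \<and> (AE x in lebesgue_on \<Omega>. 0 \<le> u x)"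


section \<open>Traces on spheres\<close>

text \<open>Surface measure on the sphere of radius \<open>r\<close> about \<open>x\<close>, obtained from Lebesgue measure by
  polar coordinates: \<open>\<sigma>(A) = (n / r) |{y \<in> B(x,r). x + r (y - x) / |y - x| \<in> A}|\<close>.\<close>

definition sphere_measure :: "'a::euclidean_space \<Rightarrow> real \<Rightarrow> 'a measure" where
  "sphere_measure x r = scale_measure (ennreal (real DIM('a) / r))
     (distr (restrict_space lborel (ball x r)) borel (\<lambda>y. x + r *\<^sub>R sgn (y - x)))"

text \<open>\<open>T\<close> is the trace of \<open>v\<close> if it is the limit of the boundary values of functions that are
  smooth up to the boundary and converge to \<open>v\<close> on the ball, in the natural norm
  \<open>\<parallel>v\<parallel>\<^sub>L\<^sub>1 + \<parallel>\<nabla>v\<parallel>\<^sub>L\<^sub>2\<close> of the class of competitors (equivalent on a ball to the norm of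
  \<open>W\<^sup>1\<^sup>,\<^sup>2\<close>).  Traces are unique up to null sets of the surface measure.\<close>

definition has_trace ::
    "'a::euclidean_space \<Rightarrow> real \<Rightarrow> ('a \<Rightarrow> real) \<Rightarrow> ('a \<Rightarrow> real) \<Rightarrow> bool" where
  "has_trace x r v T \<longleftrightarrow> integrable (sphere_measure x r) T \<and>
     (\<exists>\<phi>. (\<forall>k::nat. C_infinity (\<phi> k)) \<and>
        (\<lambda>k. \<integral>y. \<bar>\<phi> k y - v y\<bar> \<partial>lebesgue_on (ball x r)) \<longlonglongrightarrow> 0 \<and>
        (\<lambda>k. \<integral>y. (norm (weak_gradient (ball x r) (\<lambda>z. \<phi> k z - v z) y))\<^sup>2
               \<partial>lebesgue_on (ball x r)) \<longlonglongrightarrow> 0 \<and>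
        (\<lambda>k. \<integral>y. \<bar>\<phi> k y - T y\<bar> \<partial>sphere_measure x r) \<longlonglongrightarrow> 0)"

definition equal_traces ::
    "'a::euclidean_space \<Rightarrow> real \<Rightarrow> ('a \<Rightarrow> real) \<Rightarrow> ('a \<Rightarrow> real) \<Rightarrow> bool" where
  "equal_traces x r u v \<longleftrightarrow> (\<exists>T. has_trace x r u T \<and> has_trace x r v T)"

definition competitor ::
    "'a::euclidean_space \<Rightarrow> real \<Rightarrow> ('a \<Rightarrow> real) \<Rightarrow> ('a \<Rightarrow> real) \<Rightarrow> bool" where
  "competitor x r u v \<longleftrightarrow>
     L1 (ball x r) v \<and> gradient_in_L2 (ball x r) v \<and> equal_traces x r u v"


section \<open>Almost minimizers\<close>

definition J :: "('a::euclidean_space \<Rightarrow> real) \<Rightarrow> ('a \<Rightarrow> real) \<Rightarrow> 'a \<Rightarrow> real \<Rightarrow> ('a \<Rightarrow> real) \<Rightarrow> real" where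
  "J qp qm x r v =
     (\<integral>y. (norm (weak_gradient (ball x r) v y))\<^sup>2
          + (qp y)\<^sup>2 * indicator {z. v z > 0} y
          + (qm y)\<^sup>2 * indicator {z. v z < 0} y \<partial>lebesgue_on (ball x r))"

definition J_plus :: "('a::euclidean_space \<Rightarrow> real) \<Rightarrow> 'a \<Rightarrow> real \<Rightarrow> ('a \<Rightarrow> real) \<Rightarrow> real" where
  "J_plus qp x r v =
     (\<integral>y. (norm (weak_gradient (ball x r) v y))\<^sup>2
          + (qp y)\<^sup>2 * indicator {z. v z > 0} y \<partial>lebesgue_on (ball x r))"

definition almost_minimizer ::
    "'a::euclidean_space set \<Rightarrow> ('a \<Rightarrow> real) \<Rightarrow> ('a \<Rightarrow> real) \<Rightarrow> real \<Rightarrow> real \<Rightarrow> ('a \<Rightarrow> real) \<Rightarrow> bool" where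
  "almost_minimizer \<Omega> qp qm \<kappa> \<alpha> u \<longleftrightarrow> K_loc \<Omega> u \<and>
     (\<forall>x r v. 0 < r \<and> ball x r \<subseteq> \<Omega> \<and> competitor x r u v \<longrightarrow>
        J qp qm x r u \<le> (1 + \<kappa> * r powr \<alpha>) * J qp qm x r v)"

definition almost_minimizer_plus ::
    "'a::euclidean_space set \<Rightarrow> ('a \<Rightarrow> real) \<Rightarrow> real \<Rightarrow> real \<Rightarrow> ('a \<Rightarrow> real) \<Rightarrow> bool" where
  "almost_minimizer_plus \<Omega> qp \<kappa> \<alpha> u \<longleftrightarrow> K_loc_plus \<Omega> u \<and>
     (\<forall>x r v. 0 < r \<and> cball x r \<subseteq> \<Omega> \<and> competitor x r u v \<longrightarrow>
        J_plus qp x r u \<le> (1 + \<kappa> * r powr \<alpha>) * J_plus qp x r v)"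

text \<open>In the logarithmic modulus of continuity the constant depends on \<open>u\<close> and on the ball (through
  the average of \<open>|\<nabla>u|\<^sup>2\<close>).  It cannot be chosen uniformly over all balls in \<open>\<Omega>\<close>: with
  \<open>q\<^sub>+ = q\<^sub>- = 0\<close>, harmonic functions whose gradient has finite energy on balls are minimizers, and
  \<open>x\<^sub>1 x\<^sub>2\<close> on \<open>{x\<^sub>1 > 0, x\<^sub>2 > 0}\<close> has unbounded gradient on balls of radius 1.\<close>

end

theory Submission
  imports Defs
begin

text \<open>On a ball \<open>B(x,r)\<close> the function \<open>u\<close> is compared with \<open>u + \<psi>\<close>, where \<open>\<psi>\<close> is a test function for
  which \<open>u + \<psi>\<close> nearly minimizes the Dirichlet energy; this replaces the harmonic extension and needs
  no existence theory.  The field \<open>F = \<nabla>u + \<nabla>\<psi>\<close> is nearly orthogonal to gradients of test functions, so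
  its mollifications have nearly harmonic components, whose mean squares over concentric balls nearly
  increase with the radius.  As \<open>\<nabla>\<psi>\<close> is controlled by almost minimality, the quadratic means \<open>a(r)\<close> of
  \<open>|\<nabla>u|\<close> over \<open>B(x,r)\<close> satisfy \<open>a(r/2) \<le> (1 + C r\<^sup>\<alpha>\<^sup>/\<^sup>2) a(r) + C\<close>, whence \<open>a(2\<^sup>-\<^sup>k) \<le> C (1 + k)\<close>.

  Consequently the mollification \<open>u\<^sub>k\<close> of \<open>u\<close> at scale \<open>2\<^sup>-\<^sup>k\<close> has gradient \<open>O(1 + k)\<close>.  Mollifications commute,
  so \<open>u\<^sub>k\<close> and \<open>u\<^sub>k\<^sub>+\<^sub>1\<close> are both within \<open>O((1 + k) 2\<^sup>-\<^sup>k)\<close> of the doubly mollified function.  The limit of \<open>u\<^sub>k\<close>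
  therefore has the modulus of continuity, by choosing \<open>2\<^sup>-\<^sup>k\<close> comparable to \<open>|x - y|\<close>.

  Since \<open>\<psi>\<close> has compact support in the ball, the traces of \<open>u\<close> and \<open>u + \<psi>\<close> agree as soon as \<open>u\<close> has a trace
  at all.  Integration in polar coordinates provides it on almost every sphere about \<open>x\<close>, and the energy
  comparison extends to all radii by continuity.\<close>

section \<open>Smooth functions\<close>

text \<open>Near orthogonality makes the squared norms of \<open>F\<close> and of grad psi add up
  almost exactly to that of grad u. Almost minimality therefore bounds the squared norm of grad psi
  by C r^alpha times that of grad u plus C r^n, and the square root of this is the source of the
  exponent alpha/2 and of the additive constant. Over dyadic radii the factors 1 + C 2^(-k alpha/2)
  have a bounded product, whereas the additive constants, which stem from the terms with
  \<open>qp\<close> and \<open>qm\<close>, accumulate one per scale. Hence the logarithm: it counts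
  the dyadic scales between the ball and |x - y|. Both functionals differ from the Dirichlet energy
  by at most a multiple of r^n, and competitors for \<open>J_plus\<close> may change sign, so u +
  psi serves both. Pointwise gradient bounds for smooth functions take the place of a Poincare
  inequality. The estimates run on Borel functions integrated over the whole space; the completed
  measure and the chosen weak gradient of the definitions enter only where the two settings are
  translated into each other.\<close>

abbreviation restr :: "'a set \<Rightarrow> ('a \<Rightarrow> 'b::real_vector) \<Rightarrow> 'a \<Rightarrow> 'b" where
  "restr S F \<equiv> \<lambda>x. indicator S x *\<^sub>R F x"

section \<open>Partial derivatives and the gradient as a vector field\<close>

definition pd :: "'a::euclidean_space \<Rightarrow> ('a \<Rightarrow> real) \<Rightarrow> 'a \<Rightarrow> real" where
  "pd i \<phi> x = frechet_derivative \<phi> (at x) i"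

definition grad :: "('a::euclidean_space \<Rightarrow> real) \<Rightarrow> 'a \<Rightarrow> 'a" where
  "grad \<phi> x = (\<Sum>i\<in>Basis. pd i \<phi> x *\<^sub>R i)"

lemma grad_inner: "i \<in> Basis \<Longrightarrow> grad \<phi> x \<bullet> i = pd i \<phi> x"
  by (simp add: grad_def)

lemma pd_eqI:
  assumes "(\<phi> has_derivative D) (at x)"
  shows "pd i \<phi> x = D i"
  using frechet_derivative_at[OF assms] by (simp add: pd_def)

lemma has_derivative_grad:
  assumes "\<phi> differentiable (at x)"
  shows "(\<phi> has_derivative (\<lambda>h. grad \<phi> x \<bullet> h)) (at x)"
proof -
  have d: "(\<phi> has_derivative frechet_derivative \<phi> (at x)) (at x)"
    using assms frechet_derivative_works by blast
  have lin: "linear (frechet_derivative \<phi> (at x))"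
    using assms linear_frechet_derivative by blast
  have "frechet_derivative \<phi> (at x) h = grad \<phi> x \<bullet> h" for h
  proof -
    have "frechet_derivative \<phi> (at x) h = frechet_derivative \<phi> (at x) (\<Sum>i\<in>Basis. (h \<bullet> i) *\<^sub>R i)"
      by (simp add: euclidean_representation)
    also have "\<dots> = (\<Sum>i\<in>Basis. (h \<bullet> i) * frechet_derivative \<phi> (at x) i)"
      using lin by (simp add: linear_sum linear_cmul)
    also have "\<dots> = grad \<phi> x \<bullet> h"
      by (simp add: grad_def pd_def inner_sum_left inner_commute[of h] mult.commute)
    finally show ?thesis .
  qed
  then have "frechet_derivative \<phi> (at x) = (\<lambda>h. grad \<phi> x \<bullet> h)" by blast
  with d show ?thesis by simp
qed

lemma grad_eqI:
  assumes "(\<phi> has_derivative (\<lambda>h. g \<bullet> h)) (at x)"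
  shows "grad \<phi> x = g"
  by (rule euclidean_eqI) (simp add: grad_inner pd_eqI[OF assms])

lemma C_k_Suc: "C_k (Suc k) \<phi> \<longleftrightarrow> (\<forall>x. \<phi> differentiable (at x)) \<and> (\<forall>i\<in>Basis. C_k k (pd i \<phi>))"
  by (simp add: pd_def[abs_def])

declare C_k.simps(2)[simp del]

lemma C_k_imp_continuous: "C_k k \<phi> \<Longrightarrow> continuous_on UNIV \<phi>"
  by (cases k) (auto simp: C_k_Suc intro: differentiable_imp_continuous_on
      simp: differentiable_on_def differentiable_at_withinI)

text \<open>Needed because \<open>C_k (Suc k)\<close> asks for differentiability and for
  \<open>C_k k\<close> of the partial derivatives, not for \<open>C_k k\<close> of the function
  itself.\<close>

lemma C_k_Suc_imp: "C_k (Suc k) \<phi> \<Longrightarrow> C_k k \<phi>"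
proof (induction k arbitrary: \<phi>)
  case 0 then show ?case using C_k_imp_continuous by auto
next
  case (Suc k) then show ?case using C_k_Suc by blast
qed

lemma C_infinity_iff: "C_infinity \<phi> \<longleftrightarrow> (\<forall>x. \<phi> differentiable (at x)) \<and> (\<forall>i\<in>Basis. C_infinity (pd i \<phi>))"
proof
  assume "C_infinity \<phi>" then show "(\<forall>x. \<phi> differentiable (at x)) \<and> (\<forall>i\<in>Basis. C_infinity (pd i \<phi>))"
    unfolding C_infinity_def using C_k_Suc by blast
next
  assume *: "(\<forall>x. \<phi> differentiable (at x)) \<and> (\<forall>i\<in>Basis. C_infinity (pd i \<phi>))"
  have "C_k k \<phi>" for k
    using * C_k_Suc[of k \<phi>] C_k_Suc_imp[of k \<phi>] by (auto simp: C_infinity_def)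
  then show "C_infinity \<phi>" by (simp add: C_infinity_def)
qed

lemma C_infinity_diff: "C_infinity \<phi> \<Longrightarrow> \<phi> differentiable (at x)"
  and C_infinity_pd: "C_infinity \<phi> \<Longrightarrow> i \<in> Basis \<Longrightarrow> C_infinity (pd i \<phi>)"
  and C_infinity_cont: "C_infinity \<phi> \<Longrightarrow> continuous_on A \<phi>"
  using C_infinity_iff apply blast using C_infinity_iff apply blast
  unfolding C_infinity_def using C_k_imp_continuous continuous_on_subset by (metis subset_UNIV)

lemma C_infinity_grad_cont: "C_infinity \<phi> \<Longrightarrow> continuous_on A (grad \<phi>)"
  unfolding grad_def[abs_def] by (intro continuous_intros C_infinity_cont C_infinity_pd)

lemma C_k_const [simp]: "C_k k (\<lambda>x. c)"
proof (induction k arbitrary: c)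
  case (Suc k)
  have "pd i (\<lambda>x. c) = (\<lambda>x. 0)" for i :: 'a by (auto simp: fun_eq_iff intro!: pd_eqI)
  then show ?case using Suc by (simp add: C_k_Suc)
qed simp

section \<open>Sums, products and affine substitutions of smooth functions\<close>

lemma pd_add:
  assumes "f differentiable (at x)" "g differentiable (at x)"
  shows "pd i (\<lambda>x. f x + g x) x = pd i f x + pd i g x"
  using pd_eqI[OF has_derivative_add[OF has_derivative_grad[OF assms(1)] has_derivative_grad[OF assms(2)]], of i]
    pd_eqI[OF has_derivative_grad[OF assms(1)], of i] pd_eqI[OF has_derivative_grad[OF assms(2)], of i] by simp

lemma pd_mult:
  assumes "f differentiable (at x)" "g differentiable (at x)"
  shows "pd i (\<lambda>x. f x * g x) x = f x * pd i g x + pd i f x * g x"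
  using pd_eqI[OF has_derivative_mult[OF has_derivative_grad[OF assms(1)] has_derivative_grad[OF assms(2)]], of i]
    pd_eqI[OF has_derivative_grad[OF assms(1)], of i] pd_eqI[OF has_derivative_grad[OF assms(2)], of i] by simp

lemma pd_affine:
  assumes "\<And>x. f differentiable (at x)"
  shows "pd i (\<lambda>x. f (c *\<^sub>R x + b)) x = c * pd i f (c *\<^sub>R x + b)"
proof -
  have "((\<lambda>x. c *\<^sub>R x + b) has_derivative (\<lambda>h. c *\<^sub>R h)) (at x)"
    by (auto intro!: derivative_eq_intros)
  from has_derivative_compose[OF this has_derivative_grad[OF assms]]
  show ?thesis using pd_eqI[OF has_derivative_grad[OF assms], of i] by (subst pd_eqI) auto
qed

lemma C_k_add: "C_k k f \<Longrightarrow> C_k k g \<Longrightarrow> C_k k (\<lambda>x. f x + g x)"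
proof (induction k arbitrary: f g)
  case (Suc k)
  then have "pd i (\<lambda>x. f x + g x) = (\<lambda>x. pd i f x + pd i g x)" for i
    by (auto simp: fun_eq_iff C_k_Suc intro!: pd_add)
  with Suc show ?case by (auto simp: C_k_Suc)
qed (auto intro: continuous_intros)

lemma C_k_mult: "C_k k f \<Longrightarrow> C_k k g \<Longrightarrow> C_k k (\<lambda>x. f x * g x)"
proof (induction k arbitrary: f g)
  case (Suc k)
  then have *: "pd i (\<lambda>x. f x * g x) = (\<lambda>x. f x * pd i g x + pd i f x * g x)" for i
    by (auto simp: fun_eq_iff C_k_Suc intro!: pd_mult)
  show ?case unfolding C_k_Suc *
    using Suc.prems C_k_Suc_imp[of k f] C_k_Suc_imp[of k g] Suc.IH
    by (auto simp: C_k_Suc intro!: C_k_add)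
qed (auto intro: continuous_intros)

lemma C_k_affine: "C_k k f \<Longrightarrow> C_k k (\<lambda>x. f (c *\<^sub>R x + b))"
proof (induction k arbitrary: f)
  case 0 then show ?case by (auto intro!: continuous_on_compose2[of UNIV f] continuous_intros)
next
  case (Suc k)
  then have *: "pd i (\<lambda>x. f (c *\<^sub>R x + b)) = (\<lambda>x. c * pd i f (c *\<^sub>R x + b))" for i
    by (auto simp: fun_eq_iff C_k_Suc intro!: pd_affine)
  have "(\<lambda>x. f (c *\<^sub>R x + b)) differentiable (at x)" for x
  proof -
    have "((\<lambda>x. c *\<^sub>R x + b) has_derivative (\<lambda>h. c *\<^sub>R h)) (at x)"
      by (auto intro!: derivative_eq_intros)
    moreover have "f differentiable (at (c *\<^sub>R x + b))" using Suc.prems by (simp add: C_k_Suc)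
    ultimately show ?thesis
      using has_derivative_compose[OF _ has_derivative_grad] unfolding differentiable_def by blast
  qed
  then show ?case unfolding C_k_Suc * using Suc by (auto simp: C_k_Suc intro!: C_k_mult)
qed

lemma C_k_inner: "C_k k (\<lambda>x. x \<bullet> b)"
proof (cases k)
  case (Suc m)
  have "pd i (\<lambda>x. x \<bullet> b) = (\<lambda>x. i \<bullet> b)" for i :: 'a
    by (auto simp: fun_eq_iff intro!: pd_eqI derivative_eq_intros)
  moreover have "(\<lambda>x. x \<bullet> b) differentiable (at x)" for x
    unfolding differentiable_def by (auto intro!: exI derivative_eq_intros)
  ultimately show ?thesis by (simp add: Suc C_k_Suc)
qed (auto intro: continuous_intros)

lemma C_infinity_const [simp]: "C_infinity (\<lambda>x. c)"
  and C_infinity_add: "C_infinity f \<Longrightarrow> C_infinity g \<Longrightarrow> C_infinity (\<lambda>x. f x + g x)"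
  and C_infinity_mult: "C_infinity f \<Longrightarrow> C_infinity g \<Longrightarrow> C_infinity (\<lambda>x. f x * g x)"
  and C_infinity_affine: "C_infinity f \<Longrightarrow> C_infinity (\<lambda>x. f (c *\<^sub>R x + b))"
  by (auto simp: C_infinity_def intro: C_k_add C_k_mult C_k_affine)

text \<open>Up to multiplication by polynomials this family is closed under differentiation, so that the
  smoothness of the bump function below is an induction.\<close>

definition flat :: "nat \<Rightarrow> real \<Rightarrow> real" where
  "flat m t = (if t > 0 then exp (- (1/t)) / t ^ m else 0)"

text \<open>A single term of the series for \<open>exp (1/t)\<close>, the one of degree
  \<open>m + 2\<close>, already gives the bound. The surplus factor \<open>t\<^sup>2\<close> makes
  the difference quotient at 0 tend to 0.\<close>

lemma flat_bound: "\<bar>flat m t\<bar> \<le> fact (m + 2) * t\<^sup>2"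
proof (cases "t > 0")
  case True
  have "(1/t) ^ (m+2) / fact (m+2) \<le> exp (1/t)"
  proof -
    have "(1/t) ^ (m+2) / fact (m+2) = (\<Sum>k\<in>{m+2}. (1/t)^k /\<^sub>R fact k)" by (simp add: field_simps)
    also have "\<dots> \<le> (\<Sum>k. (1/t)^k /\<^sub>R fact k)"
      using True by (intro sum_le_suminf summable_exp_generic) auto
    finally show ?thesis by (simp add: exp_def)
  qed
  then have "exp (- (1/t)) / t ^ m \<le> fact (m+2) * t\<^sup>2"
  proof -
    have "1 / t ^ (m+2) \<le> fact (m+2) * exp (1/t)"
      using \<open>(1/t) ^ (m+2) / fact (m+2) \<le> exp (1/t)\<close>
      by (metis (no_types) divide_le_eq fact_gt_zero mult.commute power_one_over)
    then have "1 / t ^ (m+2) * (t\<^sup>2 * exp (- (1/t))) \<le> fact (m+2) * exp (1/t) * (t\<^sup>2 * exp (- (1/t)))"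
      by (intro mult_right_mono) auto
    moreover have "1 / t ^ (m+2) * (t\<^sup>2 * exp (- (1/t))) = exp (- (1/t)) / t ^ m"
      using True by (simp add: power_add power2_eq_square)
    moreover have "fact (m+2) * exp (1/t) * (t\<^sup>2 * exp (- (1/t))) = fact (m+2) * t\<^sup>2"
      by (simp add: exp_minus del: fact_Suc)
    ultimately show ?thesis by metis
  qed
  then show ?thesis using True by (simp add: flat_def del: fact_Suc)
qed (simp add: flat_def)

text \<open>Differentiating \<open>exp (- (1/t))\<close> raises the power in the denominator by two,
  differentiating the power raises it by one. All members of the family vanish for t <= 0, so the
  same formula holds there.\<close>

lemma flat_deriv: "(flat m has_real_derivative (flat (m+2) t - real m * flat (m+1) t)) (at t)"
proof -
  consider "t > 0" | "t < 0" | "t = 0" by linarith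
  then show ?thesis
  proof cases
    case 1
    have ev: "eventually (\<lambda>x. flat m x = exp (- (1/x)) / x ^ m) (nhds t)"
      using 1
      by (intro eventually_nhds_in_open[THEN eventually_mono, of "{0<..}"]) (auto simp: flat_def)
    have "((\<lambda>x. exp (- (1/x)) / x ^ m) has_real_derivative
        ((exp (- (1/t)) * (1 / t\<^sup>2)) * t ^ m - exp (- (1/t)) * (real m * t ^ (m - 1))) / (t ^ m * t ^ m)) (at t)"
    proof -
      have "((\<lambda>x. - (1/x)) has_real_derivative 1 / t\<^sup>2) (at t)"
        using 1 DERIV_inverse[of t, THEN DERIV_minus] by (simp add: inverse_eq_divide power2_eq_square)
      from DERIV_divide[OF DERIV_fun_exp[OF this] DERIV_pow[of m t]] show ?thesis using 1 by simp
    qed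
    moreover have "((exp (- (1/t)) * (1 / t\<^sup>2)) * t ^ m - exp (- (1/t)) * (real m * t ^ (m - 1))) / (t ^ m * t ^ m)
        = flat (m+2) t - real m * flat (m+1) t"
    \<comment> \<open>The exponent \<open>m - 1\<close> is a truncated subtraction; for m = 0 the
      factor \<open>real m\<close> removes that term.\<close>
    proof (cases m)
      case 0 then show ?thesis using 1 by (simp add: flat_def power2_eq_square)
    next
      case (Suc k) then show ?thesis using 1
        by (simp add: flat_def diff_divide_distrib power_add power2_eq_square)
    qed
    ultimately have "((\<lambda>x. exp (- (1/x)) / x ^ m) has_real_derivative (flat (m+2) t - real m * flat (m+1) t)) (at t)"
      by simp
    then show ?thesis by (rule iffD2[OF DERIV_cong_ev[OF refl ev refl]])
  next
    case 2
    have ev: "eventually (\<lambda>x. flat m x = 0) (nhds t)"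
      using 2 by (intro eventually_nhds_in_open[THEN eventually_mono, of "{..<0}"]) (auto simp: flat_def)
    have "flat (m+2) t - real m * flat (m+1) t = 0" using 2 by (simp add: flat_def)
    then show ?thesis by (simp only:) (rule iffD2[OF DERIV_cong_ev[OF refl ev refl]], rule DERIV_const)
  next
    case 3
    have "((\<lambda>h. (flat m (0 + h) - flat m 0) / h) \<longlongrightarrow> 0) (at 0)"
    proof (rule Lim_null_comparison)
      have "\<bar>flat m h\<bar> / \<bar>h\<bar> \<le> fact (m+2) * \<bar>h\<bar>" for h
      proof (cases "h = 0")
        case False
        have "fact (m+2) * h\<^sup>2 = fact (m+2) * \<bar>h\<bar> * \<bar>h\<bar>" by (simp add: power2_eq_square)
        then have "\<bar>flat m h\<bar> \<le> fact (m+2) * \<bar>h\<bar> * \<bar>h\<bar>" using flat_bound[of m h] by metis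
        then show ?thesis using False by (simp add: pos_divide_le_eq del: fact_Suc)
      qed simp
      then show "\<forall>\<^sub>F h in at 0. norm ((flat m (0 + h) - flat m 0) / h) \<le> fact (m+2) * \<bar>h\<bar>"
        by (intro always_eventually allI) (simp add: abs_divide flat_def[of m 0] del: fact_Suc)
      show "((\<lambda>h. fact (m+2) * \<bar>h\<bar>) \<longlongrightarrow> (0::real)) (at 0)"
        by (rule tendsto_eq_rhs[OF tendsto_mult[OF tendsto_const tendsto_rabs[OF tendsto_ident_at]]]) simp
    qed
    then have "DERIV (flat m) 0 :> 0" unfolding DERIV_def .
    then show ?thesis using 3 by (simp add: flat_def[of "Suc (Suc m)"] flat_def[of "Suc m"])
  qed
qed

lemma C_k_flat: "C_k k (\<lambda>x::'a::euclidean_space. flat m (1 - x \<bullet> x))"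
proof (induction k arbitrary: m)
  case 0
  have "continuous_on UNIV (flat m)"
    using DERIV_isCont[OF flat_deriv] by (intro continuous_at_imp_continuous_on) blast
  then show ?case by (auto intro!: continuous_on_compose2[of UNIV "flat m"] continuous_intros)
next
  case (Suc k)
  have d: "((\<lambda>x::'a. flat m (1 - x \<bullet> x)) has_derivative
      (\<lambda>h. (flat (m+2) (1 - x \<bullet> x) - real m * flat (m+1) (1 - x \<bullet> x)) * (- 2 * (x \<bullet> h)))) (at x)" for x
  proof -
    have "((\<lambda>x::'a. 1 - x \<bullet> x) has_derivative (\<lambda>h. - 2 * (x \<bullet> h))) (at x)"
      by (auto intro!: derivative_eq_intros simp: inner_commute)
    from has_derivative_compose[OF this has_field_derivative_imp_has_derivative[OF flat_deriv]]
    show ?thesis .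
  qed
  have "pd i (\<lambda>x::'a. flat m (1 - x \<bullet> x)) = (\<lambda>x. (flat (m+2) (1 - x \<bullet> x) + (- real m) * flat (m+1) (1 - x \<bullet> x)) * (- 2 * (x \<bullet> i)))" for i
    using pd_eqI[OF d] by (auto simp: fun_eq_iff)
  moreover have "(\<lambda>x::'a. flat m (1 - x \<bullet> x)) differentiable (at x)" for x
    using d unfolding differentiable_def by blast
  ultimately show ?case unfolding C_k_Suc
    by (simp only:) (intro conjI allI ballI C_k_mult C_k_add C_k_const C_k_inner Suc; simp)
qed

text \<open>The standard bump exp (-1 / (1 - |x|^2)) on the open unit ball, extended by 0.\<close>

definition bump :: "'a::euclidean_space \<Rightarrow> real" where
  "bump x = flat 0 (1 - x \<bullet> x)"

lemma bump_C_infinity: "C_infinity bump"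
  unfolding C_infinity_def bump_def[abs_def] using C_k_flat by blast

lemma bump_nonneg: "0 \<le> bump x" and bump_le_1: "bump x \<le> 1"
  by (auto simp: bump_def flat_def)

lemma bump_pos_iff: "0 < bump x \<longleftrightarrow> norm x < 1"
proof -
  have "x \<bullet> x < 1 \<longleftrightarrow> norm x < 1" by (simp add: dot_square_norm power_less_one_iff)
  then show ?thesis by (auto simp: bump_def flat_def)
qed

lemma bump_zero: "norm x \<ge> 1 \<Longrightarrow> bump x = 0"
  using bump_pos_iff[of x] bump_nonneg[of x] by linarith

section \<open>Test functions and mollifiers\<close>

text \<open>Replaces the closure of the support by an arbitrary compact set outside which the
  function vanishes; such a set is what sums, products and convolutions provide.\<close>

lemma test_iff:
  "test_function S \<phi> \<longleftrightarrow> C_infinity \<phi> \<and> (\<exists>K. compact K \<and> K \<subseteq> S \<and> (\<forall>x. x \<notin> K \<longrightarrow> \<phi> x = 0))"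
proof safe
  assume "test_function S \<phi>"
  then show "C_infinity \<phi>" "\<exists>K. compact K \<and> K \<subseteq> S \<and> (\<forall>x. x \<notin> K \<longrightarrow> \<phi> x = 0)"
    unfolding test_function_def using closure_subset[of "{x. \<phi> x \<noteq> 0}"] by blast+
next
  fix K assume K: "C_infinity \<phi>" "compact K" "K \<subseteq> S" "\<forall>x. x \<notin> K \<longrightarrow> \<phi> x = 0"
  then have "closure {x. \<phi> x \<noteq> 0} \<subseteq> K" by (intro closure_minimal compact_imp_closed) auto
  with K show "test_function S \<phi>" unfolding test_function_def
    using compact_closure[of "{x. \<phi> x \<noteq> 0}"] bounded_subset[OF compact_imp_bounded[OF K(2)]]
    closure_subset[of "{x. \<phi> x \<noteq> 0}"] by blast
qed

lemma test_functionI: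
  "C_infinity \<phi> \<Longrightarrow> compact K \<Longrightarrow> K \<subseteq> S \<Longrightarrow> (\<And>x. x \<notin> K \<Longrightarrow> \<phi> x = 0) \<Longrightarrow> test_function S \<phi>"
  using test_iff by blast

lemma test_functionE:
  assumes "test_function S \<phi>"
  obtains K where "C_infinity \<phi>" "compact K" "K \<subseteq> S" "\<And>x. x \<notin> K \<Longrightarrow> \<phi> x = 0"
  using assms test_iff by blast

lemma test_mono: "test_function S \<phi> \<Longrightarrow> S \<subseteq> T \<Longrightarrow> test_function T \<phi>"
  using test_iff by (metis subset_trans)

lemma test_C_infinity: "test_function S \<phi> \<Longrightarrow> C_infinity \<phi>"
  by (simp add: test_function_def)

lemma test_zero: "test_function S \<phi> \<Longrightarrow> x \<notin> S \<Longrightarrow> \<phi> x = 0"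
  by (meson subsetD test_functionE)

lemma pd_zero_outside:
  assumes "closed K" "\<And>x. x \<notin> K \<Longrightarrow> \<phi> x = 0" "x \<notin> K"
  shows "pd i \<phi> x = 0"
proof -
  have "((\<lambda>x. 0) has_derivative (\<lambda>h. 0)) (at x)" by simp
  then have "(\<phi> has_derivative (\<lambda>h. 0)) (at x)"
    by (rule has_derivative_transform_within_open[OF _ open_Compl[OF assms(1)]]) (use assms in auto)
  then show ?thesis using pd_eqI by blast
qed

lemma test_pd:
  assumes "test_function S \<phi>" "i \<in> Basis"
  shows "test_function S (pd i \<phi>)"
proof -
  obtain K where K: "C_infinity \<phi>" "compact K" "K \<subseteq> S" "\<And>x. x \<notin> K \<Longrightarrow> \<phi> x = 0"
    using assms test_functionE by blast
  show ?thesis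
    by (rule test_functionI[OF C_infinity_pd[OF K(1) assms(2)] K(2,3)])
      (rule pd_zero_outside[OF compact_imp_closed[OF K(2)] K(4)])
qed

lemma test_add:
  assumes "test_function S f" "test_function S g"
  shows "test_function S (\<lambda>x. f x + g x)"
proof -
  obtain K where K: "C_infinity f" "compact K" "K \<subseteq> S" "\<And>x. x \<notin> K \<Longrightarrow> f x = 0"
    using assms test_functionE by blast
  obtain L where L: "C_infinity g" "compact L" "L \<subseteq> S" "\<And>x. x \<notin> L \<Longrightarrow> g x = 0"
    using assms test_functionE by blast
  show ?thesis
    using K L by (intro test_functionI[of _ "K \<union> L"] C_infinity_add) auto
qed

lemma test_mult:
  assumes "C_infinity f" "test_function S g"
  shows "test_function S (\<lambda>x. f x * g x)"
proof -
  obtain L where L: "C_infinity g" "compact L" "L \<subseteq> S" "\<And>x. x \<notin> L \<Longrightarrow> g x = 0"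
    using assms test_functionE by blast
  show ?thesis
    using assms L by (intro test_functionI[of _ L] C_infinity_mult) auto
qed

lemma test_cmult: "test_function S g \<Longrightarrow> test_function S (\<lambda>x. c * g x)"
  by (rule test_mult) simp

lemma test_0: "test_function S (\<lambda>x. 0)"
  by (rule test_functionI[of _ "{}"]) auto

lemma test_cont: "test_function S \<phi> \<Longrightarrow> continuous_on A \<phi>"
  using C_infinity_cont test_C_infinity by blast

lemma test_borel [measurable_dest]: "test_function S \<phi> \<Longrightarrow> \<phi> \<in> borel_measurable borel"
  using test_cont by (intro borel_measurable_continuous_onI) blast

lemma C_infinity_borel: "C_infinity \<phi> \<Longrightarrow> \<phi> \<in> borel_measurable borel"
  using C_infinity_cont by (intro borel_measurable_continuous_onI) blast

lemma C_infinity_grad_borel: "C_infinity \<phi> \<Longrightarrow> grad \<phi> \<in> borel_measurable borel"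
  using C_infinity_grad_cont by (intro borel_measurable_continuous_onI) blast

lemma test_bounded:
  assumes "test_function S \<phi>"
  obtains B where "B > 0" "\<And>x. \<bar>\<phi> x\<bar> \<le> B"
proof -
  obtain K where K: "C_infinity \<phi>" "compact K" "K \<subseteq> S" "\<And>x. x \<notin> K \<Longrightarrow> \<phi> x = 0"
    using assms test_functionE by blast
  have "bounded (\<phi> ` K)"
    using compact_imp_bounded compact_continuous_image C_infinity_cont K by blast
  then obtain B where B: "B > 0" "\<And>x. x \<in> K \<Longrightarrow> \<bar>\<phi> x\<bar> \<le> B"
    unfolding bounded_pos by auto
  show ?thesis
  proof (rule that[OF B(1)])
    show "\<bar>\<phi> x\<bar> \<le> B" for x using B K(4)[of x] by (cases "x \<in> K") auto
  qed
qed

lemma continuous_compact_support_integrable: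
  fixes f :: "'a::euclidean_space \<Rightarrow> 'b::{banach,second_countable_topology}"
  assumes "continuous_on UNIV f" "compact K" "\<And>x. x \<notin> K \<Longrightarrow> f x = 0"
  shows "integrable lborel f"
proof -
  have "integrable lborel (restr K f)"
    using assms(1,2) by (intro borel_integrable_compact) (auto intro: continuous_on_subset)
  moreover have "restr K f = f" using assms(3) by (auto simp: fun_eq_iff indicator_def)
  ultimately show ?thesis by simp
qed

lemma test_integrable: "test_function S \<phi> \<Longrightarrow> integrable lborel \<phi>"
  by (metis C_infinity_cont continuous_compact_support_integrable test_functionE)

lemma test_zero_grad: "test_function S \<phi> \<Longrightarrow> x \<notin> S \<Longrightarrow> grad \<phi> x = 0"
  unfolding grad_def by (simp add: test_zero[OF test_pd])

lemma test_grad_bounded: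
  assumes "test_function S \<phi>"
  obtains B where "B > 0" "\<And>x. norm (grad \<phi> x) \<le> B"
proof -
  have "\<exists>B. B > 0 \<and> (\<forall>x. \<bar>pd i \<phi> x\<bar> \<le> B)" if "i \<in> Basis" for i
    using test_bounded[OF test_pd[OF assms that]] by blast
  then obtain B where B: "\<And>i x. i \<in> Basis \<Longrightarrow> B i > 0 \<and> \<bar>pd i \<phi> x\<bar> \<le> B i" by metis
  have "norm (grad \<phi> x) \<le> (\<Sum>i\<in>Basis. B i)" for x
    using norm_le_l1[of "grad \<phi> x"] B sum_mono[of Basis "\<lambda>i. \<bar>grad \<phi> x \<bullet> i\<bar>" B]
    by (force simp: grad_inner)
  moreover have "(\<Sum>i\<in>Basis. B i) > 0" using B by (intro sum_pos) auto
  ultimately show ?thesis using that by blast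
qed

lemma lipschitz_from_grad:
  assumes "\<And>x. \<phi> differentiable (at x)" "\<And>x. x \<in> S \<Longrightarrow> norm (grad \<phi> x) \<le> B" "convex S" "x \<in> S" "y \<in> S"
  shows "\<bar>\<phi> x - \<phi> y\<bar> \<le> B * norm (x - y)"
proof -
  have "onorm (\<lambda>h. grad \<phi> z \<bullet> h) \<le> norm (grad \<phi> z)" for z
    by (rule onorm_le) (simp add: Cauchy_Schwarz_ineq2)
  then have "onorm (\<lambda>h. grad \<phi> z \<bullet> h) \<le> B" if "z \<in> S" for z
    using assms(2)[OF that] order_trans by blast
  from differentiable_bound[OF assms(3) has_derivative_at_withinI[OF has_derivative_grad[OF assms(1)]] this assms(4,5)]
  show ?thesis by simp
qed

lemma test_lipschitz:
  assumes "test_function S \<phi>"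
  obtains B where "B > 0" "\<And>x y. \<bar>\<phi> x - \<phi> y\<bar> \<le> B * norm (x - y)"
proof -
  obtain B where "B > 0" "\<And>x. norm (grad \<phi> x) \<le> B" using test_grad_bounded[OF assms] by blast
  then show ?thesis
    using that lipschitz_from_grad[of \<phi> UNIV B] C_infinity_diff[OF test_C_infinity[OF assms]] by auto
qed

lemma test_grad_lipschitz:
  assumes "test_function S \<phi>"
  obtains B where "B > 0" "\<And>x y. norm (grad \<phi> x - grad \<phi> y) \<le> B * norm (x - y)"
proof -
  have "\<exists>B. B > 0 \<and> (\<forall>x y. \<bar>pd i \<phi> x - pd i \<phi> y\<bar> \<le> B * norm (x - y))" if "i \<in> Basis" for i
    using test_lipschitz[OF test_pd[OF assms that]] by metis
  then obtain B where B: "\<And>i x y. i \<in> Basis \<Longrightarrow> B i > 0 \<and> \<bar>pd i \<phi> x - pd i \<phi> y\<bar> \<le> B i * norm (x - y)" by metis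
  have "norm (grad \<phi> x - grad \<phi> y) \<le> (\<Sum>i\<in>Basis. B i) * norm (x - y)" for x y
    using norm_le_l1[of "grad \<phi> x - grad \<phi> y"] B
      sum_mono[of Basis "\<lambda>i. \<bar>(grad \<phi> x - grad \<phi> y) \<bullet> i\<bar>" "\<lambda>i. B i * norm (x - y)"]
    by (force simp: grad_inner inner_diff_left sum_distrib_right)
  moreover have "(\<Sum>i\<in>Basis. B i) > 0" using B by (intro sum_pos) auto
  ultimately show ?thesis using that by blast
qed

text \<open>The mean value inequality for \<open>\<phi>\<close> minus its linearization, with the
  Lipschitz bound on the gradient. A remainder that is quadratic uniformly in x allows
  differentiation of a convolution under the integral sign by direct estimate.\<close>

lemma test_taylor:
  assumes "test_function S \<phi>"
  obtains B where "B > 0" "\<And>x h. \<bar>\<phi> (x + h) - \<phi> x - grad \<phi> x \<bullet> h\<bar> \<le> B * (norm h)\<^sup>2"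
proof -
  obtain B where B: "B > 0" "\<And>x y. norm (grad \<phi> x - grad \<phi> y) \<le> B * norm (x - y)"
    using test_grad_lipschitz[OF assms] by blast
  have "norm (\<phi> (x + h) - \<phi> x - grad \<phi> x \<bullet> (x + h - x)) \<le> norm (x + h - x) * (B * norm h)" for x h
  proof (rule differentiable_bound_linearization[of x "x + h" "cball x (norm h)" \<phi> "\<lambda>z h. grad \<phi> z \<bullet> h" x])
    fix z assume "z \<in> cball x (norm h)"
    then have "norm (z - x) \<le> norm h" by (simp add: dist_norm norm_minus_commute)
    then have "norm (grad \<phi> z - grad \<phi> x) \<le> B * norm h"
      by (meson B(1) B(2) mult_left_mono order_less_imp_le order_trans)
    moreover have "onorm (\<lambda>k. (grad \<phi> z - grad \<phi> x) \<bullet> k) \<le> norm (grad \<phi> z - grad \<phi> x)"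
      by (rule onorm_le) (simp add: Cauchy_Schwarz_ineq2)
    ultimately show "onorm ((\<lambda>h. grad \<phi> z \<bullet> h) - (\<lambda>h. grad \<phi> x \<bullet> h)) \<le> B * norm h"
      by (simp add: fun_diff_def inner_diff_left)
  next
    show "x + t *\<^sub>R (x + h - x) \<in> cball x (norm h)" if "t \<in> {0..1}" for t
      using that by (auto simp: dist_norm mult_left_le_one_le)
  qed (auto intro!: has_derivative_at_withinI has_derivative_grad C_infinity_diff test_C_infinity[OF assms])
  then show ?thesis using that[OF B(1)] by (auto simp: power2_eq_square mult_ac)
qed

section \<open>Affine changes of variables\<close>

lemma lborel_integrable_affine:
  fixes f :: "'a::euclidean_space \<Rightarrow> 'b::{banach,second_countable_topology}"
  assumes "integrable lborel f" "c \<noteq> 0"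
  shows "integrable lborel (\<lambda>x. f (t + c *\<^sub>R x))"
proof -
  have [measurable]: "f \<in> borel_measurable borel" using assms by auto
  have "integrable (density (distr lborel borel (\<lambda>x. t + c *\<^sub>R x)) (\<lambda>_. ennreal (\<bar>c\<bar>^DIM('a)))) f"
    using assms lborel_affine[of c t] by (simp add: ennreal_power)
  then have "integrable lborel (\<lambda>x. \<bar>c\<bar>^DIM('a) *\<^sub>R f (t + c *\<^sub>R x))"
    by (subst (asm) integrable_density) (auto simp: integrable_distr_eq)
  from integrable_scaleR_right[OF this, of "inverse (\<bar>c\<bar>^DIM('a))"] show ?thesis using assms(2) by simp
qed

lemma lborel_integral_affine:
  fixes f :: "'a::euclidean_space \<Rightarrow> 'b::{banach,second_countable_topology}"
  assumes [measurable]: "f \<in> borel_measurable borel" and "c \<noteq> 0"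
  shows "(LBINT x. f x) = \<bar>c\<bar>^DIM('a) *\<^sub>R (LBINT x. f (t + c *\<^sub>R x))"
proof -
  have "(LBINT x. f x) = integral\<^sup>L (density (distr lborel borel (\<lambda>x. t + c *\<^sub>R x)) (\<lambda>_. ennreal (\<bar>c\<bar>^DIM('a)))) f"
    using assms lborel_affine[of c t] by (simp add: ennreal_power)
  also have "\<dots> = \<bar>c\<bar>^DIM('a) *\<^sub>R (LBINT x. f (t + c *\<^sub>R x))"
    by (subst integral_density) (auto simp: integral_distr)
  finally show ?thesis .
qed

lemma lborel_nn_integral_affine:
  fixes f :: "'a::euclidean_space \<Rightarrow> ennreal"
  assumes [measurable]: "f \<in> borel_measurable borel" and "c \<noteq> 0"
  shows "(\<integral>\<^sup>+x. f x \<partial>lborel) = ennreal (\<bar>c\<bar>^DIM('a)) * (\<integral>\<^sup>+x. f (t + c *\<^sub>R x) \<partial>lborel)"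
proof -
  have "(\<integral>\<^sup>+x. f x \<partial>lborel) = integral\<^sup>N (density (distr lborel borel (\<lambda>x. t + c *\<^sub>R x)) (\<lambda>_. ennreal (\<bar>c\<bar>^DIM('a)))) f"
    using assms lborel_affine[of c t] by (simp add: ennreal_power)
  also have "\<dots> = ennreal (\<bar>c\<bar>^DIM('a)) * (\<integral>\<^sup>+x. f (t + c *\<^sub>R x) \<partial>lborel)"
    by (subst nn_integral_density) (auto simp: nn_integral_distr nn_integral_cmult)
  finally show ?thesis .
qed

section \<open>Mollifiers of unit mass\<close>

definition bump_mass :: "'a::euclidean_space itself \<Rightarrow> real" where
  "bump_mass _ = (LBINT x. bump (x::'a))"

lemma bump_test: "test_function UNIV (bump :: 'a::euclidean_space \<Rightarrow> real)"
  by (rule test_functionI[OF bump_C_infinity, of "cball 0 1"]) (auto intro: bump_zero)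

lemma bump_mass_pos: "bump_mass TYPE('a::euclidean_space) > 0"
proof -
  have i: "integrable lborel (bump :: 'a \<Rightarrow> real)" using test_integrable bump_test by blast
  have "bump_mass TYPE('a) \<noteq> 0"
  proof
    assume "bump_mass TYPE('a) = 0"
    then have "AE x in lborel. bump (x::'a) = 0"
      using integral_nonneg_eq_0_iff_AE[OF i] bump_nonneg by (auto simp: bump_mass_def)
    then have "AE x in lborel. x \<notin> ball (0::'a) 1"
      by eventually_elim (use bump_pos_iff in \<open>force simp: \<close>)
    then have "ball (0::'a) 1 \<in> null_sets lborel" by (subst (asm) AE_iff_null_sets[symmetric]) auto
    then have "emeasure lborel (ball (0::'a) 1) = 0" by auto
    then show False using emeasure_lborel_ball_finite negligible_iff_emeasure0[of "ball (0::'a) 1"]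
      open_not_negligible[of "ball (0::'a) 1"] by auto
  qed
  moreover have "bump_mass TYPE('a) \<ge> 0" unfolding bump_mass_def by (intro integral_nonneg_AE) (auto simp: bump_nonneg)
  ultimately show ?thesis by linarith
qed

definition mollifier :: "real \<Rightarrow> 'a::euclidean_space \<Rightarrow> real" where
  "mollifier s x = bump ((1/s) *\<^sub>R x) / (s ^ DIM('a) * bump_mass TYPE('a))"

lemma mollifier_C_infinity: "C_infinity (mollifier s)"
proof -
  have "C_infinity (\<lambda>x::'a. (1 / (s ^ DIM('a) * bump_mass TYPE('a))) * bump ((1/s) *\<^sub>R x + 0))"
    by (intro C_infinity_mult C_infinity_const C_infinity_affine bump_C_infinity)
  then show ?thesis by (simp add: mollifier_def[abs_def])
qed

context
  fixes s :: real assumes s: "0 < s"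
begin

lemma mollifier_nonneg: "0 \<le> mollifier s (x::'a::euclidean_space)"
  using s bump_nonneg[of "(1/s) *\<^sub>R x"] bump_mass_pos[where 'a='a] by (simp add: mollifier_def)

lemma mollifier_zero: "s \<le> norm (x::'a::euclidean_space) \<Longrightarrow> mollifier s x = 0"
  using s by (auto simp: mollifier_def intro!: bump_zero)

lemma mollifier_bound: "mollifier s (x::'a::euclidean_space) \<le> 1 / (s ^ DIM('a) * bump_mass TYPE('a))"
  using s bump_le_1[of "(1/s) *\<^sub>R x"] bump_mass_pos[where 'a='a] by (simp add: mollifier_def divide_right_mono)

lemma mollifier_test: "test_function UNIV (mollifier s :: 'a::euclidean_space \<Rightarrow> real)"
  using s by (intro test_functionI[OF mollifier_C_infinity, of "cball 0 s"]) (auto intro: mollifier_zero)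

lemma mollifier_integrable: "integrable lborel (mollifier s :: 'a::euclidean_space \<Rightarrow> real)"
  using mollifier_test test_integrable by blast

lemma mollifier_integral: "(LBINT x. mollifier s (x::'a::euclidean_space)) = 1"
proof -
  have "(LBINT x. mollifier s (x::'a)) = s ^ DIM('a) *\<^sub>R (LBINT x. mollifier s (0 + s *\<^sub>R (x::'a)))"
    using s by (subst lborel_integral_affine[of _ s 0]) (auto intro!: C_infinity_borel mollifier_C_infinity)
  also have "\<dots> = 1" using s bump_mass_pos[where 'a='a]
    by (simp add: mollifier_def bump_mass_def)
  finally show ?thesis .
qed

lemma mollifier_borel [measurable]: "mollifier s \<in> borel_measurable borel"
  by (intro C_infinity_borel mollifier_C_infinity)

end

section \<open>Convolution\<close>

definition conv :: "('a::euclidean_space \<Rightarrow> real) \<Rightarrow> ('a \<Rightarrow> 'b::euclidean_space) \<Rightarrow> 'a \<Rightarrow> 'b" where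
  "conv \<eta> f x = (LBINT y. \<eta> (x - y) *\<^sub>R f y)"

lemma conv_integrable:
  fixes f :: "'a::euclidean_space \<Rightarrow> 'b::euclidean_space"
  assumes "test_function S \<eta>" "integrable lborel f"
  shows "integrable lborel (\<lambda>y. \<eta> (x - y) *\<^sub>R f y)"
proof -
  obtain B where B: "B > 0" "\<And>x. \<bar>\<eta> x\<bar> \<le> B" using test_bounded[OF assms(1)] by blast
  have [measurable]: "\<eta> \<in> borel_measurable borel" using test_borel assms by blast
  have [measurable]: "f \<in> borel_measurable borel" using assms by auto
  show ?thesis
    by (rule Bochner_Integration.integrable_bound[of _ "\<lambda>y. B *\<^sub>R f y"])
      (use assms B in \<open>auto intro!: mult_right_mono\<close>)
qed

lemma conv_borel [measurable]:
  fixes f :: "'a::euclidean_space \<Rightarrow> 'b::euclidean_space"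
  assumes [measurable]: "\<eta> \<in> borel_measurable borel" "f \<in> borel_measurable borel"
  shows "conv \<eta> f \<in> borel_measurable borel"
  unfolding conv_def[abs_def] by measurable

text \<open>The Taylor remainder of \<open>\<eta>\<close> is at most
  \<open>B * (norm h)\<^sup>2\<close> at every point, so integrating it against |f| leaves an error
  quadratic in h, for any integrable f.\<close>

lemma conv_has_derivative:
  fixes f :: "'a::euclidean_space \<Rightarrow> real"
  assumes t: "test_function S \<eta>" and f: "integrable lborel f"
  shows "(conv \<eta> f has_derivative (\<lambda>h. (LBINT y. f y *\<^sub>R grad \<eta> (x - y)) \<bullet> h)) (at x)"
proof -
  obtain B where B: "B > 0" "\<And>x h. \<bar>\<eta> (x + h) - \<eta> x - grad \<eta> x \<bullet> h\<bar> \<le> B * (norm h)\<^sup>2"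
    using test_taylor[OF t] by blast
  obtain G where G: "G > 0" "\<And>x. norm (grad \<eta> x) \<le> G" using test_grad_bounded[OF t] by blast
  have [measurable]: "\<eta> \<in> borel_measurable borel" "grad \<eta> \<in> borel_measurable borel"
    using test_borel t C_infinity_grad_borel test_C_infinity by blast+
  have [measurable]: "f \<in> borel_measurable borel" using f by auto
  have ig: "integrable lborel (\<lambda>y. f y *\<^sub>R grad \<eta> (x - y))"
    by (rule Bochner_Integration.integrable_bound[of _ "\<lambda>y. G *\<^sub>R f y"])
      (use f G in \<open>auto simp: abs_mult mult.commute[of G] intro!: mult_left_mono\<close>)
  define D where "D = (LBINT y. f y *\<^sub>R grad \<eta> (x - y))"
  define N where "N = (LBINT y. \<bar>f y\<bar>)"
  have D: "D \<bullet> h = (LBINT y. f y * (grad \<eta> (x - y) \<bullet> h))" for h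
    unfolding D_def using integral_inner_left[OF ig, of h] by simp
  have bd: "\<bar>conv \<eta> f (x + h) - conv \<eta> f x - D \<bullet> h\<bar> \<le> B * N * (norm h)\<^sup>2" for h
  proof -
    have i1: "integrable lborel (\<lambda>y. \<eta> (z - y) * f y)" for z
      using conv_integrable[OF t f, of z] by simp
    have i2: "integrable lborel (\<lambda>y. f y * (grad \<eta> (x - y) \<bullet> h))"
      using integrable_inner_left[OF ig, of h] by simp
    have "conv \<eta> f (x + h) - conv \<eta> f x - D \<bullet> h =
      (LBINT y. \<eta> (x + h - y) * f y - \<eta> (x - y) * f y - f y * (grad \<eta> (x - y) \<bullet> h))"
      unfolding conv_def D by (simp add: i1 i2)
    also have "\<bar>\<dots>\<bar> \<le> (LBINT y. B * (norm h)\<^sup>2 * \<bar>f y\<bar>)"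
      unfolding real_norm_def[symmetric]
    proof (rule order_trans[OF integral_norm_bound integral_mono])
      fix y
      have "norm (\<eta> (x + h - y) * f y - \<eta> (x - y) * f y - f y * (grad \<eta> (x - y) \<bullet> h))
        = \<bar>\<eta> ((x - y) + h) - \<eta> (x - y) - grad \<eta> (x - y) \<bullet> h\<bar> * \<bar>f y\<bar>"
        unfolding abs_mult[symmetric] by (simp add: algebra_simps)
      also have "\<dots> \<le> B * (norm h)\<^sup>2 * \<bar>f y\<bar>" using B(2)[of "x-y" h] by (intro mult_right_mono) auto
      finally show "norm (\<eta> (x + h - y) * f y - \<eta> (x - y) * f y - f y * (grad \<eta> (x - y) \<bullet> h)) \<le> B * (norm h)\<^sup>2 * norm (f y)" by simp
    qed (use i1 i2 f in auto)
    also have "\<dots> = B * N * (norm h)\<^sup>2" by (simp add: N_def)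
    finally show ?thesis .
  qed
  have "((\<lambda>h. norm (conv \<eta> f (x + h) - conv \<eta> f x - D \<bullet> h) / norm h) \<longlongrightarrow> 0) (at 0)"
  proof (rule Lim_null_comparison)
    have "norm (conv \<eta> f (x + h) - conv \<eta> f x - D \<bullet> h) / norm h \<le> B * N * norm h" for h
    proof (cases "h = 0")
      case False
      then show ?thesis using bd[of h] by (simp add: pos_divide_le_eq power2_eq_square mult.assoc)
    qed simp
    then show "\<forall>\<^sub>F h in at 0. norm (norm (conv \<eta> f (x + h) - conv \<eta> f x - D \<bullet> h) / norm h) \<le> B * N * norm h"
      by (intro always_eventually allI) simp
    show "((\<lambda>h. B * N * norm h) \<longlongrightarrow> 0) (at 0)"
      by (rule tendsto_eq_rhs[OF tendsto_mult[OF tendsto_const tendsto_norm[OF tendsto_ident_at]]]) simp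
  qed
  then show ?thesis unfolding has_derivative_at D_def[symmetric] by (simp add: bounded_linear_inner_right)
qed

lemma pd_conv:
  fixes f :: "'a::euclidean_space \<Rightarrow> real"
  assumes t: "test_function S \<eta>" and f: "integrable lborel f" and i: "i \<in> Basis"
  shows "pd i (conv \<eta> f) x = conv (pd i \<eta>) f x"
proof -
  obtain G where G: "G > 0" "\<And>x. norm (grad \<eta> x) \<le> G" using test_grad_bounded[OF t] by blast
  have [measurable]: "grad \<eta> \<in> borel_measurable borel"
    using t C_infinity_grad_borel test_C_infinity by blast
  have [measurable]: "f \<in> borel_measurable borel" using f by auto
  have ig: "integrable lborel (\<lambda>y. f y *\<^sub>R grad \<eta> (x - y))"
    by (rule Bochner_Integration.integrable_bound[of _ "\<lambda>y. G *\<^sub>R f y"])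
      (use f G in \<open>auto simp: abs_mult mult.commute[of G] intro!: mult_left_mono\<close>)
  show ?thesis
    using pd_eqI[OF conv_has_derivative[OF t f], of i x] integral_inner_left[OF ig, of i] i
    by (simp add: conv_def grad_inner mult.commute)
qed

text \<open>Every derivative can be moved onto the kernel, whose partial derivatives are again test
  functions; hence the induction generalises over the kernel.\<close>

lemma conv_C_infinity:
  fixes f :: "'a::euclidean_space \<Rightarrow> real"
  assumes "test_function S \<eta>" "integrable lborel f"
  shows "C_infinity (conv \<eta> f)"
proof -
  have "C_k k (conv \<eta> f)" if "test_function S \<eta>" for k and \<eta> :: "'a \<Rightarrow> real"
    using that
  proof (induction k arbitrary: \<eta>)
    case (0 \<eta>)
    have "continuous (at x) (conv \<eta> f)" for x
      using has_derivative_continuous[OF conv_has_derivative[OF 0 assms(2)]] .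
    then show ?case by (auto intro: continuous_at_imp_continuous_on)
  next
    case (Suc k \<eta>)
    have "conv \<eta> f differentiable (at x)" for x
      using conv_has_derivative[OF Suc.prems assms(2)] unfolding differentiable_def by blast
    moreover have "C_k k (pd i (conv \<eta> f))" if "i \<in> Basis" for i
    proof -
      have "pd i (conv \<eta> f) = conv (pd i \<eta>) f" using pd_conv[OF Suc.prems assms(2) that] by blast
      then show ?thesis using Suc.IH[OF test_pd[OF Suc.prems that]] by simp
    qed
    ultimately show ?case by (simp add: C_k_Suc)
  qed
  then show ?thesis using assms by (simp add: C_infinity_def)
qed

section \<open>Weak derivatives and convolution\<close>

lemma test_reflect:
  fixes \<eta> :: "'a::euclidean_space \<Rightarrow> real"
  assumes "C_infinity \<eta>" "\<And>z. s \<le> norm z \<Longrightarrow> \<eta> z = 0" "cball x s \<subseteq> S"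
  shows "test_function S (\<lambda>y. \<eta> (x - y))" and "pd i (\<lambda>y. \<eta> (x - y)) y = - pd i \<eta> (x - y)"
proof -
  have eq: "(\<lambda>y. \<eta> (x - y)) = (\<lambda>y. \<eta> ((-1) *\<^sub>R y + x))" by (simp add: fun_eq_iff)
  show "test_function S (\<lambda>y. \<eta> (x - y))"
  proof (rule test_functionI[of _ "cball x s"])
    show "C_infinity (\<lambda>y. \<eta> (x - y))" unfolding eq by (rule C_infinity_affine[OF assms(1)])
    show "\<eta> (x - y) = 0" if "y \<notin> cball x s" for y using that assms(2)[of "x - y"] by (simp add: dist_norm)
  qed (use assms in auto)
  show "pd i (\<lambda>y. \<eta> (x - y)) y = - pd i \<eta> (x - y)"
    unfolding eq using pd_affine[of \<eta> i "-1" x y] C_infinity_diff[OF assms(1)] by simp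
qed

text \<open>The identity of \<open>has_weak_gradient\<close> for functions given on the whole space
  and Borel integrals over it, with integrability kept separate. Test functions vanish off
  \<open>S\<close>, so the integrals see \<open>f\<close> and \<open>G\<close> on \<open>S\<close>
  only.\<close>

definition weakly_diff :: "'a::euclidean_space set \<Rightarrow> ('a \<Rightarrow> real) \<Rightarrow> ('a \<Rightarrow> 'a) \<Rightarrow> bool" where
  "weakly_diff S f G \<longleftrightarrow> (\<forall>\<phi>. test_function S \<phi> \<longrightarrow> (\<forall>i\<in>Basis.
     (LBINT x. f x * pd i \<phi> x) = - (LBINT x. (G x \<bullet> i) * \<phi> x)))"

text \<open>The kernel reflected about x is a test function in \<open>S\<close> once the closed
  s-ball about x lies in \<open>S\<close>. The sign produced by the reflection cancels the sign of
  the integration by parts.\<close>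

lemma grad_conv:
  fixes f :: "'a::euclidean_space \<Rightarrow> real"
  assumes \<eta>: "C_infinity \<eta>" "\<And>z. s \<le> norm z \<Longrightarrow> \<eta> z = 0"
    and x: "cball x s \<subseteq> S" and f: "integrable lborel f" "integrable lborel G" "weakly_diff S f G"
  shows "grad (conv \<eta> f) x = conv \<eta> G x"
proof (rule euclidean_eqI)
  fix i :: 'a assume i: "i \<in> Basis"
  have t: "test_function UNIV \<eta>"
    using \<eta> by (intro test_functionI[of _ "cball 0 s"]) auto
  have "grad (conv \<eta> f) x \<bullet> i = conv (pd i \<eta>) f x"
    using pd_conv[OF t f(1) i] i by (simp add: grad_inner)
  also have "\<dots> = - (LBINT y. f y * pd i (\<lambda>y. \<eta> (x - y)) y)"
    by (simp add: conv_def test_reflect(2)[OF \<eta> x] mult.commute)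
  also have "\<dots> = (LBINT y. (G y \<bullet> i) * \<eta> (x - y))"
    using f(3) test_reflect(1)[OF \<eta> x] i by (simp add: weakly_diff_def)
  also have "\<dots> = conv \<eta> G x \<bullet> i"
    unfolding conv_def using integral_inner_left[OF conv_integrable[OF t f(2), of x], of i] by (simp add: mult.commute)
  finally show "grad (conv \<eta> f) x \<bullet> i = conv \<eta> G x \<bullet> i" .
qed

text \<open>The bounded weight \<open>g\<close> allows two uses: \<open>g = 1\<close> for the
  integral of a convolution, and a second kernel in place of \<open>g\<close> for iterated
  convolutions.\<close>

lemma conv_Fubini:
  fixes f :: "'a::euclidean_space \<Rightarrow> 'b::euclidean_space" and \<eta> :: "'a \<Rightarrow> real" and g :: "'a \<Rightarrow> real"
  assumes f: "integrable lborel f" and \<eta>: "integrable lborel \<eta>" and [measurable]: "g \<in> borel_measurable borel"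
    and g: "\<And>x. \<bar>g x\<bar> \<le> B"
  shows "integrable (lborel \<Otimes>\<^sub>M lborel) (\<lambda>(x, y). (g x * \<eta> (x - y)) *\<^sub>R f y)"
proof -
  have [measurable]: "f \<in> borel_measurable borel" "\<eta> \<in> borel_measurable borel" using assms by auto
  have B: "0 \<le> B" using g[of 0] by linarith
  have "integrable (lborel \<Otimes>\<^sub>M lborel) (\<lambda>(y, x). (g x * \<eta> (x - y)) *\<^sub>R f y)"
  proof (rule lborel_pair.Fubini_integrable)
    have *: "integrable lborel (\<lambda>x. \<eta> (x - y))" for y
      using lborel_integrable_affine[OF \<eta>, of 1 "-y"] by simp
    have i: "integrable lborel (\<lambda>x. (g x * \<eta> (x - y)) *\<^sub>R f y)" for y
      by (rule Bochner_Integration.integrable_bound[of _ "\<lambda>x. (B * \<eta> (x - y)) *\<^sub>R f y"])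
        (use * g B in \<open>auto simp: abs_mult intro!: mult_right_mono\<close>)
    then show "AE y in lborel. integrable lborel (\<lambda>x. case (y, x) of (y, x) \<Rightarrow> (g x * \<eta> (x - y)) *\<^sub>R f y)" by simp
    show "integrable lborel (\<lambda>y. LBINT x. norm (case (y, x) of (y, x) \<Rightarrow> (g x * \<eta> (x - y)) *\<^sub>R f y))"
    proof (rule Bochner_Integration.integrable_bound[of _ "\<lambda>y. (B * (LBINT x. \<bar>\<eta> x\<bar>)) *\<^sub>R f y"])
      show "AE y in lborel. norm (LBINT x. norm (case (y, x) of (y, x) \<Rightarrow> (g x * \<eta> (x - y)) *\<^sub>R f y))
        \<le> norm ((B * (LBINT x. \<bar>\<eta> x\<bar>)) *\<^sub>R f y)"
      proof (rule AE_I2)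
        fix y
        have "(LBINT x. norm ((g x * \<eta> (x - y)) *\<^sub>R f y)) \<le> (LBINT x. B * (\<bar>\<eta> (x - y)\<bar> * norm (f y)))"
          using integrable_norm[OF i[of y]] *[of y] g B by (intro integral_mono)
            (auto simp: abs_mult mult.assoc intro!: mult_right_mono)
        also have "\<dots> = B * ((LBINT x. \<bar>\<eta> (x - y)\<bar>) * norm (f y))" by simp
        also have "(LBINT x. \<bar>\<eta> (x - y)\<bar>) = (LBINT x. \<bar>\<eta> x\<bar>)"
          using lborel_integral_affine[of "\<lambda>x. \<bar>\<eta> x\<bar>" 1 "-y"] by simp
        finally show "norm (LBINT x. norm (case (y, x) of (y, x) \<Rightarrow> (g x * \<eta> (x - y)) *\<^sub>R f y))
        \<le> norm ((B * (LBINT x. \<bar>\<eta> x\<bar>)) *\<^sub>R f y)" using B by (simp add: abs_mult mult.assoc)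
      qed
    qed (use f in auto)
  qed measurable
  from lborel_pair.integrable_product_swap[OF this] show ?thesis by (simp add: case_prod_beta')
qed

text \<open>Both sides integrate f against the convolution of the two kernels, and the substitution
  of x + z - y for y exchanges the kernels.\<close>

lemma conv_commute:
  fixes f :: "'a::euclidean_space \<Rightarrow> real"
  assumes \<eta>: "test_function UNIV \<eta>" and \<theta>: "test_function UNIV \<theta>" and f: "integrable lborel f"
  shows "conv \<eta> (conv \<theta> f) x = conv \<theta> (conv \<eta> f) x"
proof -
  have *: "conv \<eta> (conv \<theta> f) x = (LBINT z. (LBINT y. \<eta> (x - y) * \<theta> (y - z)) * f z)"
    if \<eta>: "test_function UNIV \<eta>" and \<theta>: "test_function UNIV \<theta>" for \<eta> \<theta> :: "'a \<Rightarrow> real"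
  proof -
    obtain B where B: "B > 0" "\<And>x. \<bar>\<eta> x\<bar> \<le> B" using test_bounded[OF \<eta>] by blast
    have [measurable]: "\<eta> \<in> borel_measurable borel" using test_borel \<eta> by blast
    have "integrable (lborel \<Otimes>\<^sub>M lborel) (\<lambda>(y, z). (\<eta> (x - y) * \<theta> (y - z)) *\<^sub>R f z)"
      by (rule conv_Fubini[OF f test_integrable[OF \<theta>]]) (use B in auto)
    from lborel_pair.Fubini_integral[OF this]
    have "(LBINT z. (LBINT y. (\<eta> (x - y) * \<theta> (y - z)) * f z)) = (LBINT y. (LBINT z. \<eta> (x - y) * (\<theta> (y - z) * f z)))"
      by (simp only: real_scaleR_def mult.assoc)
    then show ?thesis by (simp add: conv_def)
  qed
  have "(LBINT y. \<eta> (x - y) * \<theta> (y - z)) = (LBINT y. \<theta> (x - y) * \<eta> (y - z))" for z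
  proof -
    have [measurable]: "\<eta> \<in> borel_measurable borel" "\<theta> \<in> borel_measurable borel"
      using test_borel \<eta> \<theta> by blast+
    show ?thesis
      using lborel_integral_affine[of "\<lambda>y. \<eta> (x - y) * \<theta> (y - z)" "-1" "x + z"]
      by (simp add: mult.commute)
  qed
  then show ?thesis by (simp add: *[OF \<eta> \<theta>] *[OF \<theta> \<eta>])
qed

lemma conv_integral:
  fixes g :: "'a::euclidean_space \<Rightarrow> 'b::euclidean_space"
  assumes g: "integrable lborel g" and \<eta>: "integrable lborel \<eta>"
  shows "integrable lborel (conv \<eta> g)"
    and "(LBINT x. conv \<eta> g x) = (LBINT x. \<eta> x) *\<^sub>R (LBINT x. g x)"
proof -
  have i: "integrable (lborel \<Otimes>\<^sub>M lborel) (\<lambda>(x, y). \<eta> (x - y) *\<^sub>R g y)"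
    using conv_Fubini[OF g \<eta>, of "\<lambda>_. 1" 1] by simp
  show "integrable lborel (conv \<eta> g)"
    using lborel_pair.integrable_fst[OF i] by (simp add: conv_def[abs_def])
  have "(LBINT x. conv \<eta> g x) = (LBINT y. (LBINT x. \<eta> (x - y) *\<^sub>R g y))"
    using lborel_pair.Fubini_integral[OF i] by (simp add: conv_def)
  also have "\<dots> = (LBINT y. (LBINT x. \<eta> x) *\<^sub>R g y)"
  proof (rule Bochner_Integration.integral_cong[OF refl])
    fix y
    have [measurable]: "\<eta> \<in> borel_measurable borel" using \<eta> by auto
    have "(LBINT x. \<eta> (x - y)) = (LBINT x. \<eta> x)"
      using lborel_integral_affine[of \<eta> 1 "-y"] by simp
    moreover have "integrable lborel (\<lambda>x. \<eta> (x - y))"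
      using lborel_integrable_affine[OF \<eta>, of 1 "-y"] by simp
    ultimately show "(LBINT x. \<eta> (x - y) *\<^sub>R g y) = (LBINT x. \<eta> x) *\<^sub>R g y" by simp
  qed
  finally show "(LBINT x. conv \<eta> g x) = (LBINT x. \<eta> x) *\<^sub>R (LBINT x. g x)" by simp
qed

section \<open>Mollification as averaging against a probability density\<close>

lemma moll_kernel_integral:
  fixes x :: "'a::euclidean_space"
  assumes s: "0 < s"
  shows "integrable lborel (\<lambda>y. mollifier s (x - y :: 'a))" "(LBINT y. mollifier s (x - y :: 'a)) = 1"
proof -
  show "integrable lborel (\<lambda>y. mollifier s (x - y :: 'a))"
    using lborel_integrable_affine[OF mollifier_integrable[OF s], of "-1" x] by simp
  show "(LBINT y. mollifier s (x - y :: 'a)) = 1"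
    using lborel_integral_affine[of "mollifier s :: 'a \<Rightarrow> real" "-1" x] mollifier_integral[OF s, where 'a='a]
     mollifier_borel[OF s] by simp
qed

context
  fixes s :: real and F :: "'a::euclidean_space \<Rightarrow> 'b::euclidean_space"
  assumes s: "0 < s" and F: "integrable lborel F"
begin

lemma conv_norm_le: "norm (conv (mollifier s) F x) \<le> conv (mollifier s) (\<lambda>y. norm (F y)) x"
  unfolding conv_def using integral_norm_bound[of lborel "\<lambda>y. mollifier s (x - y) *\<^sub>R F y"]
  by (simp add: abs_of_nonneg[OF mollifier_nonneg[OF s]])

text \<open>Jensen's inequality for the square: the variance of \<open>F\<close> about its mean
  \<open>m\<close> under the kernel is nonnegative and equals the difference of the two
  sides.\<close>

lemma conv_sq_le:
  assumes F2: "integrable lborel (\<lambda>y. (norm (F y))\<^sup>2)"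
  shows "(norm (conv (mollifier s) F x))\<^sup>2 \<le> conv (mollifier s) (\<lambda>y. (norm (F y))\<^sup>2) x"
proof -
  define m where "m = conv (mollifier s) F x"
  let ?k = "\<lambda>y. mollifier s (x - y)"
  have i1: "integrable lborel (\<lambda>y. ?k y *\<^sub>R F y)" using conv_integrable[OF mollifier_test[OF s] F] .
  have i2: "integrable lborel (\<lambda>y. ?k y * (norm (F y))\<^sup>2)" using conv_integrable[OF mollifier_test[OF s] F2] by simp
  have eq: "?k y * (norm (F y - m))\<^sup>2 = ?k y * (norm (F y))\<^sup>2 - 2 * ((?k y *\<^sub>R F y) \<bullet> m) + ?k y * (norm m)\<^sup>2" for y
    by (simp add: power2_norm_eq_inner inner_diff_left inner_diff_right inner_commute algebra_simps)
  have "0 \<le> (LBINT y. ?k y * (norm (F y - m))\<^sup>2)"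
    by (intro integral_nonneg_AE) (auto simp: mollifier_nonneg[OF s])
  also have "\<dots> = (LBINT y. ?k y * (norm (F y))\<^sup>2) - 2 * ((LBINT y. ?k y *\<^sub>R F y) \<bullet> m) + (LBINT y. ?k y * (norm m)\<^sup>2)"
    unfolding eq using i2 moll_kernel_integral(1)[OF s, of x] integral_inner_left[OF i1, of m] integrable_inner_left[OF i1, of m]
    by simp
  also have "\<dots> = conv (mollifier s) (\<lambda>y. (norm (F y))\<^sup>2) x - (norm m)\<^sup>2"
    using moll_kernel_integral[OF s, of x] by (simp add: conv_def m_def power2_norm_eq_inner)
  finally show ?thesis by (simp add: m_def)
qed

end

section \<open>Approximation by mollification\<close>

lemma abs_add_power_le:
  fixes a b :: real shows "\<bar>a + b\<bar> ^ p \<le> 2 ^ p * (\<bar>a\<bar> ^ p + \<bar>b\<bar> ^ p)"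
proof -
  have "\<bar>a + b\<bar> ^ p \<le> (2 * max \<bar>a\<bar> \<bar>b\<bar>) ^ p" by (intro power_mono) auto
  also have "\<dots> = 2 ^ p * (max \<bar>a\<bar> \<bar>b\<bar>) ^ p" by (simp add: power_mult_distrib)
  also have "(max \<bar>a\<bar> \<bar>b\<bar>) ^ p \<le> \<bar>a\<bar> ^ p + \<bar>b\<bar> ^ p" by (auto simp: max_def)
  finally show ?thesis by simp
qed

definition clip :: "real \<Rightarrow> real \<Rightarrow> real" where "clip M t = max (- M) (min M t)"

lemma clip_abs: "0 \<le> M \<Longrightarrow> \<bar>clip M t\<bar> \<le> M" and clip_id: "\<bar>t\<bar> \<le> M \<Longrightarrow> clip M t = t"
  and clip_diff_le: "0 \<le> M \<Longrightarrow> \<bar>t - clip M t\<bar> \<le> \<bar>t\<bar>"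
  by (auto simp: clip_def)

lemma continuous_clip [continuous_intros]: "continuous_on S f \<Longrightarrow> continuous_on S (\<lambda>x. clip M (f x))"
  unfolding clip_def by (intro continuous_intros)

lemma clip_borel [measurable]: "clip M \<in> borel_measurable borel"
  unfolding clip_def[abs_def] by measurable

text \<open>Lebesgue measurability supplies continuous functions converging to f off a null set.
  Clipping them at height M and cutting them off near the support of f makes dominated convergence
  applicable.\<close>

lemma dense_bounded:
  fixes f :: "'a::euclidean_space \<Rightarrow> real"
  assumes [measurable]: "f \<in> borel_measurable borel" and M: "\<And>x. \<bar>f x\<bar> \<le> M"
    and R: "\<And>x. x \<notin> cball 0 R \<Longrightarrow> f x = 0" and p: "p \<ge> 1" and e: "e > 0"
  shows "\<exists>g. continuous_on UNIV g \<and> (\<forall>x. x \<notin> cball 0 (R + 1) \<longrightarrow> g x = 0) \<and>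
     integrable lborel (\<lambda>x. \<bar>f x - g x\<bar> ^ p) \<and> (LBINT x. \<bar>f x - g x\<bar> ^ p) < e"
proof -
  have M0: "0 \<le> M" using M[of 0] by linarith
  have "f \<in> borel_measurable (lebesgue_on UNIV)"
    by (intro measurable_restrict_space1 measurable_completion) simp
  then have "Equivalence_Measurable_On_Borel.measurable_on f UNIV"
    by (subst measurable_on_iff_borel_measurable) auto
  then obtain N g where N: "negligible N" and g: "\<And>n. continuous_on UNIV (g n)"
     "\<And>x. x \<notin> N \<Longrightarrow> (\<lambda>n. g n x) \<longlonglongrightarrow> f x"
    unfolding measurable_on_def by auto
  have gb [measurable]: "g n \<in> borel_measurable borel" for n using g(1) by (rule borel_measurable_continuous_onI)
  \<comment> \<open>The second factor is a continuous cutoff, equal to 1 on \<open>cball 0 R\<close>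
    and to 0 off \<open>cball 0 (R + 1)\<close>.\<close>
  define h where "h n x = clip M (g n x) * clip 1 (max 0 (R + 1 - norm x))" for n x
  have hc: "continuous_on UNIV (h n)" for n unfolding h_def by (intro continuous_intros g)
  have [measurable]: "h n \<in> borel_measurable borel" for n using hc by (rule borel_measurable_continuous_onI)
  have h0: "h n x = 0" if "x \<notin> cball 0 (R + 1)" for n x using that by (simp add: h_def clip_def)
  have hb: "\<bar>h n x\<bar> \<le> M" for n x
  proof -
    have "\<bar>h n x\<bar> \<le> M * 1" unfolding h_def abs_mult
      by (intro mult_mono clip_abs) (use M0 in auto)
    then show ?thesis by simp
  qed
  have AE: "AE x in lborel. (\<lambda>n. \<bar>f x - h n x\<bar> ^ p) \<longlonglongrightarrow> 0"
  proof -
    have "AE x in lebesgue. x \<notin> N" using N by (simp add: negligible_iff_null_sets AE_not_in)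
    then have "AE x in lebesgue. (\<lambda>n. \<bar>f x - h n x\<bar> ^ p) \<longlonglongrightarrow> 0"
    proof eventually_elim
      case (elim x)
      have "(\<lambda>n. h n x) \<longlonglongrightarrow> clip M (f x) * clip 1 (max 0 (R + 1 - norm x))"
        unfolding h_def clip_def by (intro tendsto_intros g elim)
      also have "clip M (f x) * clip 1 (max 0 (R + 1 - norm x)) = f x"
        using R[of x] by (cases "x \<in> cball 0 R") (use M0 M[of x] in \<open>auto simp: clip_def\<close>)
      finally have "(\<lambda>n. \<bar>f x - h n x\<bar> ^ p) \<longlonglongrightarrow> \<bar>f x - f x\<bar> ^ p" by (intro tendsto_intros)
      moreover have "\<bar>f x - f x\<bar> ^ p = 0" using p by simp
      ultimately show ?case by (simp only:)
    qed
    then show ?thesis by (subst (asm) AE_completion_iff) auto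
  qed
  have dom: "AE x in lborel. norm (\<bar>f x - h n x\<bar> ^ p) \<le> (2 * M) ^ p * indicator (cball 0 (R + 1)) x" for n
  proof (rule AE_I2)
    fix x show "norm (\<bar>f x - h n x\<bar> ^ p) \<le> (2 * M) ^ p * indicator (cball 0 (R + 1)) x"
    proof (cases "x \<in> cball 0 (R + 1)")
      case True
      have "\<bar>f x - h n x\<bar> \<le> 2 * M" using M[of x] hb[of n x] by linarith
      then have "\<bar>f x - h n x\<bar> ^ p \<le> (2 * M) ^ p" by (rule power_mono) simp
      then show ?thesis using True by simp
    next
      case False
      then have "\<bar>f x - h n x\<bar> = 0" using R[of x] h0[of x n] by auto
      then show ?thesis using p False by (simp add: zero_power)
    qed
  qed
  have idom: "integrable lborel (\<lambda>x::'a. (2 * M) ^ p * indicator (cball 0 (R + 1)) x :: real)"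
    using emeasure_lborel_cball_finite[of "0::'a"] by (intro integrable_mult_right integrable_real_indicator) auto
  have lim: "(\<lambda>n. LBINT x. \<bar>f x - h n x\<bar> ^ p) \<longlonglongrightarrow> (\<integral>x. 0 \<partial>(lborel :: 'a measure))"
    by (rule integral_dominated_convergence[OF _ _ idom AE dom]) auto
  have "integrable lborel (\<lambda>x. \<bar>f x - h n x\<bar> ^ p)" for n
    by (rule Bochner_Integration.integrable_bound[OF idom]) (use dom[of n] in auto)
  moreover have "\<exists>n. (LBINT x. \<bar>f x - h n x\<bar> ^ p) < e"
    using order_tendstoD(2)[OF lim, of e] e by (auto simp: eventually_sequentially)
  ultimately show ?thesis using hc h0 by blast
qed

text \<open>The truncations of f at height n converge to f in the p-th mean, dominated by
  \<open>\<bar>f x\<bar> ^ p\<close>; the bounded case applies to one of them.\<close>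

lemma dense_Lp:
  fixes f :: "'a::euclidean_space \<Rightarrow> real"
  assumes [measurable]: "f \<in> borel_measurable borel" and fp: "integrable lborel (\<lambda>x. \<bar>f x\<bar> ^ p)"
    and R: "\<And>x. x \<notin> cball 0 R \<Longrightarrow> f x = 0" and p: "p \<ge> 1" and e: "e > 0"
  shows "\<exists>g. continuous_on UNIV g \<and> (\<forall>x. x \<notin> cball 0 (R + 1) \<longrightarrow> g x = 0) \<and>
     integrable lborel (\<lambda>x. \<bar>f x - g x\<bar> ^ p) \<and> (LBINT x. \<bar>f x - g x\<bar> ^ p) < e"
proof -
  let ?h = "\<lambda>n::nat. \<lambda>x. clip (real n) (f x)"
  have dom: "norm (\<bar>f x - ?h n x\<bar> ^ p) \<le> \<bar>f x\<bar> ^ p" for n x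
    using power_mono[OF clip_diff_le[of "real n" "f x"], of p] by (simp add: power_abs[symmetric])
  have i1: "integrable lborel (\<lambda>x. \<bar>f x - ?h n x\<bar> ^ p)" for n
    by (rule Bochner_Integration.integrable_bound[OF fp]) (use dom in auto)
  have lim: "(\<lambda>n. LBINT x. \<bar>f x - ?h n x\<bar> ^ p) \<longlonglongrightarrow> (\<integral>x. 0 \<partial>(lborel :: 'a measure))"
  proof (rule integral_dominated_convergence[OF _ _ fp])
    show "AE x in lborel. (\<lambda>n. \<bar>f x - ?h n x\<bar> ^ p) \<longlonglongrightarrow> 0"
    proof (rule AE_I2, rule tendsto_eventually)
      fix x
      obtain N :: nat where N: "\<bar>f x\<bar> \<le> real N" using real_arch_simple by blast
      have "\<bar>f x - ?h n x\<bar> ^ p = 0" if "n \<ge> N" for n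
        using clip_id[of "f x" "real n"] N that p by simp
      then show "\<forall>\<^sub>F n in sequentially. \<bar>f x - ?h n x\<bar> ^ p = 0"
        unfolding eventually_sequentially by blast
    qed
  qed (use dom in auto)
  \<comment> \<open>Half of e for each of the two approximations, divided by the constant
    \<open>2 ^ p\<close> of \<open>abs_add_power_le\<close>.\<close>
  define d where "d = e / (2 ^ p * 2)"
  have d: "d > 0" using e by (simp add: d_def)
  obtain n where n: "(LBINT x. \<bar>f x - ?h n x\<bar> ^ p) < d"
    using order_tendstoD(2)[OF lim, of d] d by (auto simp: eventually_sequentially)
  obtain g where g: "continuous_on UNIV g" "\<And>x. x \<notin> cball 0 (R + 1) \<Longrightarrow> g x = 0"
     "integrable lborel (\<lambda>x. \<bar>?h n x - g x\<bar> ^ p)" "(LBINT x. \<bar>?h n x - g x\<bar> ^ p) < d"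
    using dense_bounded[of "?h n" "real n" R p d] p d R by (auto simp: clip_abs, auto simp: clip_def)
  have [measurable]: "g \<in> borel_measurable borel" using g(1) by (rule borel_measurable_continuous_onI)
  have bd: "\<bar>f x - g x\<bar> ^ p \<le> 2 ^ p * (\<bar>f x - ?h n x\<bar> ^ p + \<bar>?h n x - g x\<bar> ^ p)" for x
    using abs_add_power_le[of "f x - ?h n x" "?h n x - g x" p] by simp
  have i2: "integrable lborel (\<lambda>x. 2 ^ p * (\<bar>f x - ?h n x\<bar> ^ p + \<bar>?h n x - g x\<bar> ^ p))"
    using i1 g(3) by auto
  have i3: "integrable lborel (\<lambda>x. \<bar>f x - g x\<bar> ^ p)"
    by (rule Bochner_Integration.integrable_bound[OF i2]) (use bd in \<open>auto simp: power_abs[symmetric]\<close>)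
  have "(LBINT x. \<bar>f x - g x\<bar> ^ p) \<le> (LBINT x. 2 ^ p * (\<bar>f x - ?h n x\<bar> ^ p + \<bar>?h n x - g x\<bar> ^ p))"
    by (intro integral_mono i2 i3 bd)
  also have "\<dots> = 2 ^ p * ((LBINT x. \<bar>f x - ?h n x\<bar> ^ p) + (LBINT x. \<bar>?h n x - g x\<bar> ^ p))"
    using i1 g(3) by simp
  also have "\<dots> < 2 ^ p * (d + d)" using n g(4) by (intro mult_strict_left_mono) auto
  also have "\<dots> = e" by (simp add: d_def)
  finally show ?thesis using g(1,2) i3 by blast
qed

text \<open>Young's inequality for a kernel of mass one, by integrating the pointwise Jensen
  inequality. Exponent 1 serves the functions and exponent 2 the gradients.\<close>

lemma conv_power_le:
  fixes f :: "'a::euclidean_space \<Rightarrow> real"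
  assumes s: "0 < s" and f: "integrable lborel f" and fp: "integrable lborel (\<lambda>x. \<bar>f x\<bar> ^ p)" and p: "p = 1 \<or> p = 2"
  shows "integrable lborel (\<lambda>x. \<bar>conv (mollifier s) f x\<bar> ^ p)"
    and "(LBINT x. \<bar>conv (mollifier s) f x\<bar> ^ p) \<le> (LBINT x. \<bar>f x\<bar> ^ p)"
proof -
  have [measurable]: "f \<in> borel_measurable borel" "mollifier s \<in> borel_measurable (borel :: 'a measure)"
    using f mollifier_borel[OF s] by auto
  have bd: "\<bar>conv (mollifier s) f x\<bar> ^ p \<le> conv (mollifier s) (\<lambda>x. \<bar>f x\<bar> ^ p) x" for x
    using p conv_norm_le[OF s f, of x] conv_sq_le[OF s f, of x] fp by auto
  have i: "integrable lborel (conv (mollifier s) (\<lambda>x. \<bar>f x\<bar> ^ p))"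
    "(LBINT x. conv (mollifier s) (\<lambda>x. \<bar>f x\<bar> ^ p) x) = (LBINT x. \<bar>f x\<bar> ^ p)"
    using conv_integral[OF fp mollifier_integrable[OF s]] mollifier_integral[OF s, where 'a='a] by auto
  show j: "integrable lborel (\<lambda>x. \<bar>conv (mollifier s) f x\<bar> ^ p)"
    by (rule Bochner_Integration.integrable_bound[OF i(1)]) (use bd in \<open>auto simp: power_abs[symmetric] intro: order_trans[OF _ abs_ge_self]\<close>)
  show "(LBINT x. \<bar>conv (mollifier s) f x\<bar> ^ p) \<le> (LBINT x. \<bar>f x\<bar> ^ p)"
    using integral_mono[OF j i(1) bd] i(2) by simp
qed

lemma conv_diff:
  fixes f g :: "'a::euclidean_space \<Rightarrow> 'b::euclidean_space"
  assumes "test_function S \<eta>" "integrable lborel f" "integrable lborel g"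
  shows "conv \<eta> (\<lambda>x. f x - g x) x = conv \<eta> f x - conv \<eta> g x"
  using conv_integrable[OF assms(1,2), of x] conv_integrable[OF assms(1,3), of x]
  by (simp add: conv_def scaleR_diff_right)

text \<open>Used for the approximation of continuous functions and again for the comparison of
  mollifications at consecutive scales.\<close>

lemma conv_near:
  fixes g :: "'a::euclidean_space \<Rightarrow> 'b::euclidean_space"
  assumes s: "0 < s" and g: "integrable lborel g" and e: "\<And>y. norm (x - y) < s \<Longrightarrow> norm (g y - g x) \<le> e"
  shows "norm (conv (mollifier s) g x - g x) \<le> e"
proof -
  let ?k = "\<lambda>y. mollifier s (x - y)"
  have i1: "integrable lborel (\<lambda>y. ?k y *\<^sub>R g y)" using conv_integrable[OF mollifier_test[OF s] g] .
  note k = moll_kernel_integral[OF s, of x]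
  have "conv (mollifier s) g x - g x = (LBINT y. ?k y *\<^sub>R (g y - g x))"
    unfolding scaleR_diff_right using i1 k by (simp add: conv_def)
  also have "norm \<dots> \<le> (LBINT y. ?k y * e)"
  proof (rule order_trans[OF integral_norm_bound integral_mono])
    show "norm (?k y *\<^sub>R (g y - g x)) \<le> ?k y * e" for y
      using e[of y] mollifier_nonneg[OF s, of "x - y"] mollifier_zero[OF s, of "x - y"]
      by (cases "norm (x - y) < s") (auto intro: mult_left_mono)
    show "integrable lborel (\<lambda>y. norm (?k y *\<^sub>R (g y - g x)))"
      unfolding scaleR_diff_right using i1 k by auto
  qed (use k in auto)
  also have "\<dots> = e" using k by simp
  finally show ?thesis .
qed

lemma conv_zero_outside:
  fixes f :: "'a::euclidean_space \<Rightarrow> 'b::euclidean_space"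
  assumes s: "0 < s" and "\<And>x. x \<notin> cball a R \<Longrightarrow> f x = 0" "x \<notin> cball a (R + s)"
  shows "conv (mollifier s) f x = 0"
proof -
  have "mollifier s (x - y) *\<^sub>R f y = 0" for y
  proof (cases "y \<in> cball a R")
    case True
    have "dist a x \<le> dist a y + norm (x - y)" by (metis dist_norm dist_triangle norm_minus_commute)
    then have "s \<le> norm (x - y)" using True assms(3) by auto
    then show ?thesis by (simp add: mollifier_zero[OF s])
  qed (use assms in auto)
  then have "(\<lambda>y. mollifier s (x - y) *\<^sub>R f y) = (\<lambda>_. 0)" by (rule ext)
  then show ?thesis unfolding conv_def by (simp only: integral_zero)
qed

text \<open>For a continuous g close to f, the error splits into the mollification of f - g, which
  is no larger than f - g in the p-th mean, the mollification error of g, which is uniformly small,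
  and g - f.\<close>

lemma conv_Lp_tendsto:
  fixes f :: "'a::euclidean_space \<Rightarrow> real"
  assumes f: "integrable lborel f" and fp: "integrable lborel (\<lambda>x. \<bar>f x\<bar> ^ p)" and p: "p = 1 \<or> p = 2"
    and R: "\<And>x. x \<notin> cball 0 R \<Longrightarrow> f x = 0" and s: "\<And>k. 0 < s k" "s \<longlonglongrightarrow> 0"
  shows "integrable lborel (\<lambda>x. \<bar>conv (mollifier (s k)) f x - f x\<bar> ^ p)"
    and "(\<lambda>k. LBINT x. \<bar>conv (mollifier (s k)) f x - f x\<bar> ^ p) \<longlonglongrightarrow> 0"
proof -
  have [measurable]: "f \<in> borel_measurable borel" using f by auto
  have p1: "p \<ge> 1" using p by auto
  let ?c = "\<lambda>k. conv (mollifier (s k))"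
  have [measurable]: "?c k f \<in> borel_measurable borel" for k using mollifier_borel[OF s(1)] by measurable
  have key: "integrable lborel (\<lambda>x. \<bar>?c k f x - f x\<bar> ^ p)" for k
  proof (rule Bochner_Integration.integrable_bound)
    show "integrable lborel (\<lambda>x. 2 ^ p * (\<bar>?c k f x\<bar> ^ p + \<bar>- f x\<bar> ^ p))"
      using conv_power_le(1)[OF s(1) f fp p, of k] fp by auto
    show "AE x in lborel. norm (\<bar>?c k f x - f x\<bar> ^ p) \<le> norm (2 ^ p * (\<bar>?c k f x\<bar> ^ p + \<bar>- f x\<bar> ^ p))"
      using abs_add_power_le[of "?c k f x" "- f x" p for x] by (auto simp: power_abs[symmetric])
  qed measurable
  then show "integrable lborel (\<lambda>x. \<bar>conv (mollifier (s k)) f x - f x\<bar> ^ p)" .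
  show "(\<lambda>k. LBINT x. \<bar>?c k f x - f x\<bar> ^ p) \<longlonglongrightarrow> 0"
  proof (rule LIMSEQ_I)
    fix e :: real assume e: "0 < e"
    \<comment> \<open>The split into three terms costs \<open>4 ^ p\<close> times three copies of
      \<open>d\<close>; \<open>8 ^ p\<close> is a convenient larger factor.\<close>
    define A where "A = (8::real) ^ p * 3"
    have A: "A > 0" by (simp add: A_def)
    define d where "d = e / A"
    have d: "d > 0" using e A by (simp add: d_def)
    obtain g where g: "continuous_on UNIV g" "\<And>x. x \<notin> cball 0 (R + 1) \<Longrightarrow> g x = 0"
     "integrable lborel (\<lambda>x. \<bar>f x - g x\<bar> ^ p)" "(LBINT x. \<bar>f x - g x\<bar> ^ p) < d"
      using dense_Lp[OF _ fp R p1 d] by auto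
    have [measurable]: "g \<in> borel_measurable borel" using g(1) by (rule borel_measurable_continuous_onI)
    have gi: "integrable lborel g"
      using continuous_compact_support_integrable[OF g(1) compact_cball g(2)] .
    have fgi: "integrable lborel (\<lambda>x. f x - g x)" using f gi by auto
    define V where "V = measure lborel (cball (0::'a) (R + 2))"
    have V: "V \<ge> 0" by (simp add: V_def)
    \<comment> \<open>A uniform error \<open>t\<close> on a set of volume \<open>V\<close>
      contributes \<open>t ^ p * V\<close>. Taking t <= 1 reduces \<open>t ^ p\<close> to
      \<open>t\<close>.\<close>
    obtain t where t: "t > 0" "t ^ p * V < d"
    proof -
      define t where "t = min 1 (d / (V + 1))"
      have "t > 0" using d V by (simp add: t_def)
      have "t \<le> 1" by (simp add: t_def)
      then have "t ^ p \<le> t" using p \<open>t > 0\<close> by (auto simp: power2_eq_square mult_left_le)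
      then have "t ^ p * V \<le> t * V" using V by (intro mult_right_mono)
      also have "\<dots> \<le> d / (V + 1) * V" using V by (intro mult_right_mono) (auto simp: t_def)
      also have "\<dots> < d" using d V by (simp add: field_simps)
      finally show ?thesis using that \<open>t > 0\<close> by blast
    qed
    \<comment> \<open>\<open>g\<close> lives on radius R + 1 and, as scales below 1 are used, its
      mollification on radius R + 2. Averaging at such points reaches at most radius R + 3.\<close>
    have "uniformly_continuous_on (cball 0 (R + 3)) g"
      using g(1) by (intro compact_uniformly_continuous) (auto intro: continuous_on_subset)
    then obtain \<delta> where \<delta>: "\<delta> > 0" "\<And>x y. x \<in> cball 0 (R + 3) \<Longrightarrow> y \<in> cball 0 (R + 3) \<Longrightarrow> dist y x < \<delta> \<Longrightarrow> dist (g y) (g x) < t"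
      unfolding uniformly_continuous_on_def using t(1) by metis
    have "\<forall>\<^sub>F k in sequentially. s k < min 1 \<delta>" using \<delta>(1) by (intro order_tendstoD(2)[OF s(2)]) auto
    then obtain K where K: "\<And>k. k \<ge> K \<Longrightarrow> s k < min 1 \<delta>" by (auto simp: eventually_sequentially)
    have "(LBINT x. \<bar>?c k f x - f x\<bar> ^ p) < e" if "k \<ge> K" for k
    proof -
      have sk: "s k < 1" "s k < \<delta>" "0 < s k" using K[OF that] s(1) by auto
      have ni: "\<bar>?c k g x - g x\<bar> ^ p \<le> t ^ p * indicator (cball 0 (R + 2)) x" for x
      proof (cases "x \<in> cball 0 (R + 2)")
        case True
        have "norm (?c k g x - g x) \<le> t"
        proof (rule conv_near[OF sk(3) gi])
          fix y assume y: "norm (x - y) < s k"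
          have "norm y \<le> norm x + norm (x - y)" using norm_triangle_sub[of y x] by (simp add: norm_minus_commute)
          then have "dist (g y) (g x) < t" using y sk True by (intro \<delta>(2)) (auto simp: dist_norm norm_minus_commute)
          then show "norm (g y - g x) \<le> t" by (simp add: dist_norm)
        qed
        then show ?thesis using True by (simp add: power_mono)
      next
        case False
        then have "?c k g x = 0" using sk by (intro conv_zero_outside[of "s k" 0 "R + 1" g] g(2)) auto
        moreover have "g x = 0" using False by (intro g(2)) auto
        ultimately show ?thesis using False p by auto
      qed
      have i4: "integrable lborel (\<lambda>x::'a. t ^ p * indicator (cball 0 (R + 2)) x :: real)"
        using emeasure_lborel_cball_finite[of "0::'a"] by (intro integrable_mult_right integrable_real_indicator) auto
      have [measurable]: "?c k g \<in> borel_measurable borel" using mollifier_borel[OF s(1)] by measurable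
      have i5: "integrable lborel (\<lambda>x. \<bar>?c k g x - g x\<bar> ^ p)"
        by (rule Bochner_Integration.integrable_bound[OF i4]) (use ni in \<open>auto simp: power_abs[symmetric] intro: order_trans[OF _ abs_ge_self]\<close>)
      have "(LBINT x. \<bar>?c k g x - g x\<bar> ^ p) \<le> (\<integral>x. t ^ p * indicator (cball 0 (R + 2)) x \<partial>(lborel::'a measure))"
        by (rule integral_mono[OF i5 i4 ni])
      also have "\<dots> = t ^ p * V" by (simp add: V_def)
      finally have b1: "(LBINT x. \<bar>?c k g x - g x\<bar> ^ p) < d" using t by linarith
      note b2 = conv_power_le[OF s(1) fgi g(3) p, of k]
      let ?D = "\<lambda>x. \<bar>?c k (\<lambda>x. f x - g x) x\<bar> ^ p"
      have bd: "\<bar>?c k f x - f x\<bar> ^ p \<le> 4 ^ p * (?D x + \<bar>?c k g x - g x\<bar> ^ p + \<bar>f x - g x\<bar> ^ p)" for x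
      proof -
        have "?c k f x - f x = ?c k (\<lambda>x. f x - g x) x + ((?c k g x - g x) + (g x - f x))"
          using conv_diff[OF mollifier_test[OF s(1)] f gi] by simp
        then have "\<bar>?c k f x - f x\<bar> ^ p \<le> 2 ^ p * (?D x + \<bar>(?c k g x - g x) + (g x - f x)\<bar> ^ p)"
          by (metis abs_add_power_le)
        also have "\<dots> \<le> 2 ^ p * (2 ^ p * ?D x + 2 ^ p * (\<bar>?c k g x - g x\<bar> ^ p + \<bar>g x - f x\<bar> ^ p))"
        proof (intro mult_left_mono add_mono abs_add_power_le)
          have "1 \<le> (2::real) ^ p" by simp
          then show "?D x \<le> 2 ^ p * ?D x" using mult_right_mono[of 1 "2^p" "?D x"] by simp
        qed auto
        also have "\<dots> = 4 ^ p * (?D x + \<bar>?c k g x - g x\<bar> ^ p + \<bar>f x - g x\<bar> ^ p)"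
        proof -
          have "(4::real) ^ p = 2 ^ p * 2 ^ p" by (simp add: power_mult_distrib[symmetric])
          then show ?thesis by (simp add: algebra_simps abs_minus_commute)
        qed
        finally show ?thesis .
      qed
      have "(LBINT x. \<bar>?c k f x - f x\<bar> ^ p) \<le> (LBINT x. 4 ^ p * (?D x + \<bar>?c k g x - g x\<bar> ^ p + \<bar>f x - g x\<bar> ^ p))"
        using b2(1) i5 g(3) by (intro integral_mono key bd) auto
      also have "\<dots> = 4 ^ p * ((LBINT x. ?D x) + (LBINT x. \<bar>?c k g x - g x\<bar> ^ p) + (LBINT x. \<bar>f x - g x\<bar> ^ p))"
        using b2(1) i5 g(3) by simp
      also have "\<dots> < 4 ^ p * (d + d + d)" using b1 b2(2) g(4) by (intro mult_strict_left_mono add_strict_mono) auto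
      also have "\<dots> \<le> 8 ^ p * (d + d + d)" using d by (intro mult_right_mono power_mono) auto
      also have "\<dots> = A * d" by (simp add: A_def)
      also have "\<dots> = e" using A by (simp add: d_def)
      finally show ?thesis .
    qed
    then show "\<exists>no. \<forall>k\<ge>no. norm ((LBINT x. \<bar>?c k f x - f x\<bar> ^ p) - 0) < e"
      by (auto simp: abs_of_nonneg intro!: exI[of _ K] integral_nonneg_AE)
  qed
qed

section \<open>Square-integrable fields\<close>

definition sqint :: "('a::euclidean_space \<Rightarrow> 'b::euclidean_space) \<Rightarrow> bool" where
  "sqint F \<longleftrightarrow> F \<in> borel_measurable borel \<and> integrable lborel (\<lambda>x. (norm (F x))\<^sup>2)"

definition nrm :: "('a::euclidean_space \<Rightarrow> 'b::euclidean_space) \<Rightarrow> real" where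
  "nrm F = sqrt (LBINT x. (norm (F x))\<^sup>2)"

lemma sqint_borel [measurable_dest]: "sqint F \<Longrightarrow> F \<in> borel_measurable borel"
  and sqint_integrable: "sqint F \<Longrightarrow> integrable lborel (\<lambda>x. (norm (F x))\<^sup>2)"
  by (auto simp: sqint_def)

lemma nrm_nonneg [simp]: "0 \<le> nrm F"
  by (simp add: nrm_def integral_nonneg_AE)

lemma nrm_sq: "(nrm F)\<^sup>2 = (LBINT x. (norm (F x))\<^sup>2)"
  by (simp add: nrm_def integral_nonneg_AE)

lemma norm_add_sq_le:
  fixes a b :: "'a::real_inner"
  shows "(norm (a + b))\<^sup>2 \<le> 2 * (norm a)\<^sup>2 + 2 * (norm b)\<^sup>2"
proof -
  have "0 \<le> (norm (a - b))\<^sup>2" by simp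
  then show ?thesis
    by (simp add: power2_norm_eq_inner inner_add_left inner_add_right inner_diff_left inner_diff_right inner_commute)
qed

lemma sqint_add:
  assumes "sqint F" "sqint G" shows "sqint (\<lambda>x. F x + G x)"
proof -
  note [measurable] = sqint_borel[OF assms(1)] sqint_borel[OF assms(2)]
  have "integrable lborel (\<lambda>x. 2 * (norm (F x))\<^sup>2 + 2 * (norm (G x))\<^sup>2)"
    using assms by (auto simp: sqint_def)
  then have "integrable lborel (\<lambda>x. (norm (F x + G x))\<^sup>2)"
    by (rule Bochner_Integration.integrable_bound) (auto intro: order_trans[OF norm_add_sq_le])
  then show ?thesis by (simp add: sqint_def)
qed

lemma sqint_scaleR: "sqint F \<Longrightarrow> sqint (\<lambda>x. c *\<^sub>R F x)"
  by (auto simp: sqint_def power_mult_distrib)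

lemma sqint_diff: "sqint F \<Longrightarrow> sqint G \<Longrightarrow> sqint (\<lambda>x. F x - G x)"
  using sqint_add[OF _ sqint_scaleR[of G "-1"], of F] by simp

lemma sqint_indicator:
  assumes "sqint F" "S \<in> sets borel" shows "sqint (restr S F)"
proof -
  have "integrable lborel (\<lambda>x. indicator S x *\<^sub>R (norm (F x))\<^sup>2)"
    using assms by (intro integrable_mult_indicator) (auto simp: sqint_def)
  moreover have "(\<lambda>x. indicator S x *\<^sub>R (norm (F x))\<^sup>2) = (\<lambda>x. (norm (indicator S x *\<^sub>R F x))\<^sup>2)"
    by (auto simp: fun_eq_iff indicator_def)
  ultimately show ?thesis using assms by (auto simp: sqint_def)
qed

lemma sqint_inner_integrable:
  assumes "sqint F" "sqint G" shows "integrable lborel (\<lambda>x. F x \<bullet> G x)"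
proof -
  note [measurable] = sqint_borel[OF assms(1)] sqint_borel[OF assms(2)]
  have i: "integrable lborel (\<lambda>x. (norm (F x))\<^sup>2 + (norm (G x))\<^sup>2)"
    using assms by (auto simp: sqint_def)
  have "\<bar>F x \<bullet> G x\<bar> \<le> (norm (F x))\<^sup>2 + (norm (G x))\<^sup>2" for x
  proof -
    have "\<bar>F x \<bullet> G x\<bar> \<le> norm (F x) * norm (G x)" by (rule Cauchy_Schwarz_ineq2)
    moreover have "2 * norm (F x) * norm (G x) \<le> (norm (F x))\<^sup>2 + (norm (G x))\<^sup>2" by (rule sum_squares_bound)
    moreover have "0 \<le> norm (F x) * norm (G x)" by simp
    ultimately show ?thesis by linarith
  qed
  then show ?thesis by (intro Bochner_Integration.integrable_bound[OF i]) auto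
qed

lemma nrm_add_sq:
  assumes "sqint F" "sqint G"
  shows "(nrm (\<lambda>x. F x + c *\<^sub>R G x))\<^sup>2 = (nrm F)\<^sup>2 + 2 * c * (LBINT x. F x \<bullet> G x) + c\<^sup>2 * (nrm G)\<^sup>2"
proof -
  have eq: "(norm (F x + c *\<^sub>R G x))\<^sup>2 = (norm (F x))\<^sup>2 + 2 * c * (F x \<bullet> G x) + c\<^sup>2 * (norm (G x))\<^sup>2" for x
    unfolding power2_norm_eq_inner by (simp add: inner_add_left inner_add_right inner_commute power2_eq_square)
  show ?thesis unfolding nrm_sq eq
    using sqint_inner_integrable[OF assms] sqint_integrable[OF assms(1)] sqint_integrable[OF assms(2)]
    by (simp add: integral_nonneg_AE)
qed

text \<open>Used in two ways: with \<open>e\<close> a norm it is the Cauchy-Schwarz inequality, with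
  \<open>e\<^sup>2\<close> the gap of a near-minimizer it expresses near orthogonality.\<close>

lemma discriminant_bound:
  fixes b c e :: real
  assumes "\<And>t. 0 \<le> e\<^sup>2 + 2 * t * b + t\<^sup>2 * c\<^sup>2" "0 \<le> e" "0 \<le> c"
  shows "\<bar>b\<bar> \<le> e * c"
proof (cases "c = 0")
  case True
  have "b = 0"
  proof (rule ccontr)
    assume "b \<noteq> 0"
    \<comment> \<open>For c = 0 the quadratic degenerates to an affine function, and this t gives it
      the value -1.\<close>
    then show False using assms(1)[of "- (e\<^sup>2 + 1) / (2 * b)"] True by (simp add: field_simps)
  qed
  then show ?thesis using True by simp
next
  case False
  \<comment> \<open>The minimizer of the quadratic is inserted.\<close>
  have "0 \<le> e\<^sup>2 + 2 * (- b / c\<^sup>2) * b + (- b / c\<^sup>2)\<^sup>2 * c\<^sup>2" by (rule assms(1))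
  also have "\<dots> = e\<^sup>2 - b\<^sup>2 / c\<^sup>2" using False by (simp add: power_divide power2_eq_square field_simps)
  finally have "b\<^sup>2 \<le> (e * c)\<^sup>2" using False by (simp add: field_simps power_mult_distrib)
  then show ?thesis using assms by (intro power2_le_imp_le[of "\<bar>b\<bar>"]) auto
qed

lemma nrm_Cauchy_Schwarz:
  assumes "sqint F" "sqint G" shows "\<bar>LBINT x. F x \<bullet> G x\<bar> \<le> nrm F * nrm G"
proof (rule discriminant_bound)
  fix t :: real
  show "0 \<le> (nrm F)\<^sup>2 + 2 * t * (LBINT x. F x \<bullet> G x) + t\<^sup>2 * (nrm G)\<^sup>2"
    unfolding nrm_add_sq[OF assms, symmetric] by simp
qed auto

lemma nrm_triangle:
  assumes "sqint F" "sqint G" shows "nrm (\<lambda>x. F x + G x) \<le> nrm F + nrm G"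
proof (rule power2_le_imp_le)
  have "(nrm (\<lambda>x. F x + G x))\<^sup>2 = (nrm F)\<^sup>2 + 2 * (LBINT x. F x \<bullet> G x) + (nrm G)\<^sup>2"
    using nrm_add_sq[OF assms, of 1] by simp
  also have "\<dots> \<le> (nrm F + nrm G)\<^sup>2"
    using nrm_Cauchy_Schwarz[OF assms] by (simp add: power2_sum)
  finally show "(nrm (\<lambda>x. F x + G x))\<^sup>2 \<le> (nrm F + nrm G)\<^sup>2" .
qed simp

lemma nrm_scaleR: "nrm (\<lambda>x. c *\<^sub>R F x) = \<bar>c\<bar> * nrm F"
  by (simp add: nrm_def power_mult_distrib real_sqrt_mult)

lemma nrm_minus: "nrm (\<lambda>x. - F x) = nrm F"
  by (simp add: nrm_def)

lemma nrm_mono: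
  assumes "sqint G" "F \<in> borel_measurable borel" "\<And>x. norm (F x) \<le> norm (G x)"
  shows "sqint F" "nrm F \<le> nrm G"
proof -
  have i: "integrable lborel (\<lambda>x. (norm (F x))\<^sup>2)"
    by (rule Bochner_Integration.integrable_bound[OF sqint_integrable[OF assms(1)]])
      (use assms in \<open>auto intro!: power_mono\<close>)
  then show "sqint F" using assms by (simp add: sqint_def)
  show "nrm F \<le> nrm G" unfolding nrm_def
    by (intro real_sqrt_le_mono integral_mono i sqint_integrable assms power_mono) auto
qed

lemma nrm_conv_le:
  fixes F :: "'a::euclidean_space \<Rightarrow> 'b::euclidean_space"
  assumes s: "0 < s" and F: "integrable lborel F" "sqint F"
  shows "sqint (conv (mollifier s) F)" and "nrm (conv (mollifier s) F) \<le> nrm F"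
proof -
  note [measurable] = sqint_borel[OF F(2)] mollifier_borel[OF s]
  note i0 = sqint_integrable[OF F(2)]
  have i: "integrable lborel (conv (mollifier s) (\<lambda>x. (norm (F x))\<^sup>2))"
    "(LBINT x. conv (mollifier s) (\<lambda>x. (norm (F x))\<^sup>2) x) = (LBINT x. (norm (F x))\<^sup>2)"
    using conv_integral[OF i0 mollifier_integrable[OF s]] mollifier_integral[OF s, where 'a='a] by auto
  have j: "integrable lborel (\<lambda>x. (norm (conv (mollifier s) F x))\<^sup>2)"
    by (rule Bochner_Integration.integrable_bound[OF i(1)])
      (use conv_sq_le[OF s F(1) i0] in \<open>auto intro: order_trans[OF _ abs_ge_self]\<close>)
  show "sqint (conv (mollifier s) F)" using j by (simp add: sqint_def)
  show "nrm (conv (mollifier s) F) \<le> nrm F" unfolding nrm_def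
    using integral_mono[OF j i(1) conv_sq_le[OF s F(1) i0]] i(2) by (intro real_sqrt_le_mono) simp
qed

section \<open>Mean squares of almost harmonic functions\<close>

lemma has_derivative_difference_quotient:
  fixes F :: "'a::real_normed_vector \<Rightarrow> real"
  assumes "(F has_derivative D) (at x)"
  shows "(\<lambda>k. (F (x + inverse (real (Suc k)) *\<^sub>R v) - F x) * real (Suc k)) \<longlonglongrightarrow> D v"
proof -
  have "((\<lambda>t::real. x + t *\<^sub>R v) has_derivative (\<lambda>t. t *\<^sub>R v)) (at 0)"
    by (auto intro!: derivative_eq_intros)
  then have "((\<lambda>t. F (x + t *\<^sub>R v)) has_derivative (\<lambda>t. D (t *\<^sub>R v))) (at 0)"
    using has_derivative_compose[of "\<lambda>t::real. x + t *\<^sub>R v" "\<lambda>t. t *\<^sub>R v" 0 UNIV F D] assms by simp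
  moreover have "(\<lambda>t. D (t *\<^sub>R v)) = (\<lambda>t. D v * t)"
    using has_derivative_bounded_linear[OF assms] by (auto simp: fun_eq_iff linear_simps)
  ultimately have "((\<lambda>t. F (x + t *\<^sub>R v)) has_real_derivative D v) (at 0)"
    by (simp add: has_field_derivative_def)
  then have lim: "((\<lambda>t. (F (x + t *\<^sub>R v) - F x) / t) \<longlongrightarrow> D v) (at 0)"
    unfolding DERIV_def by simp
  have "filterlim (\<lambda>k. inverse (real (Suc k))) (at 0) sequentially"
    by (intro filterlim_atI LIMSEQ_inverse_real_of_nat) auto
  from filterlim_compose[OF lim this] show ?thesis by (simp add: divide_inverse)
qed

text \<open>The difference quotients have integral zero by translation invariance.\<close>

lemma integral_derivative_zero:
  fixes F d :: "'a::euclidean_space \<Rightarrow> real"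
  assumes F: "continuous_on UNIV F" "\<And>x. x \<notin> cball a R \<Longrightarrow> F x = 0" and v: "norm v \<le> 1"
    and L: "\<And>x h. 0 < h \<Longrightarrow> h \<le> 1 \<Longrightarrow> \<bar>F (x + h *\<^sub>R v) - F x\<bar> \<le> L * h"
    and d [measurable]: "d \<in> borel_measurable borel"
    and D: "AE x in lborel. (F has_derivative D x) (at x) \<and> D x v = d x"
  shows "integrable lborel d" "(LBINT x. d x) = 0"
proof -
  have Fi: "integrable lborel F" using continuous_compact_support_integrable[OF F(1) compact_cball F(2)] .
  have [measurable]: "F \<in> borel_measurable borel" using Fi by auto
  let ?q = "\<lambda>k x. (F (x + inverse (real (Suc k)) *\<^sub>R v) - F x) * real (Suc k)"
  have iF: "integrable lborel (\<lambda>x. F (x + c))" "(LBINT x. F (x + c)) = (LBINT x. F x)" for c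
    using lborel_integrable_affine[OF Fi, of 1 c] lborel_integral_affine[of F 1 c]
    by (simp_all add: add.commute)
  have zero: "(LBINT x. ?q k x) = 0" for k using iF Fi by simp
  have lim: "AE x in lborel. (\<lambda>k. ?q k x) \<longlonglongrightarrow> d x"
    using D
  proof eventually_elim
    case (elim x)
    show ?case using has_derivative_difference_quotient[OF conjunct1[OF elim], of v] by (simp only: conjunct2[OF elim])
  qed
  \<comment> \<open>Steps \<open>h *\<^sub>R v\<close> have length at most 1, so every difference
    quotient vanishes off the ball of radius R + 1.\<close>
  have idom: "integrable lborel (\<lambda>x. L * indicator (cball a (R + 1)) x :: real)"
    using emeasure_lborel_cball_finite[of a "R + 1"]
    by (intro integrable_mult_right integrable_real_indicator) auto
  have dom: "norm (?q k x) \<le> L * indicator (cball a (R + 1)) x" for k x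
  proof -
    define h where "h = inverse (real (Suc k))"
    have h: "0 < h" "h \<le> 1" "h * real (Suc k) = 1" by (auto simp: h_def field_simps)
    have "norm ((F (x + h *\<^sub>R v) - F x) * real (Suc k)) \<le> L * indicator (cball a (R + 1)) x"
    proof (cases "x \<in> cball a (R + 1)")
      case True
      have "\<bar>F (x + h *\<^sub>R v) - F x\<bar> * real (Suc k) \<le> L * h * real (Suc k)"
        using L[OF h(1,2), of x] by (intro mult_right_mono) auto
      also have "\<dots> = L" using h(3) by (simp only: mult.assoc mult_1_right)
      finally show ?thesis using True by (simp add: abs_mult del: of_nat_Suc)
    next
      case False
      have "h * norm v \<le> 1 * 1" using v h by (intro mult_mono) auto
      moreover have "dist (x + h *\<^sub>R v) x = h * norm v" using h by (simp add: dist_norm)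
      moreover have "dist a x \<le> dist a (x + h *\<^sub>R v) + dist (x + h *\<^sub>R v) x" by (rule dist_triangle)
      ultimately have "x + h *\<^sub>R v \<notin> cball a R" "x \<notin> cball a R" using False by auto
      then show ?thesis using F(2) False by simp
    qed
    then show ?thesis by (simp only: h_def)
  qed
  have "(\<lambda>k. LBINT x. ?q k x) \<longlonglongrightarrow> (LBINT x. d x)"
    by (rule integral_dominated_convergence[OF _ _ idom lim AE_I2[OF dom]]) measurable
  then show "(LBINT x. d x) = 0" unfolding zero by (simp add: LIMSEQ_const_iff)
  show "integrable lborel d"
    by (rule integrable_dominated_convergence[OF _ _ idom lim AE_I2[OF dom]]) measurable
qed

lemma integral_pd_test:
  assumes t: "test_function S \<phi>" and i: "i \<in> Basis"
  shows "(LBINT x. pd i \<phi> x) = 0"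
proof -
  obtain K where K: "C_infinity \<phi>" "compact K" "K \<subseteq> S" "\<And>x. x \<notin> K \<Longrightarrow> \<phi> x = 0"
    using t test_functionE by blast
  obtain a R where R: "K \<subseteq> cball a R" using compact_imp_bounded[OF K(2)] bounded_subset_cball by blast
  obtain B where B: "B > 0" "\<And>x y. \<bar>\<phi> x - \<phi> y\<bar> \<le> B * norm (x - y)" using test_lipschitz[OF t] by blast
  show ?thesis
  proof (rule integral_derivative_zero(2)[of \<phi> a R i B _ "\<lambda>x h. grad \<phi> x \<bullet> h"])
    show "\<bar>\<phi> (x + h *\<^sub>R i) - \<phi> x\<bar> \<le> B * h" if "0 < h" for x h
      using B(2)[of "x + h *\<^sub>R i" x] that i by simp
    show "AE x in lborel. (\<phi> has_derivative (\<lambda>h. grad \<phi> x \<bullet> h)) (at x) \<and> grad \<phi> x \<bullet> i = pd i \<phi> x"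
      using has_derivative_grad[OF C_infinity_diff[OF K(1)]] grad_inner[OF i] by auto
    show "\<phi> x = 0" if "x \<notin> cball a R" for x using K(4) R that by blast
  qed (use K i t in \<open>auto intro!: test_cont C_infinity_borel C_infinity_pd\<close>)
qed

lemma integral_by_parts_test:
  assumes "C_infinity f" "test_function S \<phi>" "i \<in> Basis"
  shows "(LBINT x. f x * pd i \<phi> x) = - (LBINT x. pd i f x * \<phi> x)"
proof -
  have "pd i (\<lambda>x. f x * \<phi> x) = (\<lambda>x. f x * pd i \<phi> x + pd i f x * \<phi> x)"
    using pd_mult C_infinity_diff assms test_C_infinity by blast
  then have "(LBINT x. f x * pd i \<phi> x + pd i f x * \<phi> x) = 0"
    using integral_pd_test[OF test_mult[OF assms(1,2)] assms(3)] by simp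
  moreover have "integrable lborel (\<lambda>x. f x * pd i \<phi> x)" "integrable lborel (\<lambda>x. pd i f x * \<phi> x)"
    using test_integrable test_mult test_pd C_infinity_pd assms by blast+
  ultimately show ?thesis by simp
qed

lemma weakly_diff_smooth: "C_infinity f \<Longrightarrow> weakly_diff S f (grad f)"
  unfolding weakly_diff_def using integral_by_parts_test grad_inner
  by (auto simp: grad_inner)

lemma integrable_indicator_ball:
  fixes g :: "'a::euclidean_space \<Rightarrow> 'b::{banach,second_countable_topology}"
  assumes "continuous_on UNIV g"
  shows "integrable lborel (restr (ball a R) g)"
proof -
  have "integrable lborel (restr (cball a R) g)"
    using assms by (intro borel_integrable_compact) (auto intro: continuous_on_subset)
  from integrable_mult_indicator[OF _ this, of "ball a R"] show ?thesis
    by (simp add: indicator_inter_arith[symmetric] Int_absorb2 ball_subset_cball)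
qed

definition laplace :: "('a::euclidean_space \<Rightarrow> real) \<Rightarrow> 'a \<Rightarrow> real" where
  "laplace p x = (\<Sum>i\<in>Basis. pd i (pd i p) x)"

text \<open>The left-hand side is the radial derivative of the mean of \<open>q\<^sup>2\<close> over balls.  It is rewritten by
  integrating the divergence of \<open>(1 - |y|\<^sup>2)\<^sub>+ q \<nabla>q\<close>; the weight vanishes on the sphere, so there is no
  boundary term.\<close>

lemma weight_identity:
  fixes q :: "'a::euclidean_space \<Rightarrow> real"
  assumes q: "C_infinity q"
  shows "(LBINT y. indicator (ball 0 1) y * (2 * q y * (grad q y \<bullet> y))) =
    (LBINT y. indicator (ball 0 1) y * ((1 - (norm y)\<^sup>2) * ((norm (grad q y))\<^sup>2 + q y * laplace q y)))"
proof -
  \<comment> \<open>This weight is Lipschitz on bounded sets but has a kink on the unit sphere. That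
    is why \<open>integral_derivative_zero\<close> asks for the derivative only almost
    everywhere.\<close>
  define w :: "'a \<Rightarrow> real" where "w y = max 0 (1 - (norm y)\<^sup>2)" for y
  define m where "m i y = q y * pd i q y" for i y
  have mC: "C_infinity (m i)" if "i \<in> Basis" for i
    unfolding m_def[abs_def] using q that C_infinity_mult C_infinity_pd by blast
  define d where "d i y = indicator (ball 0 1) y * ((1 - (norm y)\<^sup>2) * pd i (m i) y - 2 * (y \<bullet> i) * m i y)" for i y
  have cont: "continuous_on UNIV (\<lambda>y. (1 - (norm y)\<^sup>2) * pd i (m i) y - 2 * (y \<bullet> i) * m i y)" if "i \<in> Basis" for i
    using mC[OF that] that by (intro continuous_intros C_infinity_cont C_infinity_pd)
  have di: "integrable lborel (d i)" if "i \<in> Basis" for i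
    using integrable_indicator_ball[OF cont[OF that], of 0 1] by (simp add: d_def[abs_def])
  have main: "(LBINT y. d i y) = 0" if i: "i \<in> Basis" for i
  proof -
    let ?F = "\<lambda>y. w y * m i y"
    have "bounded (m i ` cball 0 3)" "bounded (grad (m i) ` cball 0 3)"
      using C_infinity_cont[OF mC[OF i]] C_infinity_grad_cont[OF mC[OF i]]
      by (meson compact_cball compact_continuous_image compact_imp_bounded)+
    then obtain A B where A: "A > 0" "\<And>x. x \<in> cball 0 3 \<Longrightarrow> \<bar>m i x\<bar> \<le> A"
      and B: "B > 0" "\<And>x. x \<in> cball 0 3 \<Longrightarrow> norm (grad (m i) x) \<le> B"
      unfolding bounded_pos by (metis image_eqI real_norm_def)
    have w1: "\<bar>w y\<bar> \<le> 1" for y by (simp add: w_def)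
    \<comment> \<open>The factor 6 bounds \<open>norm x + norm y\<close> on the ball of radius
      3.\<close>
    have wl: "\<bar>w x - w y\<bar> \<le> 6 * norm (x - y)" if "x \<in> cball 0 3" "y \<in> cball 0 3" for x y
    proof -
      have "\<bar>w x - w y\<bar> \<le> \<bar>(norm x)\<^sup>2 - (norm y)\<^sup>2\<bar>" unfolding w_def by linarith
      also have "\<dots> = (norm x + norm y) * \<bar>norm x - norm y\<bar>"
        by (simp add: power2_eq_square square_diff_square_factored abs_mult)
      also have "\<dots> \<le> 6 * norm (x - y)"
        using that by (intro mult_mono norm_triangle_ineq3) auto
      finally show ?thesis .
    qed
    have w0: "w y = 0" if "y \<notin> cball 0 1" for y
      using that power_mono[of 1 "norm y" 2] by (simp add: w_def)
    \<comment> \<open>For |x| <= 2 both points of a step of length at most 1 lie in the ball of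
      radius 3, where the bounds hold; for |x| > 2 both lie off the unit ball and the product
      vanishes at both.\<close>
    have lip: "\<bar>?F (x + h *\<^sub>R i) - ?F x\<bar> \<le> (B + 6 * A) * h" if h: "0 < h" "h \<le> 1" for x h
    proof (cases "x \<in> cball 0 2")
      case True
      have ni: "norm (h *\<^sub>R i) = h" using h i by simp
      have x3: "x \<in> cball 0 3" "x + h *\<^sub>R i \<in> cball 0 3"
        using True h ni norm_triangle_ineq[of x "h *\<^sub>R i"] by auto
      have "?F (x + h *\<^sub>R i) - ?F x = w (x + h *\<^sub>R i) * (m i (x + h *\<^sub>R i) - m i x) + m i x * (w (x + h *\<^sub>R i) - w x)"
        by (simp add: algebra_simps)
      also have "\<bar>\<dots>\<bar> \<le> 1 * (B * h) + A * (6 * h)"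
        unfolding abs_mult[symmetric]
      proof (rule order_trans[OF abs_triangle_ineq add_mono])
        show "\<bar>w (x + h *\<^sub>R i) * (m i (x + h *\<^sub>R i) - m i x)\<bar> \<le> 1 * (B * h)" unfolding abs_mult
          using lipschitz_from_grad[OF C_infinity_diff[OF mC[OF i]] B(2) convex_cball x3(2,1)] ni w1 h B
          by (intro mult_mono) auto
        show "\<bar>m i x * (w (x + h *\<^sub>R i) - w x)\<bar> \<le> A * (6 * h)" unfolding abs_mult
          using wl[OF x3(2,1)] A(2)[OF x3(1)] ni h A(1) by (intro mult_mono) auto
      qed
      finally show ?thesis by (simp add: algebra_simps)
    next
      case False
      have "norm x \<le> norm (x + h *\<^sub>R i) + norm (h *\<^sub>R i)" using norm_triangle_ineq4[of "x + h *\<^sub>R i" "h *\<^sub>R i"] by simp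
      then have "w x = 0" "w (x + h *\<^sub>R i) = 0" using False h i by (auto intro!: w0)
      then show ?thesis using A B h by simp
    qed
    have AEs: "AE y in lborel. y \<notin> sphere (0::'a) 1"
    proof -
      have "sphere (0::'a) 1 \<in> null_sets lborel"
        using negligible_sphere[of "0::'a" 1] by (simp add: negligible_iff_null_sets null_sets_completion_iff)
      then show ?thesis by (rule AE_not_in)
    qed
    define D where "D y h = indicator (ball 0 1) y * ((1 - (norm y)\<^sup>2) * (grad (m i) y \<bullet> h) - 2 * (y \<bullet> h) * m i y)" for y h
    have der: "(?F has_derivative D y) (at y) \<and> D y i = d i y" if "y \<notin> sphere 0 1" for y
    proof
      show "D y i = d i y" using i by (simp add: D_def d_def grad_inner)
      show "(?F has_derivative D y) (at y)"
      proof (cases "y \<in> ball 0 1")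
        case True
        have "((\<lambda>y. 1 - y \<bullet> y) has_derivative (\<lambda>h. - 2 * (y \<bullet> h))) (at y)"
          by (auto intro!: derivative_eq_intros simp: inner_commute)
        from has_derivative_mult[OF this has_derivative_grad[OF C_infinity_diff[OF mC[OF i]]]]
        have "((\<lambda>y. (1 - y \<bullet> y) * m i y) has_derivative D y) (at y)"
          using True by (simp add: D_def[abs_def] power2_norm_eq_inner algebra_simps)
        then show ?thesis
        proof (rule has_derivative_transform_within_open[OF _ open_ball True])
          fix z :: 'a assume "z \<in> ball 0 1"
          then have "(norm z)\<^sup>2 \<le> 1" by (simp add: power_le_one)
          then show "(1 - z \<bullet> z) * m i z = w z * m i z" by (simp add: w_def power2_norm_eq_inner)
        qed
      next
        case False
        then have y: "y \<in> - cball 0 1" using that by auto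
        have "((\<lambda>y. 0) has_derivative D y) (at y)" using False by (simp add: D_def[abs_def])
        then show ?thesis
          by (rule has_derivative_transform_within_open[OF _ open_Compl[OF closed_cball] y]) (use w0 in auto)
      qed
    qed
    show ?thesis
    proof (rule integral_derivative_zero(2)[of ?F 0 1 i "B + 6 * A" "d i" D])
      show "continuous_on UNIV ?F" unfolding w_def by (intro continuous_intros C_infinity_cont mC i)
      show "AE x in lborel. (?F has_derivative D x) (at x) \<and> D x i = d i x"
        using AEs by eventually_elim (rule der)
      show "d i \<in> borel_measurable borel" using di[OF i] by auto
    qed (use w0 lip i in auto)
  qed
  \<comment> \<open>The divergence of w q grad q inside the ball: w (|grad q|^2 + q laplace q) from
    the field q grad q, and -2 q (grad q . y) from the gradient of the weight.\<close>
  have "(\<Sum>i\<in>Basis. d i y) = indicator (ball 0 1) y * ((1 - (norm y)\<^sup>2) * ((norm (grad q y))\<^sup>2 + q y * laplace q y))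
     - indicator (ball 0 1) y * (2 * q y * (grad q y \<bullet> y))" for y
  proof -
    have p: "pd i (m i) y = q y * pd i (pd i q) y + (pd i q y)\<^sup>2" if "i \<in> Basis" for i
      unfolding m_def[abs_def] using pd_mult[OF C_infinity_diff[OF q] C_infinity_diff[OF C_infinity_pd[OF q that]], of i y]
      by (simp add: power2_eq_square)
    have "(\<Sum>i\<in>Basis. d i y) = (\<Sum>i\<in>Basis. indicator (ball 0 1) y * ((1 - (norm y)\<^sup>2) * (q y * pd i (pd i q) y + (pd i q y)\<^sup>2) - 2 * (y \<bullet> i) * (q y * pd i q y)))"
      by (intro sum.cong refl) (simp add: d_def p, simp add: m_def)
    also have "\<dots> = indicator (ball 0 1) y * ((1 - (norm y)\<^sup>2) * (q y * (\<Sum>i\<in>Basis. pd i (pd i q) y) + (\<Sum>i\<in>Basis. (pd i q y)\<^sup>2))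
       - 2 * q y * (\<Sum>i\<in>Basis. (y \<bullet> i) * pd i q y))"
      by (simp add: sum_distrib_left sum.distrib sum_subtractf algebra_simps)
    also have "(\<Sum>i\<in>Basis. (pd i q y)\<^sup>2) = (norm (grad q y))\<^sup>2"
      unfolding power2_norm_eq_inner euclidean_inner[of "grad q y" "grad q y"] by (simp add: grad_inner power2_eq_square)
    also have "(\<Sum>i\<in>Basis. (y \<bullet> i) * pd i q y) = grad q y \<bullet> y"
      unfolding euclidean_inner[of "grad q y" y] by (simp add: grad_inner mult.commute)
    finally show ?thesis by (simp add: laplace_def algebra_simps)
  qed
  then have "(LBINT y. indicator (ball 0 1) y * ((1 - (norm y)\<^sup>2) * ((norm (grad q y))\<^sup>2 + q y * laplace q y))
     - indicator (ball 0 1) y * (2 * q y * (grad q y \<bullet> y))) = (LBINT y. (\<Sum>i\<in>Basis. d i y))" by simp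
  also have "\<dots> = 0" using di main by (subst Bochner_Integration.integral_sum) auto
  finally show ?thesis
  proof (subst (asm) Bochner_Integration.integral_diff)
    have c1: "continuous_on UNIV (\<lambda>y. (1 - (norm y)\<^sup>2) * ((norm (grad q y))\<^sup>2 + q y * laplace q y))"
      unfolding laplace_def by (intro continuous_intros C_infinity_cont C_infinity_grad_cont C_infinity_pd q)
    show "integrable lborel (\<lambda>y. indicator (ball 0 1) y * ((1 - (norm y)\<^sup>2) * ((norm (grad q y))\<^sup>2 + q y * laplace q y)))"
      using integrable_indicator_ball[OF c1, of 0 1] by simp
    have c2: "continuous_on UNIV (\<lambda>y. 2 * q y * (grad q y \<bullet> y))"
      by (intro continuous_intros C_infinity_cont C_infinity_grad_cont q)
    show "integrable lborel (\<lambda>y. indicator (ball 0 1) y * (2 * q y * (grad q y \<bullet> y)))"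
      using integrable_indicator_ball[OF c2, of 0 1] by simp
  qed simp
qed

text \<open>The integral of p(x + t y)^2 over the unit ball has derivative \<open>I t\<close>. By
  \<open>weight_identity\<close> for q(y) = p(x + t y), t times this derivative is the integral of
  (1 - |y|^2)(|grad q|^2 + q laplace q). The gradient term is nonnegative and laplace q is t^2 times
  the Laplacian of p, so the derivative is at least -V P delta t.\<close>

lemma mean_square_mono_aux:
  fixes p :: "'a::euclidean_space \<Rightarrow> real"
  assumes p: "C_infinity p" and ab: "0 < a" "a \<le> b"
    and P: "0 \<le> P" "\<And>z. z \<in> cball x b \<Longrightarrow> \<bar>p z\<bar> \<le> P"
    and \<delta>: "0 \<le> \<delta>" "\<And>z. z \<in> cball x b \<Longrightarrow> \<bar>laplace p z\<bar> \<le> \<delta>"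
  shows "(LBINT y. indicator (ball 0 1) y * (p (x + a *\<^sub>R y))\<^sup>2) \<le>
     (LBINT y. indicator (ball 0 1) y * (p (x + b *\<^sub>R y))\<^sup>2) + measure lborel (ball (0::'a) 1) * P * \<delta> * b\<^sup>2"
proof -
  define V where "V = measure lborel (ball (0::'a) 1)"
  have V: "0 \<le> V" by (simp add: V_def)
  define g where "g t y = 2 * p (x + t *\<^sub>R y) * (grad p (x + t *\<^sub>R y) \<bullet> y)" for t y
  define I where "I t = (LBINT y. indicator (ball 0 1) y * g t y)" for t
  have gc: "continuous_on UNIV (\<lambda>z::real \<times> 'a. g (fst z) (snd z))"
    unfolding g_def
    by (intro continuous_on_mult continuous_on_inner continuous_on_const continuous_on_snd continuous_on_id
      continuous_on_compose2[OF C_infinity_cont[OF p, of UNIV]] subset_UNIV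
      continuous_on_compose2[OF C_infinity_grad_cont[OF p, of UNIV]]
      continuous_on_add continuous_on_scaleR continuous_on_fst)
  have I: "- (V * P * \<delta> * b) \<le> I t" if t: "t \<in> {a..b}" for t
  proof -
    have t0: "0 < t" using t ab by auto
    define q where "q y = p (t *\<^sub>R y + x)" for y
    have q: "C_infinity q" unfolding q_def[abs_def] by (rule C_infinity_affine[OF p])
    have pdq: "pd i q = (\<lambda>y. t * pd i p (t *\<^sub>R y + x))" for i
      unfolding q_def[abs_def] using pd_affine[OF C_infinity_diff[OF p]] by blast
    have gq: "grad q y = t *\<^sub>R grad p (t *\<^sub>R y + x)" for y
      unfolding grad_def pdq by (simp add: scaleR_sum_right)
    have lq: "laplace q y = t\<^sup>2 * laplace p (t *\<^sub>R y + x)" for y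
    proof -
      have "pd i (pd i q) y = t\<^sup>2 * pd i (pd i p) (t *\<^sub>R y + x)" if "i \<in> Basis" for i
      proof -
        have d: "pd i p differentiable (at x)" for x using C_infinity_diff C_infinity_pd p that by blast
        have d2: "(\<lambda>y. pd i p (t *\<^sub>R y + x)) differentiable (at y)"
          using C_infinity_diff[OF C_infinity_affine[OF C_infinity_pd[OF p that]]] .
        have "pd i (\<lambda>y. t * pd i p (t *\<^sub>R y + x)) y = t * pd i (\<lambda>y. pd i p (t *\<^sub>R y + x)) y"
          using pd_mult[of "\<lambda>_. t" y "\<lambda>y. pd i p (t *\<^sub>R y + x)" i] d2 pd_eqI[OF has_derivative_const, of i t] by simp
        then show ?thesis unfolding pdq pd_affine[OF d] by (simp add: power2_eq_square)
      qed
      then show ?thesis by (simp add: laplace_def sum_distrib_left)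
    qed
    have "t * I t = (LBINT y. indicator (ball 0 1) y * (2 * q y * (grad q y \<bullet> y)))"
      unfolding I_def integral_mult_right_zero[symmetric] gq g_def q_def
      by (intro Bochner_Integration.integral_cong refl) (simp add: add.commute)
    also have "\<dots> = (LBINT y. indicator (ball 0 1) y * ((1 - (norm y)\<^sup>2) * ((norm (grad q y))\<^sup>2 + q y * laplace q y)))"
      by (rule weight_identity[OF q])
    also have "\<dots> \<ge> (LBINT y. indicator (ball 0 1) (y::'a) * (- (P * (t\<^sup>2 * \<delta>))))"
    proof (rule integral_mono)
      show "integrable lborel (\<lambda>y::'a. indicator (ball 0 1) y * (- (P * (t\<^sup>2 * \<delta>))) :: real)"
        using integrable_indicator_ball[of "\<lambda>_. - (P * (t\<^sup>2 * \<delta>))" "0::'a" 1] by simp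
      have c1: "continuous_on UNIV (\<lambda>y. (1 - (norm y)\<^sup>2) * ((norm (grad q y))\<^sup>2 + q y * laplace q y))"
        unfolding laplace_def by (intro continuous_intros C_infinity_cont C_infinity_grad_cont C_infinity_pd q)
      show "integrable lborel (\<lambda>y. indicator (ball 0 1) y * ((1 - (norm y)\<^sup>2) * ((norm (grad q y))\<^sup>2 + q y * laplace q y)))"
        using integrable_indicator_ball[OF c1, of 0 1] by simp
      fix y :: 'a
      show "indicator (ball 0 1) y * (- (P * (t\<^sup>2 * \<delta>))) \<le> indicator (ball 0 1) y * ((1 - (norm y)\<^sup>2) * ((norm (grad q y))\<^sup>2 + q y * laplace q y))"
      proof (cases "y \<in> ball 0 1")
        case True
        have z: "t *\<^sub>R y + x \<in> cball x b"
        proof -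
          have "t * norm y \<le> b * 1" using True t t0 by (intro mult_mono) auto
          then show ?thesis using t0 by (simp add: dist_norm)
        qed
        have w: "0 \<le> 1 - (norm y)\<^sup>2" "1 - (norm y)\<^sup>2 \<le> 1" using True by (auto simp: power_le_one)
        have "\<bar>q y * laplace q y\<bar> \<le> P * (t\<^sup>2 * \<delta>)"
          unfolding abs_mult lq using P(2)[OF z] \<delta>(2)[OF z] P(1)
          by (intro mult_mono) (auto simp: q_def abs_mult intro!: mult_left_mono)
        then have "- (P * (t\<^sup>2 * \<delta>)) \<le> (norm (grad q y))\<^sup>2 + q y * laplace q y"
          using zero_le_power2[of "norm (grad q y)"] by linarith
        from mult_left_mono[OF this w(1)]
        have "(1 - (norm y)\<^sup>2) * - (P * (t\<^sup>2 * \<delta>)) \<le> (1 - (norm y)\<^sup>2) * ((norm (grad q y))\<^sup>2 + q y * laplace q y)" .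
        moreover have "(1 - (norm y)\<^sup>2) * (P * (t\<^sup>2 * \<delta>)) \<le> 1 * (P * (t\<^sup>2 * \<delta>))"
          using P(1) \<delta>(1) w by (intro mult_right_mono) auto
        ultimately show ?thesis using True by simp
      qed simp
    qed
    finally have "t * I t \<ge> - (V * P * \<delta> * t) * t"
      by (simp add: V_def power2_eq_square mult_ac)
    then have "t * (- (V * P * \<delta> * t)) \<le> t * I t" by (simp add: mult.commute)
    then have "- (V * P * \<delta> * t) \<le> I t" using t0 by (simp only: mult_le_cancel_left_pos)
    moreover have "V * P * \<delta> * t \<le> V * P * \<delta> * b" using t V P(1) \<delta>(1) by (intro mult_left_mono) auto
    ultimately show ?thesis by linarith
  qed
  have meas [measurable]: "(\<lambda>z::real \<times> 'a. g (fst z) (snd z)) \<in> borel_measurable (lborel \<Otimes>\<^sub>M lborel)"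
    using borel_measurable_continuous_onI[OF gc] by (simp add: borel_prod[symmetric] cong: measurable_cong_sets)
  obtain C where C: "\<And>t y. t \<in> {a..b} \<Longrightarrow> y \<in> cball 0 1 \<Longrightarrow> \<bar>g t y\<bar> \<le> C"
  proof -
    have "compact ((\<lambda>z::real \<times> 'a. g (fst z) (snd z)) ` ({a..b} \<times> cball 0 1))"
      by (intro compact_continuous_image continuous_on_subset[OF gc] compact_Times) auto
    then obtain C where "\<And>w. w \<in> (\<lambda>z::real \<times> 'a. g (fst z) (snd z)) ` ({a..b} \<times> cball 0 1) \<Longrightarrow> norm w \<le> C"
      using compact_imp_bounded bounded_iff by metis
    then have "\<bar>g t y\<bar> \<le> C" if "t \<in> {a..b}" "y \<in> cball 0 1" for t y
      using that by (force simp: image_iff)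
    then show ?thesis using that by blast
  qed
  \<comment> \<open>Exchanging the integrals turns the integral of \<open>I\<close> over [a,b] into
    the increments of p^2 along the segments from x + a y to x + b y.\<close>
  have Fub: "integrable (lborel \<Otimes>\<^sub>M lborel) (\<lambda>(t, y). indicator {a..b} t * (indicator (ball 0 1) y * g t y))"
  proof (rule Bochner_Integration.integrable_bound[of _ "\<lambda>z. C * indicator ({a..b} \<times> ball (0::'a) 1) z :: real"])
    have "emeasure (lborel \<Otimes>\<^sub>M lborel) ({a..b} \<times> ball (0::'a) 1) < \<infinity>"
      using emeasure_lborel_ball_finite[of "0::'a" 1] by (subst lborel.emeasure_pair_measure_Times) (auto simp: ennreal_mult_less_top emeasure_lborel_Icc_eq)
    then show "integrable (lborel \<Otimes>\<^sub>M lborel) (\<lambda>z. C * indicator ({a..b} \<times> ball (0::'a) 1) z :: real)"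
      by (intro integrable_mult_right integrable_real_indicator) auto
    show "AE z in lborel \<Otimes>\<^sub>M lborel. norm (case z of (t, y) \<Rightarrow> indicator {a..b} t * (indicator (ball 0 1) y * g t y))
       \<le> norm (C * indicator ({a..b} \<times> ball (0::'a) 1) z)"
      using C by (intro AE_I2) (auto simp: indicator_def intro: order_trans[OF _ abs_ge_self])
    have "(\<lambda>z. indicator ({a..b} \<times> ball (0::'a) 1) z * g (fst z) (snd z)) \<in> borel_measurable (lborel \<Otimes>\<^sub>M lborel)"
      by (intro borel_measurable_times borel_measurable_indicator meas pair_measureI) auto
    moreover have "(\<lambda>(t, y). indicator {a..b} t * (indicator (ball 0 1) y * g t y)) = (\<lambda>z. indicator ({a..b} \<times> ball (0::'a) 1) z * g (fst z) (snd z))"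
      by (auto simp: fun_eq_iff indicator_def)
    ultimately show "(\<lambda>(t, y). indicator {a..b} t * (indicator (ball 0 1) y * g t y)) \<in> borel_measurable (lborel \<Otimes>\<^sub>M lborel)"
      by simp
  qed
  have inner: "(LBINT t. indicator {a..b} t * (indicator (ball 0 1) y * g t y)) =
     indicator (ball 0 1) y * (p (x + b *\<^sub>R y))\<^sup>2 - indicator (ball 0 1) y * (p (x + a *\<^sub>R y))\<^sup>2" for y
  proof -
    have "(LBINT t. g t y * indicator {a..b} t) = (p (x + b *\<^sub>R y))\<^sup>2 - (p (x + a *\<^sub>R y))\<^sup>2"
    proof (rule integral_FTC_Icc_real[OF ab(2)])
      fix t assume "a \<le> t" "t \<le> b"
      have "((\<lambda>t. x + t *\<^sub>R y) has_derivative (\<lambda>h. h *\<^sub>R y)) (at t)" by (auto intro!: derivative_eq_intros)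
      from has_derivative_compose[OF this has_derivative_grad[OF C_infinity_diff[OF p]]]
      have "((\<lambda>t. p (x + t *\<^sub>R y)) has_derivative (\<lambda>h. grad p (x + t *\<^sub>R y) \<bullet> h *\<^sub>R y)) (at t)" .
      then have "((\<lambda>t. p (x + t *\<^sub>R y)) has_real_derivative (grad p (x + t *\<^sub>R y) \<bullet> y)) (at t)"
      proof -
        assume h: "((\<lambda>t. p (x + t *\<^sub>R y)) has_derivative (\<lambda>h. grad p (x + t *\<^sub>R y) \<bullet> h *\<^sub>R y)) (at t)"
        have "(\<lambda>h. grad p (x + t *\<^sub>R y) \<bullet> h *\<^sub>R y) = (*) (grad p (x + t *\<^sub>R y) \<bullet> y)"
          by (auto simp: fun_eq_iff)
        with h show ?thesis by (simp only: has_field_derivative_def)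
      qed
      from DERIV_power[OF this, of 2] show "((\<lambda>t. (p (x + t *\<^sub>R y))\<^sup>2) has_real_derivative g t y) (at t)"
        by (simp add: g_def mult_ac)
      have "continuous_on UNIV (\<lambda>t. g t y)"
        using continuous_on_compose2[OF gc continuous_on_Pair[OF continuous_on_id continuous_on_const], of y UNIV] by simp
      then show "isCont (\<lambda>t. g t y) t" by (simp add: continuous_on_eq_continuous_at)
    qed
    then have "indicator (ball 0 1) y * (LBINT t. g t y * indicator {a..b} t) =
        indicator (ball 0 1) y * ((p (x + b *\<^sub>R y))\<^sup>2 - (p (x + a *\<^sub>R y))\<^sup>2)" by simp
    then show ?thesis unfolding integral_mult_right_zero[symmetric] by (simp add: mult_ac right_diff_distrib)
  qed
  have ci: "integrable lborel (\<lambda>y. indicator (ball 0 1) y * (p (x + t *\<^sub>R y))\<^sup>2)" for t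
  proof -
    have c: "continuous_on UNIV (\<lambda>y. (p (x + t *\<^sub>R y))\<^sup>2)"
      by (intro continuous_intros continuous_on_compose2[OF C_infinity_cont[OF p, of UNIV]]) auto
    show ?thesis using integrable_indicator_ball[OF c, of 0 1] by simp
  qed
  have "(LBINT y. indicator (ball 0 1) y * (p (x + b *\<^sub>R y))\<^sup>2) - (LBINT y. indicator (ball 0 1) y * (p (x + a *\<^sub>R y))\<^sup>2)
    = (LBINT y. (LBINT t. indicator {a..b} t * (indicator (ball 0 1) y * g t y)))"
    unfolding inner using ci by simp
  also have "\<dots> = (LBINT t. (LBINT y. indicator {a..b} t * (indicator (ball 0 1) y * g t y)))"
    by (rule lborel_pair.Fubini_integral[OF Fub])
  also have "\<dots> = (LBINT t. indicator {a..b} t * I t)" by (simp add: I_def)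
  also have "\<dots> \<ge> (LBINT t. indicator {a..b} t * (- (V * P * \<delta> * b)))"
  proof (rule integral_mono)
    show "integrable lborel (\<lambda>t. indicator {a..b} t * (- (V * P * \<delta> * b)))"
      by (intro integrable_mult_left integrable_real_indicator) (auto simp: emeasure_lborel_Icc_eq)
    show "integrable lborel (\<lambda>t. indicator {a..b} t * I t)"
      using lborel_pair.integrable_fst[OF Fub] by (simp add: I_def)
  qed (use I in \<open>auto simp: indicator_def\<close>)
  finally have "(LBINT y. indicator (ball 0 1) y * (p (x + b *\<^sub>R y))\<^sup>2) - (LBINT y. indicator (ball 0 1) y * (p (x + a *\<^sub>R y))\<^sup>2)
     \<ge> - ((b - a) * (V * P * \<delta> * b))" using ab by simp
  \<comment> \<open>The length b - a is bounded crudely by b; the error term tends to 0 with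
    \<delta> anyway.\<close>
  moreover have "(b - a) * (V * P * \<delta> * b) \<le> b * (V * P * \<delta> * b)"
    using ab V P(1) \<delta>(1) by (intro mult_right_mono) auto
  ultimately show ?thesis by (simp add: V_def power2_eq_square mult_ac)
qed

text \<open>Rescaling to the unit ball produces the volume ratio \<open>(a / b) ^ DIM('a)\<close>.
  This factor is what makes the decay of the energy exactly that of the volume.\<close>

lemma mean_square_mono:
  fixes p :: "'a::euclidean_space \<Rightarrow> real"
  assumes p: "C_infinity p" and ab: "0 < a" "a \<le> b"
    and P: "0 \<le> P" "\<And>z. z \<in> cball x b \<Longrightarrow> \<bar>p z\<bar> \<le> P"
    and \<delta>: "0 \<le> \<delta>" "\<And>z. z \<in> cball x b \<Longrightarrow> \<bar>laplace p z\<bar> \<le> \<delta>"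
  shows "(LBINT z. indicator (ball x a) z * (p z)\<^sup>2) \<le> (a / b) ^ DIM('a) *
     ((LBINT z. indicator (ball x b) z * (p z)\<^sup>2) + b ^ DIM('a) * (measure lborel (ball (0::'a) 1) * P * \<delta> * b\<^sup>2))"
proof -
  have *: "(LBINT z. indicator (ball x t) z * (p z)\<^sup>2) = t ^ DIM('a) * (LBINT y. indicator (ball 0 1) y * (p (x + t *\<^sub>R y))\<^sup>2)"
    if t: "0 < t" for t
  proof -
    have "indicator (ball x t) (x + t *\<^sub>R y) = (indicator (ball 0 1) y :: real)" for y
      using t by (auto simp: indicator_def dist_norm)
    moreover have "(\<lambda>z. indicator (ball x t) z * (p z)\<^sup>2) \<in> borel_measurable borel"
      by (intro borel_measurable_times borel_measurable_indicator borel_measurable_power C_infinity_borel[OF p]) simp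
    ultimately show ?thesis
      using t by (subst lborel_integral_affine[of _ t x]) auto
  qed
  have b: "0 < b" using ab by simp
  have eq: "(a / b) ^ DIM('a) * (b ^ DIM('a) * u + b ^ DIM('a) * v) = a ^ DIM('a) * (u + v)" for u v
    using b by (simp add: power_divide field_simps)
  show ?thesis
    unfolding *[OF ab(1)] *[OF b] eq
    using ab by (intro mult_left_mono mean_square_mono_aux[OF p ab P \<delta>]) auto
qed

section \<open>Energy decay\<close>

lemma sqint_grad: 
  fixes \<psi> :: "'a::euclidean_space \<Rightarrow> real"
  assumes "test_function S \<psi>"
  shows "sqint (grad \<psi>)" and "integrable lborel (grad \<psi>)"
proof -
  obtain K where K: "C_infinity \<psi>" "compact K" "K \<subseteq> S" "\<And>x. x \<notin> K \<Longrightarrow> \<psi> x = 0"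
    using assms test_functionE by blast
  have z: "grad \<psi> x = 0" if "x \<notin> K" for x
    unfolding grad_def using pd_zero_outside[OF compact_imp_closed[OF K(2)] K(4) that] by simp
  have c: "continuous_on UNIV (grad \<psi>)" using C_infinity_grad_cont K(1) by blast
  show "integrable lborel (grad \<psi>)" by (rule continuous_compact_support_integrable[OF c K(2) z])
  have "integrable lborel (\<lambda>x. (norm (grad \<psi> x))\<^sup>2)"
    by (rule continuous_compact_support_integrable[OF _ K(2)]) (use c z in \<open>auto intro!: continuous_intros\<close>)
  then show "sqint (grad \<psi>)" using borel_measurable_continuous_onI[OF c] by (simp add: sqint_def)
qed

lemma nrm_reflect:
  fixes H :: "'a::euclidean_space \<Rightarrow> 'b::euclidean_space"
  assumes H: "sqint H"
  shows "sqint (\<lambda>y. H (z - y))" and "nrm (\<lambda>y. H (z - y)) = nrm H"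
proof -
  have [measurable]: "H \<in> borel_measurable borel" using H by (rule sqint_borel)
  show "sqint (\<lambda>y. H (z - y))"
    using lborel_integrable_affine[OF sqint_integrable[OF H], of "-1" z] by (simp add: sqint_def)
  show "nrm (\<lambda>y. H (z - y)) = nrm H"
    using lborel_integral_affine[of "\<lambda>y. (norm (H y))\<^sup>2" "-1" z] by (simp add: nrm_def)
qed

lemma sqint_test: "test_function S \<phi> \<Longrightarrow> sqint \<phi>"
  for \<phi> :: "'a::euclidean_space \<Rightarrow> real"
  using test_integrable[OF test_mult[OF test_C_infinity, of S \<phi> S \<phi>]]
    test_borel[of S \<phi>] by (simp add: sqint_def power2_eq_square)

text \<open>Cauchy-Schwarz in y, with the basis vector moved onto the reflected kernel. The bound is
  pointwise in z although F is only square-integrable.\<close>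

lemma conv_inner_bound:
  fixes F :: "'a::euclidean_space \<Rightarrow> 'b::euclidean_space"
  assumes t: "test_function S \<eta>" and F: "integrable lborel F" "sqint F" and i: "i \<in> Basis"
  shows "\<bar>conv \<eta> F z \<bullet> i\<bar> \<le> nrm F * nrm \<eta>"
proof -
  have s: "sqint (\<lambda>y. \<eta> (z - y) *\<^sub>R i)"
    using nrm_reflect(1)[OF sqint_test[OF t], of z] i by (auto simp: sqint_def power_mult_distrib)
  have "conv \<eta> F z \<bullet> i = (LBINT y. (\<eta> (z - y) *\<^sub>R F y) \<bullet> i)"
    unfolding conv_def by (rule integral_inner_left[symmetric, OF conv_integrable[OF t F(1)]])
  also have "\<dots> = (LBINT y. F y \<bullet> (\<eta> (z - y) *\<^sub>R i))" by simp
  finally have "\<bar>conv \<eta> F z \<bullet> i\<bar> \<le> nrm F * nrm (\<lambda>y. \<eta> (z - y) *\<^sub>R i)"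
    using nrm_Cauchy_Schwarz[OF F(2) s] by simp
  also have "nrm (\<lambda>y. \<eta> (z - y) *\<^sub>R i) = nrm (\<lambda>y. \<eta> (z - y))" using i by (simp add: nrm_def power_mult_distrib)
  also have "\<dots> = nrm \<eta>" by (rule nrm_reflect(2)[OF sqint_test[OF t]])
  finally show ?thesis .
qed

text \<open>The margin from s to 3/2 s leaves the closed support of the mollifier. There the
  function vanishes on a neighbourhood and so do its derivatives.\<close>

lemma pd_mollifier_zero:
  assumes "0 < s" "3/2 * s \<le> norm z" shows "pd i (mollifier s) z = 0"
  by (rule pd_zero_outside[of "cball 0 s"]) (use assms in \<open>auto intro!: mollifier_zero\<close>)

lemma pd_pd_mollifier_zero:
  assumes "0 < s" "3/2 * s \<le> norm z" shows "pd j (pd i (mollifier s)) z = 0"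
proof (rule pd_zero_outside[of "cball 0 s"])
  show "pd i (mollifier s) x = 0" if "x \<notin> cball 0 s" for x :: 'a
    by (rule pd_zero_outside[of "cball 0 s"]) (use assms that in \<open>auto intro!: mollifier_zero\<close>)
qed (use assms in auto)

text \<open>\<open>K\<close> is fixed before \<open>e\<close>, \<open>v\<close> and
  \<open>F\<close>, so that e can tend to 0 while the scale s stays fixed. The components of the
  mollified field are partial derivatives of a mollified function; their Laplacians are integrals of
  F against gradients of test functions, hence at most \<open>e\<close> times a constant.\<close>

lemma approx_harmonic_mean:
  fixes x :: "'a::euclidean_space"
  assumes s: "0 < s" "4 * s < r" and Q: "0 \<le> Q"
  shows "\<exists>K\<ge>0. \<forall>e v F. 0 \<le> e \<and> integrable lborel v \<and> integrable lborel F \<and> sqint F \<and> nrm F \<le> Q \<and>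
      weakly_diff (ball x r) v F \<and>
      (\<forall>\<phi>. test_function (ball x r) \<phi> \<longrightarrow> \<bar>LBINT y. F y \<bullet> grad \<phi> y\<bar> \<le> e * nrm (grad \<phi>)) \<longrightarrow>
      (nrm (\<lambda>z. indicator (ball x (r/2)) z *\<^sub>R conv (mollifier s) F z))\<^sup>2
        \<le> ((r/2) / (r - 2 * s)) ^ DIM('a) * ((nrm F)\<^sup>2 + e * K)"
proof -
  define \<eta> :: "'a \<Rightarrow> real" where "\<eta> = mollifier s"
  define \<theta> where "\<theta> i = pd i \<eta>" for i
  \<comment> \<open>Kernels of radius 3/2 s centred in \<open>cball x b\<close> have their support
    inside \<open>ball x r\<close>, with s/2 to spare.\<close>
  define b where "b = r - 2 * s"
  define P where "P = Q * nrm \<eta>"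
  define V where "V = measure lborel (ball (0::'a) 1)"
  define N where "N i = nrm (grad (\<theta> i))" for i
  define K where "K = (\<Sum>i\<in>Basis. b ^ DIM('a) * (V * P * N i * b\<^sup>2))"
  have b: "0 < b" "r/2 \<le> b" "0 < r" using s by (auto simp: b_def)
  have P0: "0 \<le> P" using Q by (simp add: P_def)
  have N0: "0 \<le> N i" for i by (simp add: N_def)
  have K0: "0 \<le> K" unfolding K_def V_def using b P0 N0 by (intro sum_nonneg mult_nonneg_nonneg) auto
  have \<eta>: "test_function UNIV \<eta>" unfolding \<eta>_def by (rule mollifier_test[OF s(1)])
  have \<eta>C: "C_infinity \<eta>" using \<eta> test_C_infinity by blast
  have \<theta>: "test_function UNIV (\<theta> i)" if "i \<in> Basis" for i unfolding \<theta>_def by (rule test_pd[OF \<eta> that])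
  have zero: "\<eta> z = 0" "\<theta> i z = 0" "pd j (\<theta> i) z = 0" if "3/2 * s \<le> norm z" for z i j
    using that s mollifier_zero[OF s(1), of z] pd_mollifier_zero[OF s(1) that] pd_pd_mollifier_zero[OF s(1) that]
    by (auto simp: \<eta>_def \<theta>_def)
  have sub: "cball z (3/2 * s) \<subseteq> ball x r" if "z \<in> cball x b" for z
  proof
    fix y assume "y \<in> cball z (3/2 * s)"
    then have "dist x y \<le> b + 3/2 * s" using that dist_triangle[of x y z] by auto
    then show "y \<in> ball x r" using s by (auto simp: b_def)
  qed
  have "(nrm (\<lambda>z. indicator (ball x (r/2)) z *\<^sub>R conv \<eta> F z))\<^sup>2 \<le> ((r/2) / b) ^ DIM('a) * ((nrm F)\<^sup>2 + e * K)"
    if e: "0 \<le> e" and v: "integrable lborel v" and F: "integrable lborel F" "sqint F" "nrm F \<le> Q"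
      and w: "weakly_diff (ball x r) v F"
      and har: "\<And>\<phi>. test_function (ball x r) \<phi> \<Longrightarrow> \<bar>LBINT y. F y \<bullet> grad \<phi> y\<bar> \<le> e * nrm (grad \<phi>)"
    for e v and F :: "'a \<Rightarrow> 'a"
  proof -
    \<comment> \<open>Differentiating the kernel makes \<open>p i\<close> smooth everywhere; it is
      the i-th component of the mollified field only on \<open>cball x b\<close>, where F is a weak
      gradient near all the points involved.\<close>
    define p where "p i = conv (\<theta> i) v" for i
    have pC: "C_infinity (p i)" if "i \<in> Basis" for i
      unfolding p_def by (rule conv_C_infinity[OF \<theta>[OF that] v])
    have p1: "p i z = conv \<eta> F z \<bullet> i" if i: "i \<in> Basis" and z: "z \<in> cball x b" for i z
    proof -
      have "p i z = pd i (conv \<eta> v) z" unfolding p_def \<theta>_def using pd_conv[OF \<eta> v i] by simp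
      also have "\<dots> = grad (conv \<eta> v) z \<bullet> i" using i by (simp add: grad_inner)
      also have "grad (conv \<eta> v) z = conv \<eta> F z"
        by (rule grad_conv[OF \<eta>C zero(1) sub[OF z] v F(1) w])
      finally show ?thesis .
    qed
    have pP: "\<bar>p i z\<bar> \<le> P" if "i \<in> Basis" "z \<in> cball x b" for i z
    proof -
      have "\<bar>p i z\<bar> \<le> nrm F * nrm \<eta>" unfolding p1[OF that] by (rule conv_inner_bound[OF \<eta> F(1,2) that(1)])
      also have "\<dots> \<le> P" unfolding P_def using F(3) by (intro mult_right_mono) auto
      finally show ?thesis .
    qed
    have lap: "\<bar>laplace (p i) z\<bar> \<le> e * N i" if i: "i \<in> Basis" and z: "z \<in> cball x b" for i z
    proof -
      have t2: "test_function UNIV (pd j (\<theta> i))" if "j \<in> Basis" for j by (rule test_pd[OF \<theta>[OF i] that])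
      \<comment> \<open>Of the two derivatives in direction j, one stays on the kernel and one is
        passed to v, where it becomes F. Summed over j this pairs F with the gradient of the
        reflected \<open>\<theta> i\<close>.\<close>
      have "pd j (pd j (p i)) z = (LBINT y. pd j (\<theta> i) (z - y) * (F y \<bullet> j))" if j: "j \<in> Basis" for j
      proof -
        have "pd j (p i) = conv (pd j (\<theta> i)) v" unfolding p_def using pd_conv[OF \<theta>[OF i] v j] by blast
        then have "pd j (pd j (p i)) z = grad (conv (pd j (\<theta> i)) v) z \<bullet> j" using j by (simp add: grad_inner)
        also have "grad (conv (pd j (\<theta> i)) v) z = conv (pd j (\<theta> i)) F z"
          by (rule grad_conv[OF test_C_infinity[OF t2[OF j]] zero(3) sub[OF z] v F(1) w])
        also have "\<dots> \<bullet> j = (LBINT y. (pd j (\<theta> i) (z - y) *\<^sub>R F y) \<bullet> j)"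
          unfolding conv_def by (rule integral_inner_left[symmetric, OF conv_integrable[OF t2[OF j] F(1)]])
        finally show ?thesis by simp
      qed
      then have "laplace (p i) z = (\<Sum>j\<in>Basis. LBINT y. pd j (\<theta> i) (z - y) * (F y \<bullet> j))"
        by (simp add: laplace_def)
      also have "\<dots> = (LBINT y. (\<Sum>j\<in>Basis. pd j (\<theta> i) (z - y) * (F y \<bullet> j)))"
      proof (rule Bochner_Integration.integral_sum[symmetric])
        fix j :: 'a assume "j \<in> Basis"
        then show "integrable lborel (\<lambda>y. pd j (\<theta> i) (z - y) * (F y \<bullet> j))"
          using integrable_inner_left[OF conv_integrable[OF t2 F(1), of j z], of j] by simp
      qed
      also have "\<dots> = - (LBINT y. F y \<bullet> grad (\<lambda>y. \<theta> i (z - y)) y)"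
      proof -
        have "grad (\<lambda>y. \<theta> i (z - y)) y = - grad (\<theta> i) (z - y)" for y
          unfolding grad_def using test_reflect(2)[OF test_C_infinity[OF \<theta>[OF i]] zero(2) sub[OF z]]
          by (simp add: sum_negf)
        moreover have "(\<Sum>j\<in>Basis. pd j (\<theta> i) (z - y) * (F y \<bullet> j)) = F y \<bullet> grad (\<theta> i) (z - y)" for y
          unfolding grad_def by (simp add: inner_sum_right)
        ultimately show ?thesis by simp
      qed
      finally have "\<bar>laplace (p i) z\<bar> = \<bar>LBINT y. F y \<bullet> grad (\<lambda>y. \<theta> i (z - y)) y\<bar>" by simp
      also have "\<dots> \<le> e * nrm (grad (\<lambda>y. \<theta> i (z - y)))"
        by (rule har[OF test_reflect(1)[OF test_C_infinity[OF \<theta>[OF i]] zero(2) sub[OF z]]])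
      also have "nrm (grad (\<lambda>y. \<theta> i (z - y))) = nrm (\<lambda>y. - grad (\<theta> i) (z - y))"
        unfolding grad_def[abs_def] using test_reflect(2)[OF test_C_infinity[OF \<theta>[OF i]] zero(2) sub[OF z]]
          by (simp add: sum_negf)
      also have "\<dots> = N i" unfolding N_def nrm_minus by (rule nrm_reflect(2)[OF sqint_grad(1)[OF \<theta>[OF i]]])
      finally show ?thesis .
    qed
    have mono: "(LBINT z. indicator (ball x (r/2)) z * (p i z)\<^sup>2) \<le> ((r/2) / b) ^ DIM('a) *
       ((LBINT z. indicator (ball x b) z * (p i z)\<^sup>2) + b ^ DIM('a) * (V * P * (e * N i) * b\<^sup>2))" if "i \<in> Basis" for i
      unfolding V_def by (rule mean_square_mono[OF pC[OF that]]) (use b P0 e N0 pP[OF that] lap[OF that] in auto)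
    have rep: "(nrm (\<lambda>z. indicator (ball x t) z *\<^sub>R conv \<eta> F z))\<^sup>2 = (\<Sum>i\<in>Basis. LBINT z. indicator (ball x t) z * (p i z)\<^sup>2)"
      if t: "t \<le> b" for t
    proof -
      have "(norm (indicator (ball x t) z *\<^sub>R conv \<eta> F z))\<^sup>2 = (\<Sum>i\<in>Basis. indicator (ball x t) z * (p i z)\<^sup>2)" for z
      proof (cases "z \<in> ball x t")
        case True
        then have z: "z \<in> cball x b" using t by auto
        have "(norm (conv \<eta> F z))\<^sup>2 = (\<Sum>i\<in>Basis. (conv \<eta> F z \<bullet> i)\<^sup>2)"
          unfolding power2_norm_eq_inner euclidean_inner[of "conv \<eta> F z" "conv \<eta> F z"] by (simp add: power2_eq_square)
        then show ?thesis using True p1[OF _ z] by simp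
      qed simp
      then have "(nrm (\<lambda>z. indicator (ball x t) z *\<^sub>R conv \<eta> F z))\<^sup>2 = (LBINT z. (\<Sum>i\<in>Basis. indicator (ball x t) z * (p i z)\<^sup>2))"
        unfolding nrm_sq by simp
      also have "\<dots> = (\<Sum>i\<in>Basis. LBINT z. indicator (ball x t) z * (p i z)\<^sup>2)"
      proof (rule Bochner_Integration.integral_sum)
        fix i :: 'a assume i: "i \<in> Basis"
        have "continuous_on UNIV (\<lambda>z. (p i z)\<^sup>2)" by (intro continuous_intros C_infinity_cont pC i)
        from integrable_indicator_ball[OF this, of x t]
        show "integrable lborel (\<lambda>z. indicator (ball x t) z * (p i z)\<^sup>2)" by simp
      qed
      finally show ?thesis .
    qed
    have cv: "sqint (conv \<eta> F)" "nrm (conv \<eta> F) \<le> nrm F" unfolding \<eta>_def using nrm_conv_le[OF s(1) F(1,2)] by auto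
    have le: "(nrm (\<lambda>z. indicator (ball x b) z *\<^sub>R conv \<eta> F z))\<^sup>2 \<le> (nrm F)\<^sup>2"
    proof (rule power_mono)
      have "nrm (\<lambda>z. indicator (ball x b) z *\<^sub>R conv \<eta> F z) \<le> nrm (conv \<eta> F)"
        by (rule nrm_mono(2)[OF cv(1)]) (use sqint_borel[OF sqint_indicator[OF cv(1), of "ball x b"]] in \<open>auto simp: indicator_def\<close>)
      then show "nrm (\<lambda>z. indicator (ball x b) z *\<^sub>R conv \<eta> F z) \<le> nrm F" using cv(2) by simp
    qed simp
    have "(nrm (\<lambda>z. indicator (ball x (r/2)) z *\<^sub>R conv \<eta> F z))\<^sup>2 = (\<Sum>i\<in>Basis. LBINT z. indicator (ball x (r/2)) z * (p i z)\<^sup>2)"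
      by (rule rep[OF b(2)])
    also have "\<dots> \<le> (\<Sum>i\<in>Basis. ((r/2) / b) ^ DIM('a) *
       ((LBINT z. indicator (ball x b) z * (p i z)\<^sup>2) + b ^ DIM('a) * (V * P * (e * N i) * b\<^sup>2)))"
      by (rule sum_mono[OF mono])
    also have "\<dots> = ((r/2) / b) ^ DIM('a) * ((\<Sum>i\<in>Basis. LBINT z. indicator (ball x b) z * (p i z)\<^sup>2) + e * K)"
      unfolding K_def by (simp add: sum_distrib_left sum.distrib distrib_left mult_ac)
    also have "(\<Sum>i\<in>Basis. LBINT z. indicator (ball x b) z * (p i z)\<^sup>2) = (nrm (\<lambda>z. indicator (ball x b) z *\<^sub>R conv \<eta> F z))\<^sup>2"
      by (rule rep[symmetric]) simp
    also have "((r/2) / b) ^ DIM('a) * ((nrm (\<lambda>z. indicator (ball x b) z *\<^sub>R conv \<eta> F z))\<^sup>2 + e * K)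
       \<le> ((r/2) / b) ^ DIM('a) * ((nrm F)\<^sup>2 + e * K)"
      using le b by (intro mult_left_mono add_right_mono) auto
    finally show ?thesis .
  qed
  with K0 show ?thesis unfolding b_def \<eta>_def by blast
qed

text \<open>Energy within \<open>e\<^sup>2\<close> of the infimum suffices: along the line psi + t
  phi the energy is a quadratic in t that stays above the infimum, and its discriminant bounds the
  linear coefficient. A gap of \<open>e\<^sup>2\<close> rather than e makes that bound linear in
  e.\<close>

lemma near_minimizer:
  fixes G :: "'a::euclidean_space \<Rightarrow> 'a"
  assumes G: "sqint G" and e: "0 < e"
  obtains \<psi> where "test_function B \<psi>" "(nrm (\<lambda>y. G y + grad \<psi> y))\<^sup>2 \<le> (nrm G)\<^sup>2 + e\<^sup>2"
    "\<And>\<phi>. test_function B \<phi> \<Longrightarrow> \<bar>LBINT y. (G y + grad \<psi> y) \<bullet> grad \<phi> y\<bar> \<le> e * nrm (grad \<phi>)"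
proof -
  define A where "A = {(nrm (\<lambda>y. G y + grad \<psi> y))\<^sup>2 | \<psi>. test_function B \<psi>}"
  have bdd: "bdd_below A" unfolding A_def by (rule bdd_belowI[of _ 0]) auto
  have ne: "A \<noteq> {}" unfolding A_def using test_0[of B] by blast
  have low: "Inf A \<le> (nrm (\<lambda>y. G y + grad \<psi> y))\<^sup>2" if "test_function B \<psi>" for \<psi>
    using bdd that by (intro cInf_lower) (auto simp: A_def)
  have "Inf A < Inf A + e\<^sup>2" using e by simp
  then obtain a where "a \<in> A" "a < Inf A + e\<^sup>2" using cInf_lessD[OF ne] by blast
  then obtain \<psi> where \<psi>: "test_function B \<psi>" "(nrm (\<lambda>y. G y + grad \<psi> y))\<^sup>2 < Inf A + e\<^sup>2"
    unfolding A_def by blast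
  have F: "sqint (\<lambda>y. G y + grad \<psi> y)" by (intro sqint_add G sqint_grad(1)[OF \<psi>(1)])
  show ?thesis
  proof (rule that[OF \<psi>(1)])
    have g0: "grad (\<lambda>x. 0) y = 0" for y :: 'a unfolding grad_def using test_zero_grad[OF test_0, of _ "{}"]
      by (simp add: grad_def)
    \<comment> \<open>The zero function is among the perturbations.\<close>
    have "Inf A \<le> (nrm G)\<^sup>2" using low[OF test_0] by (simp add: g0)
    then show "(nrm (\<lambda>y. G y + grad \<psi> y))\<^sup>2 \<le> (nrm G)\<^sup>2 + e\<^sup>2" using \<psi>(2) by linarith
    fix \<phi> assume \<phi>: "test_function B \<phi>"
    show "\<bar>LBINT y. (G y + grad \<psi> y) \<bullet> grad \<phi> y\<bar> \<le> e * nrm (grad \<phi>)"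
    proof (rule discriminant_bound)
      fix t :: real
      have tt: "test_function B (\<lambda>y. \<psi> y + t * \<phi> y)" by (intro test_add test_cmult \<psi> \<phi>)
      have d: "\<psi> differentiable (at y)" "\<phi> differentiable (at y)" for y
        using \<psi>(1) \<phi> C_infinity_diff test_C_infinity by blast+
      have "grad (\<lambda>y. \<psi> y + t * \<phi> y) y = grad \<psi> y + t *\<^sub>R grad \<phi> y" for y
      proof (rule grad_eqI)
        show "((\<lambda>y. \<psi> y + t * \<phi> y) has_derivative (\<bullet>) (grad \<psi> y + t *\<^sub>R grad \<phi> y)) (at y)"
          using has_derivative_add[OF has_derivative_grad[OF d(1)] has_derivative_mult_right[OF has_derivative_grad[OF d(2)], of t]]
          by (simp add: inner_add_left[abs_def])
      qed
      then have "Inf A \<le> (nrm (\<lambda>y. (G y + grad \<psi> y) + t *\<^sub>R grad \<phi> y))\<^sup>2"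
        using low[OF tt] by (simp add: add.assoc)
      also have "\<dots> = (nrm (\<lambda>y. G y + grad \<psi> y))\<^sup>2 + 2 * t * (LBINT y. (G y + grad \<psi> y) \<bullet> grad \<phi> y) + t\<^sup>2 * (nrm (grad \<phi>))\<^sup>2"
        by (rule nrm_add_sq[OF F sqint_grad(1)[OF \<phi>]])
      finally show "0 \<le> e\<^sup>2 + 2 * t * (LBINT y. (G y + grad \<psi> y) \<bullet> grad \<phi> y) + t\<^sup>2 * (nrm (grad \<phi>))\<^sup>2"
        using \<psi>(2) by linarith
    qed (use e in auto)
  qed
qed

text \<open>With F = G + grad psi and w the norm of grad psi, expanding the square of F - grad psi
  and using near orthogonality gives w^2 <= c |F|^2 + E + 2 e w. Completing the square isolates
  w.\<close>

lemma correction_bound: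
  fixes G :: "'a::euclidean_space \<Rightarrow> 'a"
  assumes G: "sqint G" and e: "0 < e" and c: "0 \<le> c" and \<psi>: "test_function B \<psi>"
    and F: "(nrm (\<lambda>y. G y + grad \<psi> y))\<^sup>2 \<le> (nrm G)\<^sup>2 + e\<^sup>2"
    and har: "\<bar>LBINT y. (G y + grad \<psi> y) \<bullet> grad \<psi> y\<bar> \<le> e * nrm (grad \<psi>)"
    and AM: "(nrm G)\<^sup>2 \<le> (1 + c) * (nrm (\<lambda>y. G y + grad \<psi> y))\<^sup>2 + E"
  shows "nrm (grad \<psi>) \<le> e + sqrt (e\<^sup>2 + (c * ((nrm G)\<^sup>2 + e\<^sup>2) + E))"
proof -
  let ?F = "\<lambda>y. G y + grad \<psi> y" and ?w = "nrm (grad \<psi>)"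
  have Fs: "sqint ?F" by (intro sqint_add G sqint_grad(1)[OF \<psi>])
  have "(nrm G)\<^sup>2 = (nrm ?F)\<^sup>2 + 2 * (- 1) * (LBINT y. ?F y \<bullet> grad \<psi> y) + (- 1)\<^sup>2 * ?w\<^sup>2"
    using nrm_add_sq[OF Fs sqint_grad(1)[OF \<psi>], of "-1"] by simp
  then have "?w\<^sup>2 \<le> c * (nrm ?F)\<^sup>2 + E + 2 * e * ?w" using har AM by (simp add: algebra_simps)
  also have "\<dots> \<le> c * ((nrm G)\<^sup>2 + e\<^sup>2) + E + 2 * e * ?w"
    using F c by (intro add_right_mono mult_left_mono) auto
  finally have "(?w - e)\<^sup>2 \<le> e\<^sup>2 + (c * ((nrm G)\<^sup>2 + e\<^sup>2) + E)" by (simp add: power2_diff mult_ac)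
  from real_sqrt_le_mono[OF this] have "\<bar>?w - e\<bar> \<le> sqrt (e\<^sup>2 + (c * ((nrm G)\<^sup>2 + e\<^sup>2) + E))" by simp
  then show ?thesis by linarith
qed

text \<open>The scalar statement with exponent 2, applied to each component; squared norms are sums
  of squared components.\<close>

lemma nrm_conv_tendsto:
  fixes G :: "'a::euclidean_space \<Rightarrow> 'b::euclidean_space"
  assumes G: "integrable lborel G" "sqint G" and R: "\<And>x. x \<notin> cball 0 R \<Longrightarrow> G x = 0"
    and s: "\<And>k. 0 < s k" "s \<longlonglongrightarrow> 0"
  shows "(\<lambda>k. nrm (\<lambda>x. conv (mollifier (s k)) G x - G x)) \<longlonglongrightarrow> 0"
proof -
  have eq: "conv (mollifier (s k)) G x \<bullet> i = conv (mollifier (s k)) (\<lambda>x. G x \<bullet> i) x" for k x i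
    unfolding conv_def using integral_inner_left[OF conv_integrable[OF mollifier_test[OF s(1)] G(1)], of k x i]
    by simp
  have i2: "integrable lborel (\<lambda>x. \<bar>G x \<bullet> i\<bar> ^ 2)" if i: "i \<in> Basis" for i
    by (rule Bochner_Integration.integrable_bound[OF sqint_integrable[OF G(2)]])
      (use sqint_borel[OF G(2)] Basis_le_norm[OF i] in \<open>auto intro!: power_mono simp: abs_le_square_iff[symmetric]\<close>)
  have lim: "(\<lambda>k. LBINT x. \<bar>conv (mollifier (s k)) (\<lambda>x. G x \<bullet> i) x - G x \<bullet> i\<bar> ^ 2) \<longlonglongrightarrow> 0"
    and int: "\<And>k. integrable lborel (\<lambda>x. \<bar>conv (mollifier (s k)) (\<lambda>x. G x \<bullet> i) x - G x \<bullet> i\<bar> ^ 2)" if i: "i \<in> Basis" for i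
    using conv_Lp_tendsto[of "\<lambda>x. G x \<bullet> i" 2 R s] G(1) i2[OF i] R s by auto
  have "(norm (conv (mollifier (s k)) G x - G x))\<^sup>2 = (\<Sum>i\<in>Basis. \<bar>conv (mollifier (s k)) (\<lambda>x. G x \<bullet> i) x - G x \<bullet> i\<bar> ^ 2)" for k x
    unfolding power2_norm_eq_inner euclidean_inner[of "conv (mollifier (s k)) G x - G x" "conv (mollifier (s k)) G x - G x"]
    by (simp add: power2_eq_square inner_diff_left eq)
  then have "(nrm (\<lambda>x. conv (mollifier (s k)) G x - G x))\<^sup>2 = (\<Sum>i\<in>Basis. LBINT x. \<bar>conv (mollifier (s k)) (\<lambda>x. G x \<bullet> i) x - G x \<bullet> i\<bar> ^ 2)" for k
    unfolding nrm_sq using int by (simp add: Bochner_Integration.integral_sum)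
  moreover have "(\<lambda>k. \<Sum>i\<in>Basis. LBINT x. \<bar>conv (mollifier (s k)) (\<lambda>x. G x \<bullet> i) x - G x \<bullet> i\<bar> ^ 2) \<longlonglongrightarrow> (\<Sum>i\<in>(Basis::'b set). 0)"
    by (intro tendsto_sum lim)
  ultimately have "(\<lambda>k. (nrm (\<lambda>x. conv (mollifier (s k)) G x - G x))\<^sup>2) \<longlonglongrightarrow> 0" by simp
  from tendsto_real_sqrt[OF this] show ?thesis by simp
qed

lemma weakly_diff_cong:
  assumes "weakly_diff S f G" "\<And>x. x \<in> S \<Longrightarrow> G x = G' x"
  shows "weakly_diff S f G'"
  unfolding weakly_diff_def
proof (intro allI impI ballI)
  fix \<phi> and i :: 'a assume t: "test_function S \<phi>" and i: "i \<in> Basis"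
  have "(G x \<bullet> i) * \<phi> x = (G' x \<bullet> i) * \<phi> x" for x
    using assms(2) test_zero[OF t] by (cases "x \<in> S") auto
  then have "(\<lambda>x. (G x \<bullet> i) * \<phi> x) = (\<lambda>x. (G' x \<bullet> i) * \<phi> x)" by (rule ext)
  then show "(LBINT x. f x * pd i \<phi> x) = - (LBINT x. (G' x \<bullet> i) * \<phi> x)"
    using assms(1) t i by (simp add: weakly_diff_def)
qed

lemma weakly_diff_lincomb:
  assumes w: "weakly_diff S f G" "weakly_diff S f' G'"
    and f: "integrable lborel f" "integrable lborel G" "integrable lborel f'" "integrable lborel G'"
  shows "weakly_diff S (\<lambda>x. f x + c * f' x) (\<lambda>x. G x + c *\<^sub>R G' x)"
  unfolding weakly_diff_def
proof (intro allI impI ballI)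
  fix \<phi> and i :: 'a assume t: "test_function S \<phi>" and i: "i \<in> Basis"
  have int: "integrable lborel (\<lambda>x. k x * \<theta> x)" if k: "integrable lborel k" and \<theta>: "test_function S \<theta>" for k \<theta>
  proof -
    obtain B where B: "B > 0" "\<And>x. \<bar>\<theta> x\<bar> \<le> B" using test_bounded[OF \<theta>] by blast
    have [measurable]: "k \<in> borel_measurable borel" "\<theta> \<in> borel_measurable borel"
      using k test_borel[OF \<theta>] by auto
    show ?thesis by (rule Bochner_Integration.integrable_bound[of _ "\<lambda>x. B *\<^sub>R k x"])
      (use k B in \<open>auto simp: abs_mult mult.commute[of B] intro!: mult_left_mono\<close>)
  qed
  note i1 = int[OF f(1) test_pd[OF t i]] and i2 = int[OF f(3) test_pd[OF t i]]
    and i3 = int[OF integrable_inner_left[OF f(2), of i] t] and i4 = int[OF integrable_inner_left[OF f(4), of i] t]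
  have "(LBINT x. (f x + c * f' x) * pd i \<phi> x) = (LBINT x. f x * pd i \<phi> x) + c * (LBINT x. f' x * pd i \<phi> x)"
    using i1 i2 by (simp add: distrib_right mult.assoc)
  also have "\<dots> = - (LBINT x. (G x \<bullet> i) * \<phi> x) - c * (LBINT x. (G' x \<bullet> i) * \<phi> x)"
    using w t i by (simp add: weakly_diff_def)
  also have "\<dots> = - (LBINT x. ((G x + c *\<^sub>R G' x) \<bullet> i) * \<phi> x)"
    using i3 i4 by (simp add: distrib_right inner_add_left mult.assoc)
  finally show "(LBINT x. (f x + c * f' x) * pd i \<phi> x) = - (LBINT x. ((G x + c *\<^sub>R G' x) \<bullet> i) * \<phi> x)" .
qed

lemma weakly_diff_add_test:
  assumes "weakly_diff S f G" "integrable lborel f" "integrable lborel G" and \<psi>: "test_function T \<psi>"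
  shows "weakly_diff S (\<lambda>x. f x + \<psi> x) (\<lambda>x. G x + grad \<psi> x)"
  using weakly_diff_lincomb[OF assms(1) weakly_diff_smooth[OF test_C_infinity[OF \<psi>]] assms(2,3)
    test_integrable[OF \<psi>] sqint_grad(2)[OF \<psi>], of 1] by simp

lemma conv_add:
  fixes f g :: "'a::euclidean_space \<Rightarrow> 'b::euclidean_space"
  assumes "test_function S \<eta>" "integrable lborel f" "integrable lborel g"
  shows "conv \<eta> (\<lambda>x. f x + g x) x = conv \<eta> f x + conv \<eta> g x"
  using conv_integrable[OF assms(1,2), of x] conv_integrable[OF assms(1,3), of x]
  by (simp add: conv_def scaleR_add_right)

lemma nrm_indicator_le:
  fixes F :: "'a::euclidean_space \<Rightarrow> 'b::euclidean_space"
  assumes "sqint F" "S \<in> sets borel" shows "nrm (restr S F) \<le> nrm F"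
  by (rule nrm_mono(2)[OF assms(1) sqint_borel[OF sqint_indicator[OF assms]]]) (auto simp: indicator_def)

text \<open>First the tolerance of the near-minimizer tends to \<open>0\<close> with the mollification scale fixed, then the
  scale tends to \<open>0\<close>.\<close>

lemma energy_decay:
  fixes G :: "'a::euclidean_space \<Rightarrow> 'a"
  assumes f: "integrable lborel f" and G: "integrable lborel G" "sqint G" and w: "weakly_diff (ball x r) f G"
    and r: "0 < r" and c: "0 \<le> c" and E: "0 \<le> E"
    and AM: "\<And>\<psi>. test_function (ball x r) \<psi> \<Longrightarrow> (nrm (restr (ball x r) G))\<^sup>2
      \<le> (1 + c) * (nrm (\<lambda>y. indicator (ball x r) y *\<^sub>R G y + grad \<psi> y))\<^sup>2 + E"
  shows "nrm (restr (ball x (r/2)) G) \<le>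
     sqrt ((1/2) ^ DIM('a)) * nrm (restr (ball x r) G)
     + sqrt (c * (nrm (restr (ball x r) G))\<^sup>2 + E)"
proof -
  define G0 where "G0 y = indicator (ball x r) y *\<^sub>R G y" for y
  define L where "L = nrm (restr (ball x (r/2)) G)"
  define e0 where "e0 = nrm G0"
  define T where "T s = nrm (\<lambda>y. conv (mollifier s) G0 y - G0 y)" for s
  have e0: "0 \<le> e0" by (simp add: e0_def)
  have G0: "integrable lborel G0" "sqint G0"
    unfolding G0_def[abs_def] using G(1) integrable_mult_indicator[OF _ G(1), of "ball x r"] sqint_indicator[OF G(2)] by auto
  have w0: "weakly_diff (ball x r) f G0"
    by (rule weakly_diff_cong[OF w]) (simp add: G0_def)
  have AM0: "(nrm G0)\<^sup>2 \<le> (1 + c) * (nrm (\<lambda>y. G0 y + grad \<psi> y))\<^sup>2 + E" if "test_function (ball x r) \<psi>" for \<psi>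
    using AM[OF that] by (simp add: G0_def[abs_def])
  have step1: "L \<le> T s + sqrt (c * e0\<^sup>2 + E) + sqrt (((r/2) / (r - 2 * s)) ^ DIM('a) * e0\<^sup>2)" if s: "0 < s" "4 * s < r" for s
  proof -
    \<comment> \<open>For e <= 1 the energy of F is at most that of \<open>G0\<close> plus 1, so one
      \<open>Q\<close>, and with it one \<open>K\<close>, serves all tolerances.\<close>
    define Q where "Q = sqrt (e0\<^sup>2 + 1)"
    obtain K where K: "K \<ge> 0" "\<And>e v F. 0 \<le> e \<Longrightarrow> integrable lborel v \<Longrightarrow> integrable lborel F \<Longrightarrow> sqint F \<Longrightarrow> nrm F \<le> Q \<Longrightarrow>
      weakly_diff (ball x r) v F \<Longrightarrow>
      (\<And>\<phi>. test_function (ball x r) \<phi> \<Longrightarrow> \<bar>LBINT y. F y \<bullet> grad \<phi> y\<bar> \<le> e * nrm (grad \<phi>)) \<Longrightarrow>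
      (nrm (\<lambda>z. indicator (ball x (r/2)) z *\<^sub>R conv (mollifier s) F z))\<^sup>2
        \<le> ((r/2) / (r - 2 * s)) ^ DIM('a) * ((nrm F)\<^sup>2 + e * K)"
      using approx_harmonic_mean[OF s, of Q x] by (auto simp: Q_def)
    have eps: "L \<le> T s + (e + sqrt (e\<^sup>2 + (c * (e0\<^sup>2 + e\<^sup>2) + E))) + sqrt (((r/2) / (r - 2 * s)) ^ DIM('a) * ((e0\<^sup>2 + e\<^sup>2) + e * K))"
      if e: "0 < e" "e \<le> 1" for e
    proof -
      obtain \<psi> where \<psi>: "test_function (ball x r) \<psi>" "(nrm (\<lambda>y. G0 y + grad \<psi> y))\<^sup>2 \<le> (nrm G0)\<^sup>2 + e\<^sup>2"
        "\<And>\<phi>. test_function (ball x r) \<phi> \<Longrightarrow> \<bar>LBINT y. (G0 y + grad \<psi> y) \<bullet> grad \<phi> y\<bar> \<le> e * nrm (grad \<phi>)"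
        using near_minimizer[OF G0(2) e(1), of "ball x r"] by blast
      define F where "F y = G0 y + grad \<psi> y" for y
      note g\<psi> = sqint_grad[OF \<psi>(1)]
      have F: "sqint F" "integrable lborel F" unfolding F_def[abs_def] using sqint_add[OF G0(2) g\<psi>(1)] G0(1) g\<psi>(2) by auto
      have F2: "(nrm F)\<^sup>2 \<le> e0\<^sup>2 + e\<^sup>2" using \<psi>(2) by (simp add: F_def[abs_def] e0_def)
      have "e\<^sup>2 \<le> 1" using e by (simp add: power_le_one)
      then have FQ: "nrm F \<le> Q" unfolding Q_def using F2 by (intro real_le_rsqrt) linarith
      have W: "nrm (grad \<psi>) \<le> e + sqrt (e\<^sup>2 + (c * (e0\<^sup>2 + e\<^sup>2) + E))"
        unfolding e0_def by (rule correction_bound[OF G0(2) e(1) c \<psi>(1,2) \<psi>(3)[OF \<psi>(1)] AM0[OF \<psi>(1)]])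
      have "(nrm (\<lambda>z. indicator (ball x (r/2)) z *\<^sub>R conv (mollifier s) F z))\<^sup>2 \<le> ((r/2) / (r - 2 * s)) ^ DIM('a) * ((nrm F)\<^sup>2 + e * K)"
      proof (rule K(2)[of e "\<lambda>y. f y + \<psi> y" F])
        show "integrable lborel (\<lambda>y. f y + \<psi> y)" using f test_integrable[OF \<psi>(1)] by auto
        show "weakly_diff (ball x r) (\<lambda>y. f y + \<psi> y) F"
          unfolding F_def[abs_def] by (rule weakly_diff_add_test[OF w0 f G0(1) \<psi>(1)])
      qed (use e F FQ \<psi>(3) in \<open>auto simp: F_def[abs_def]\<close>)
      also have "\<dots> \<le> ((r/2) / (r - 2 * s)) ^ DIM('a) * ((e0\<^sup>2 + e\<^sup>2) + e * K)"
        using F2 s r by (intro mult_left_mono add_right_mono) auto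
      finally have H: "nrm (\<lambda>z. indicator (ball x (r/2)) z *\<^sub>R conv (mollifier s) F z) \<le> sqrt (((r/2) / (r - 2 * s)) ^ DIM('a) * ((e0\<^sup>2 + e\<^sup>2) + e * K))"
        by (rule real_le_rsqrt)
      let ?I = "\<lambda>y. indicator (ball x (r/2)) y :: real" and ?c = "conv (mollifier s)"
      \<comment> \<open>On the half ball G is minus the mollification error of \<open>G0\<close>,
        plus the mollification of F, minus that of grad psi. The three norms are \<open>T s\<close>,
        the nearly harmonic part and the correction.\<close>
      have eq: "?I y *\<^sub>R G y = ?I y *\<^sub>R ((-1) *\<^sub>R (?c G0 y - G0 y)) + (?I y *\<^sub>R ?c F y + ?I y *\<^sub>R ((-1) *\<^sub>R ?c (grad \<psi>) y))" for y
      proof -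
        have "?c F y = ?c G0 y + ?c (grad \<psi>) y"
          unfolding F_def[abs_def] by (rule conv_add[OF mollifier_test[OF s(1)] G0(1) g\<psi>(2)])
        moreover have "?I y *\<^sub>R G y = ?I y *\<^sub>R G0 y" using r by (auto simp: G0_def indicator_def)
        ultimately show ?thesis by (simp add: algebra_simps)
      qed
      have c1: "sqint (\<lambda>y. (-1) *\<^sub>R (?c G0 y - G0 y))"
        by (intro sqint_scaleR sqint_diff G0 nrm_conv_le(1)[OF s(1)])
      have c2: "sqint (?c F)" by (intro nrm_conv_le(1)[OF s(1)] F)
      have c3: "sqint (\<lambda>y. (-1) *\<^sub>R ?c (grad \<psi>) y)" by (intro sqint_scaleR nrm_conv_le(1)[OF s(1)] g\<psi>)
      have b: "ball x (r/2) \<in> sets borel" by simp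
      have "L \<le> nrm (\<lambda>y. ?I y *\<^sub>R ((-1) *\<^sub>R (?c G0 y - G0 y))) + nrm (\<lambda>y. ?I y *\<^sub>R ?c F y + ?I y *\<^sub>R ((-1) *\<^sub>R ?c (grad \<psi>) y))"
        unfolding L_def eq by (intro nrm_triangle sqint_add sqint_indicator c1 c2 c3 b)
      also have "nrm (\<lambda>y. ?I y *\<^sub>R ?c F y + ?I y *\<^sub>R ((-1) *\<^sub>R ?c (grad \<psi>) y)) \<le> nrm (\<lambda>y. ?I y *\<^sub>R ?c F y) + nrm (\<lambda>y. ?I y *\<^sub>R ((-1) *\<^sub>R ?c (grad \<psi>) y))"
        by (intro nrm_triangle sqint_add sqint_indicator c1 c2 c3 b)
      also have "nrm (\<lambda>y. ?I y *\<^sub>R ((-1) *\<^sub>R (?c G0 y - G0 y))) \<le> T s"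
        using nrm_indicator_le[OF c1 b] unfolding T_def nrm_scaleR by simp
      also have "nrm (\<lambda>y. ?I y *\<^sub>R ((-1) *\<^sub>R ?c (grad \<psi>) y)) \<le> nrm (grad \<psi>)"
        using nrm_indicator_le[OF c3 b] nrm_conv_le(2)[OF s(1) g\<psi>(2,1)] unfolding nrm_scaleR by simp
      finally show ?thesis using H W by linarith
    qed
    \<comment> \<open>The tolerance tends to 0 at fixed s; the term with \<open>K\<close>, which may
      blow up as s tends to 0, disappears here.\<close>
    let ?e = "\<lambda>k. inverse (real (Suc k))"
    have "(\<lambda>k. T s + (?e k + sqrt ((?e k)\<^sup>2 + (c * (e0\<^sup>2 + (?e k)\<^sup>2) + E))) + sqrt (((r/2) / (r - 2 * s)) ^ DIM('a) * ((e0\<^sup>2 + (?e k)\<^sup>2) + ?e k * K)))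
       \<longlonglongrightarrow> T s + (0 + sqrt (0\<^sup>2 + (c * (e0\<^sup>2 + 0\<^sup>2) + E))) + sqrt (((r/2) / (r - 2 * s)) ^ DIM('a) * ((e0\<^sup>2 + 0\<^sup>2) + 0 * K))"
      by (intro tendsto_intros LIMSEQ_inverse_real_of_nat)
    from LIMSEQ_le_const[OF this, of L] show ?thesis
      using eps[of "?e _"] by (simp add: field_simps)
  qed
  \<comment> \<open>The factor 1/8 ensures \<open>4 * s k < r\<close> for every k.\<close>
  define s where "s k = r / 8 * inverse (real (Suc k))" for k
  have s: "0 < s k" "4 * s k < r" for k
  proof -
    have "inverse (real (Suc k)) \<le> 1" by (simp add: field_simps)
    then have "s k \<le> r / 8 * 1" unfolding s_def using r by (intro mult_left_mono) auto
    then show "4 * s k < r" using r by simp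
    show "0 < s k" using r by (simp add: s_def)
  qed
  have s0: "s \<longlonglongrightarrow> 0"
    using tendsto_mult[OF tendsto_const[of "r/8"] LIMSEQ_inverse_real_of_nat] by (simp add: s_def[abs_def])
  have T0: "(\<lambda>k. T (s k)) \<longlonglongrightarrow> 0" unfolding T_def
  proof (rule nrm_conv_tendsto[OF G0 _ s(1) s0])
    fix y :: 'a assume "y \<notin> cball 0 (norm x + r)"
    then have "y \<notin> ball x r" using norm_triangle_ineq2[of y x] by (auto simp: dist_norm norm_minus_commute)
    then show "G0 y = 0" by (simp add: G0_def)
  qed
  have "(\<lambda>k. T (s k) + sqrt (c * e0\<^sup>2 + E) + sqrt (((r/2) / (r - 2 * s k)) ^ DIM('a) * e0\<^sup>2))
    \<longlonglongrightarrow> 0 + sqrt (c * e0\<^sup>2 + E) + sqrt (((r/2) / (r - 2 * 0)) ^ DIM('a) * e0\<^sup>2)"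
    using r by (intro tendsto_intros T0 s0) auto
  from LIMSEQ_le_const[OF this, of L] have "L \<le> sqrt (c * e0\<^sup>2 + E) + sqrt (((r/2) / r) ^ DIM('a) * e0\<^sup>2)"
    using step1[OF s] by simp
  \<comment> \<open>This square root of the volume ratio becomes 1 after passing to quadratic
    means.\<close>
  also have "sqrt (((r/2) / r) ^ DIM('a) * e0\<^sup>2) = sqrt ((1/2) ^ DIM('a)) * e0"
    using r e0 by (simp add: real_sqrt_mult)
  finally show ?thesis by (simp add: L_def e0_def G0_def[abs_def])
qed

section \<open>Logarithmic modulus of continuity\<close>

text \<open>A discrete Gronwall inequality. The factors 1 + D p^k multiply up to at most exp (D / (1
  - p)), so that beyond a fixed factor only the additive D is collected, once per step.\<close>

lemma linear_growth:
  fixes A :: "nat \<Rightarrow> real"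
  assumes D: "0 \<le> D" and p: "0 < p" "p < 1" and A0: "\<And>k. 0 \<le> A k" and A: "\<And>k. A (Suc k) \<le> A k + D * (p ^ k * A k + 1)"
  shows "A k \<le> exp (D / (1 - p)) * (A 0 + D * real k)"
proof -
  have *: "A k \<le> exp (D * (\<Sum>j<k. p ^ j)) * (A 0 + D * real k)" for k
  proof (induction k)
    case (Suc k)
    let ?S = "\<Sum>j<k. p ^ j" and ?X = "A 0 + D * real k"
    have X: "0 \<le> ?X" using A0 D by simp
    have S: "0 \<le> ?S" using p by (intro sum_nonneg) auto
    have "A (Suc k) \<le> (1 + D * p ^ k) * A k + D" using A[of k] by (simp add: algebra_simps)
    also have "\<dots> \<le> exp (D * p ^ k) * (exp (D * ?S) * ?X) + D"
      using Suc.IH A0 X by (intro add_right_mono mult_mono exp_ge_add_one_self) auto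
    also have "exp (D * p ^ k) * (exp (D * ?S) * ?X) = exp (D * (\<Sum>j<Suc k. p ^ j)) * ?X"
      by (simp add: exp_add[symmetric] algebra_simps)
    finally have 1: "A (Suc k) \<le> exp (D * (\<Sum>j<Suc k. p ^ j)) * ?X + D" .
    have 2: "D \<le> exp (D * (\<Sum>j<Suc k. p ^ j)) * D"
    proof -
      have "1 \<le> exp (D * (\<Sum>j<Suc k. p ^ j))" using D p by (simp add: sum_nonneg)
      from mult_right_mono[OF this D] show ?thesis by simp
    qed
    have "exp (D * (\<Sum>j<Suc k. p ^ j)) * (A 0 + D * real (Suc k)) = exp (D * (\<Sum>j<Suc k. p ^ j)) * ?X + exp (D * (\<Sum>j<Suc k. p ^ j)) * D"
      by (simp add: distrib_left algebra_simps del: sum.lessThan_Suc)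
    with 1 2 show ?case by linarith
  qed simp
  have "(\<Sum>j<k. p ^ j) \<le> 1 / (1 - p)"
    using p sum_le_suminf[of "\<lambda>j. p ^ j" "{..<k}"] by (simp add: suminf_geometric summable_geometric)
  from mult_left_mono[OF this D] have "exp (D * (\<Sum>j<k. p ^ j)) \<le> exp (D / (1 - p))" by simp
  then have "exp (D * (\<Sum>j<k. p ^ j)) * (A 0 + D * real k) \<le> exp (D / (1 - p)) * (A 0 + D * real k)"
    using A0 D by (intro mult_right_mono) auto
  with *[of k] show ?thesis by linarith
qed

text \<open>The square of a mollifier is at most its supremum times itself, and its mass is one. The
  resulting power s^(-n/2) is exactly the normalisation that turns an L2 norm over a ball of radius
  s into a quadratic mean.\<close>

lemma nrm_mollifier_le:
  assumes s: "0 < s"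
  shows "nrm (mollifier s :: 'a::euclidean_space \<Rightarrow> real) \<le> sqrt (1 / (s ^ DIM('a) * bump_mass TYPE('a)))"
proof -
  let ?M = "1 / (s ^ DIM('a) * bump_mass TYPE('a))"
  have "(LBINT x. (norm (mollifier s (x::'a)))\<^sup>2) \<le> (LBINT x. ?M * mollifier s (x::'a))"
  proof (rule integral_mono)
    show "integrable lborel (\<lambda>x. (norm (mollifier s (x::'a)))\<^sup>2)"
      using sqint_integrable[OF sqint_test[OF mollifier_test[OF s]]] .
    show "integrable lborel (\<lambda>x. ?M * mollifier s (x::'a))" by (rule integrable_mult_right[OF mollifier_integrable[OF s]])
    show "(norm (mollifier s (x::'a)))\<^sup>2 \<le> ?M * mollifier s x" for x
      using mult_right_mono[OF mollifier_bound[OF s, of x] mollifier_nonneg[OF s, of x]]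
      by (simp add: power2_eq_square)
  qed
  also have "\<dots> = ?M" using mollifier_integral[OF s, where 'a='a] by simp
  finally show ?thesis unfolding nrm_def by (rule real_sqrt_le_mono)
qed

text \<open>The least k satisfying the first inequality; its minimality, or d < R for k = 0, yields
  the second.\<close>

lemma dyadic_scale:
  fixes d R :: real
  assumes "0 < d" "d < R"
  obtains k where "R * (1/2) ^ k / 2 < d" "d \<le> R * (1/2) ^ k"
proof -
  define P where "P k \<longleftrightarrow> R * (1/2) ^ k / 2 < d" for k :: nat
  have "(\<lambda>k. R * (1/2) ^ k / 2) \<longlonglongrightarrow> R * 0 / 2" by (intro tendsto_intros LIMSEQ_realpow_zero) auto
  then have "\<forall>\<^sub>F k in sequentially. P k" unfolding P_def using assms by (intro order_tendstoD(2)) auto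
  then have ex: "\<exists>k. P k" by (auto simp: eventually_sequentially)
  define k where "k = (LEAST k. P k)"
  have "P k" unfolding k_def using ex by (rule LeastI_ex)
  moreover have "d \<le> R * (1/2) ^ k"
  proof (cases k)
    case (Suc j)
    then have "\<not> P j" using not_less_Least[of j P] by (simp add: k_def)
    then show ?thesis using Suc by (simp add: P_def)
  qed (use assms in simp)
  ultimately show ?thesis using that by (simp add: P_def)
qed

lemma weakly_diff_mono: "weakly_diff T f G \<Longrightarrow> S \<subseteq> T \<Longrightarrow> weakly_diff S f G"
  unfolding weakly_diff_def using test_mono by blast

lemma power_powr_commute: "0 < x \<Longrightarrow> (x ^ k) powr a = (x powr a) ^ k" for x :: real
  by (induction k) (auto simp: powr_mult)

lemma sqrt_add_le: "0 \<le> a \<Longrightarrow> 0 \<le> b \<Longrightarrow> sqrt (a + b) \<le> sqrt a + sqrt b"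
  by (rule real_le_lsqrt) (auto simp: power2_sum)

text \<open>Division by \<open>sqrt (t ^ n)\<close> gives the quadratic mean up to a dimensional
  factor, and the volume factor \<open>sqrt ((1/2) ^ n)\<close> cancels. At t = R 2^-k the square
  root of t^alpha is R^(alpha/2) p^k with p = 2^(-alpha/2), the form that
  \<open>linear_growth\<close> expects.\<close>

lemma normalised_decay_step:
  fixes N N' t D :: real
  assumes step: "N' \<le> sqrt ((1/2) ^ n) * N + sqrt (\<kappa> * t powr \<alpha> * N\<^sup>2 + E * t ^ n)"
    and t: "t = R * (1/2) ^ k" "0 < R" and N: "0 \<le> N" and \<kappa>: "0 \<le> \<kappa>" and E: "0 \<le> E"
  shows "N' / sqrt ((t / 2) ^ n) \<le> N / sqrt (t ^ n)
     + (sqrt (\<kappa> * R powr \<alpha>) + sqrt E) / sqrt ((1/2) ^ n) * (sqrt ((1/2) powr \<alpha>) ^ k * (N / sqrt (t ^ n)) + 1)"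
proof -
  define a where "a = N / sqrt (t ^ n)"
  define h where "h = sqrt ((1/2) ^ n :: real)"
  define p where "p = sqrt ((1/2) powr \<alpha>)"
  have t0: "0 < t" using t by simp
  have h: "0 < h" by (simp add: h_def)
  have p: "0 \<le> p" by (simp add: p_def)
  have T: "0 < sqrt (t ^ n)" using t0 by simp
  have a: "0 \<le> a" using N T by (simp add: a_def)
  have Na: "N = sqrt (t ^ n) * a" using T t0 by (simp add: a_def)
  have N2: "N\<^sup>2 = t ^ n * a\<^sup>2" using t0 by (simp add: Na power_mult_distrib)
  have tp: "t powr \<alpha> = R powr \<alpha> * (p ^ k)\<^sup>2"
  proof -
    have "(p ^ k)\<^sup>2 = (p\<^sup>2) ^ k" by (simp add: power_mult[symmetric] mult.commute)
    also have "\<dots> = ((1/2) powr \<alpha>) ^ k" by (simp add: p_def)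
    also have "\<dots> = ((1/2) ^ k) powr \<alpha>" by (rule power_powr_commute[symmetric]) simp
    finally show ?thesis using t by (simp add: powr_mult)
  qed
  have "\<kappa> * t powr \<alpha> * N\<^sup>2 + E * t ^ n = t ^ n * (\<kappa> * R powr \<alpha> * (p ^ k * a)\<^sup>2 + E)"
    by (simp add: N2 tp power_mult_distrib algebra_simps)
  then have "sqrt (\<kappa> * t powr \<alpha> * N\<^sup>2 + E * t ^ n) = sqrt (t ^ n) * sqrt (\<kappa> * R powr \<alpha> * (p ^ k * a)\<^sup>2 + E)"
    by (simp add: real_sqrt_mult)
  also have "sqrt (\<kappa> * R powr \<alpha> * (p ^ k * a)\<^sup>2 + E) \<le> sqrt (\<kappa> * R powr \<alpha> * (p ^ k * a)\<^sup>2) + sqrt E"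
    using \<kappa> E by (intro sqrt_add_le) auto
  also have "sqrt (\<kappa> * R powr \<alpha> * (p ^ k * a)\<^sup>2) = sqrt (\<kappa> * R powr \<alpha>) * (p ^ k * a)"
    using a p by (simp add: real_sqrt_mult abs_mult)
  also have "sqrt (\<kappa> * R powr \<alpha>) * (p ^ k * a) + sqrt E \<le> (sqrt (\<kappa> * R powr \<alpha>) + sqrt E) * (p ^ k * a + 1)"
    using \<kappa> E a p by (simp add: algebra_simps)
  finally have "sqrt (\<kappa> * t powr \<alpha> * N\<^sup>2 + E * t ^ n) \<le> sqrt (t ^ n) * ((sqrt (\<kappa> * R powr \<alpha>) + sqrt E) * (p ^ k * a + 1))"
    using T by simp
  with step have "N' \<le> h * (sqrt (t ^ n) * a) + sqrt (t ^ n) * ((sqrt (\<kappa> * R powr \<alpha>) + sqrt E) * (p ^ k * a + 1))"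
    unfolding Na h_def by linarith
  also have "\<dots> = (h * sqrt (t ^ n)) * (a + (sqrt (\<kappa> * R powr \<alpha>) + sqrt E) / h * (p ^ k * a + 1))"
    using h by (simp add: field_simps)
  finally have "N' / (h * sqrt (t ^ n)) \<le> a + (sqrt (\<kappa> * R powr \<alpha>) + sqrt E) / h * (p ^ k * a + 1)"
    using h T by (simp add: pos_divide_le_eq mult.commute)
  moreover have "sqrt ((t / 2) ^ n) = h * sqrt (t ^ n)"
    by (simp add: h_def real_sqrt_mult[symmetric] power_mult_distrib[symmetric] power_divide)
  ultimately show ?thesis by (simp add: a_def h_def p_def)
qed

lemma conv_localize:
  assumes s: "0 < s" shows "conv (mollifier s) G z = conv (mollifier s) (restr (ball z s) G) z"
proof -
  have "mollifier s (z - y) *\<^sub>R G y = mollifier s (z - y) *\<^sub>R indicator (ball z s) y *\<^sub>R G y" for y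
    using mollifier_zero[OF s, of "z - y"] by (cases "y \<in> ball z s") (auto simp: dist_norm)
  then have "(\<lambda>y. mollifier s (z - y) *\<^sub>R G y) = (\<lambda>y. mollifier s (z - y) *\<^sub>R indicator (ball z s) y *\<^sub>R G y)" by (rule ext)
  then show ?thesis unfolding conv_def by (simp only:)
qed

text \<open>All that the regularity argument takes from almost minimality: a comparison of Dirichlet
  energies under compactly supported smooth perturbations. Traces and the functionals are gone, and
  the terms with \<open>qp\<close> and \<open>qm\<close> survive as
  \<open>E * r ^ DIM('a)\<close>.\<close>

locale almost_min_energy =
  fixes x0 :: "'a::euclidean_space" and \<rho> :: real and f :: "'a \<Rightarrow> real" and G :: "'a \<Rightarrow> 'a" and \<kappa> \<alpha> E :: real
  assumes f: "integrable lborel f" and G: "integrable lborel G" "sqint G"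
    and w: "weakly_diff (ball x0 \<rho>) f G"
    and \<kappa>: "0 \<le> \<kappa>" and \<alpha>: "0 < \<alpha>" and E: "0 \<le> E"
    and AM: "\<And>x r \<psi>. 0 < r \<Longrightarrow> ball x r \<subseteq> ball x0 \<rho> \<Longrightarrow> test_function (ball x r) \<psi> \<Longrightarrow>
      (nrm (restr (ball x r) G))\<^sup>2
      \<le> (1 + \<kappa> * r powr \<alpha>) * (nrm (\<lambda>y. indicator (ball x r) y *\<^sub>R G y + grad \<psi> y))\<^sup>2 + E * r ^ DIM('a)"
begin

text \<open>The gradient of the mollification at scale t is an average of G over
  \<open>ball x t\<close>, so Cauchy-Schwarz bounds it by the quadratic mean there, which grows
  linearly in k. Points of \<open>ball x0 (\<rho> - R)\<close> keep all balls of radius up to R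
  inside \<open>ball x0 \<rho>\<close>.\<close>

lemma gradient_growth:
  assumes R: "0 < R"
  obtains L where "0 < L" "\<And>k x. x \<in> ball x0 (\<rho> - R) \<Longrightarrow> norm (grad (conv (mollifier (R * (1/2) ^ k)) f) x) \<le> L * (1 + real k)"
proof -
  define t where "t k = R * (1/2) ^ k" for k :: nat
  define A where "A x k = nrm (restr (ball x (t k)) G) / sqrt (t k ^ DIM('a))" for x k
  define D where "D = (sqrt (\<kappa> * R powr \<alpha>) + sqrt E) / sqrt ((1/2) ^ DIM('a))"
  define p where "p = sqrt ((1/2) powr \<alpha>)"
  have t0: "0 < t k" for k using R by (simp add: t_def)
  have tR: "t k \<le> R" for k using R by (simp add: t_def mult_left_le power_le_one)
  have tS: "t (Suc k) = t k / 2" for k by (simp add: t_def)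
  have A0: "0 \<le> A x k" for x k using t0[of k] by (simp add: A_def)
  have D0: "0 \<le> D" using \<kappa> E by (simp add: D_def)
  have p: "0 < p" "p < 1"
  proof -
    have "(1/2) powr \<alpha> < (1::real)" using \<alpha> by (simp add: powr_def mult_pos_neg)
    then show "0 < p" "p < 1" by (auto simp: p_def)
  qed
  define Z where "Z = bump_mass TYPE('a)"
  have Z: "0 < Z" unfolding Z_def by (rule bump_mass_pos)
  \<comment> \<open>The exponential and \<open>D\<close> come from \<open>linear_growth\<close>,
    \<open>real DIM('a) / sqrt Z\<close> from summing the components and from the mollifier norm.
    The summand 1 only makes \<open>L\<close> positive.\<close>
  define L where "L = real DIM('a) / sqrt Z * exp (D / (1 - p)) * (nrm G / sqrt (R ^ DIM('a)) + D) + 1"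
  have L1: "0 \<le> real DIM('a) / sqrt Z * exp (D / (1 - p)) * (nrm G / sqrt (R ^ DIM('a)) + D)"
    using Z D0 R by simp
  show ?thesis
  proof (rule that[of L])
    show "0 < L" using L1 by (simp add: L_def)
    fix k x assume x: "x \<in> ball x0 (\<rho> - R)"
    have sub: "ball x (t j) \<subseteq> ball x0 \<rho>" "cball x (t j) \<subseteq> ball x0 \<rho>" for j
      using x tR[of j] dist_triangle[of x0 _ x] by (auto simp: subset_iff) (smt (verit) dist_triangle)+
    have step: "A x (Suc j) \<le> A x j + D * (p ^ j * A x j + 1)" for j
      unfolding A_def tS D_def p_def
    proof (rule normalised_decay_step[OF _ t_def R])
      show "nrm (restr (ball x (t j / 2)) G)
        \<le> sqrt ((1/2) ^ DIM('a)) * nrm (restr (ball x (t j)) G)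
         + sqrt (\<kappa> * t j powr \<alpha> * (nrm (restr (ball x (t j)) G))\<^sup>2 + E * t j ^ DIM('a))"
        by (rule energy_decay[OF f G weakly_diff_mono[OF w sub(1)] t0])
          (use \<kappa> E t0[of j] AM[OF t0 sub(1)] in auto)
    qed (use \<kappa> E in auto)
    have "A x k \<le> exp (D / (1 - p)) * (A x 0 + D * real k)"
      by (rule linear_growth[OF D0 p A0 step])
    also have "\<dots> \<le> exp (D / (1 - p)) * ((nrm G / sqrt (R ^ DIM('a)) + D) * (1 + real k))"
    proof (intro mult_left_mono)
      have "A x 0 \<le> nrm G / sqrt (R ^ DIM('a))"
        unfolding A_def using nrm_indicator_le[OF G(2), of "ball x (t 0)"] R by (auto simp: t_def intro!: divide_right_mono)
      moreover have "u + D * real k \<le> (v + D) * (1 + real k)" if "u \<le> v" "0 \<le> v" for u v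
      proof -
        have "0 \<le> v * real k" using that by simp
        then show ?thesis using that D0 by (simp only: algebra_simps mult_1_right)
      qed
      ultimately show "A x 0 + D * real k \<le> (nrm G / sqrt (R ^ DIM('a)) + D) * (1 + real k)" using R by simp
    qed simp
    finally have Ak: "A x k \<le> exp (D / (1 - p)) * ((nrm G / sqrt (R ^ DIM('a)) + D) * (1 + real k))" .
    have tk: "test_function UNIV (mollifier (t k) :: 'a \<Rightarrow> real)" by (rule mollifier_test[OF t0])
    have "grad (conv (mollifier (t k)) f) x = conv (mollifier (t k)) G x"
      by (rule grad_conv[OF mollifier_C_infinity mollifier_zero[OF t0] sub(2) f G(1) w])
    also have "\<dots> = conv (mollifier (t k)) (restr (ball x (t k)) G) x"
      by (rule conv_localize[OF t0])
    finally have g: "grad (conv (mollifier (t k)) f) x = conv (mollifier (t k)) (restr (ball x (t k)) G) x" .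
    have bd: "\<bar>grad (conv (mollifier (t k)) f) x \<bullet> i\<bar> \<le> A x k / sqrt Z" if i: "i \<in> Basis" for i
    proof -
      have "\<bar>grad (conv (mollifier (t k)) f) x \<bullet> i\<bar> \<le> nrm (restr (ball x (t k)) G) * nrm (mollifier (t k) :: 'a \<Rightarrow> real)"
        unfolding g using integrable_mult_indicator[OF _ G(1), of "ball x (t k)"] sqint_indicator[OF G(2)]
        by (intro conv_inner_bound[OF tk _ _ i]) auto
      also have "\<dots> \<le> nrm (restr (ball x (t k)) G) * sqrt (1 / (t k ^ DIM('a) * Z))"
        unfolding Z_def by (intro mult_left_mono nrm_mollifier_le t0) auto
      also have "\<dots> = A x k / sqrt Z" using t0[of k] Z by (simp add: A_def real_sqrt_mult real_sqrt_divide)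
      finally show ?thesis .
    qed
    have "norm (grad (conv (mollifier (t k)) f) x) \<le> (\<Sum>i\<in>(Basis::'a set). A x k / sqrt Z)"
      by (rule order_trans[OF norm_le_l1 sum_mono[OF bd]])
    also have "\<dots> = real DIM('a) / sqrt Z * A x k" by simp
    also have "\<dots> \<le> real DIM('a) / sqrt Z * (exp (D / (1 - p)) * ((nrm G / sqrt (R ^ DIM('a)) + D) * (1 + real k)))"
      using Ak Z by (intro mult_left_mono) auto
    also have "\<dots> = (L - 1) * (1 + real k)" by (simp add: L_def mult.assoc)
    also have "\<dots> \<le> L * (1 + real k)" by (intro mult_right_mono) auto
    finally show "norm (grad (conv (mollifier (R * (1/2) ^ k)) f) x) \<le> L * (1 + real k)" by (simp add: t_def)
  qed
qed

text \<open>One R in the hypothesis on \<rho> is spent on the gradient bound, the other on moving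
  from x to a neighbour at distance below R. The condition R <= 2 r0 lets 2 r0 / |x - y| dominate R
  / |x - y| in the logarithm.\<close>

lemma log_lipschitz:
  assumes r0: "0 < r0" and R: "0 < R" "R \<le> 2 * r0" "r0 + 2 * R \<le> \<rho>"
  obtains W C where "0 < C" "\<And>x. x \<in> ball x0 r0 \<Longrightarrow> (\<lambda>k. conv (mollifier (R * (1/2) ^ k)) f x) \<longlonglongrightarrow> W x"
    "\<And>x y. x \<in> ball x0 r0 \<Longrightarrow> y \<in> ball x0 r0 \<Longrightarrow> \<bar>W x - W y\<bar> \<le> C * norm (x - y) * (1 + ln (2 * r0 / norm (x - y)))"
proof -
  obtain L where L: "0 < L" "\<And>k x. x \<in> ball x0 (\<rho> - R) \<Longrightarrow> norm (grad (conv (mollifier (R * (1/2) ^ k)) f) x) \<le> L * (1 + real k)"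
    using gradient_growth[OF R(1)] by blast
  define t where "t k = R * (1/2) ^ k" for k :: nat
  define F where "F k = conv (mollifier (t k)) f" for k
  have t0: "0 < t k" for k using R by (simp add: t_def)
  have tR: "t k \<le> R" for k using R by (simp add: t_def mult_left_le power_le_one)
  have tS: "t (Suc k) = t k / 2" for k by (simp add: t_def)
  have mt: "test_function UNIV (mollifier (t k) :: 'a \<Rightarrow> real)" for k by (rule mollifier_test[OF t0])
  have FC: "C_infinity (F k)" for k unfolding F_def by (rule conv_C_infinity[OF mt f])
  have Fi: "integrable lborel (F k)" for k unfolding F_def by (rule conv_integral(1)[OF f mollifier_integrable[OF t0]])
  have lip: "\<bar>F k x - F k y\<bar> \<le> L * (1 + real k) * norm (x - y)" if "x \<in> ball x0 (\<rho> - R)" "y \<in> ball x0 (\<rho> - R)" for k x y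
    by (rule lipschitz_from_grad[OF C_infinity_diff[OF FC] _ convex_ball that]) (simp add: F_def t_def L)
  have in1: "y \<in> ball x0 (\<rho> - R)" if "x \<in> ball x0 r0" "norm (x - y) < R" for x y
    using that R(3) dist_triangle[of x0 y x] by (auto simp: dist_norm)
  have step: "\<bar>F (Suc k) x - F k x\<bar> \<le> 2 * L * (2 + real k) * t k" if x: "x \<in> ball x0 r0" for k x
  proof -
    have x1: "x \<in> ball x0 (\<rho> - R)" using in1[OF x, of x] R by simp
    \<comment> \<open>Seen as an average of \<open>F (Suc k)\<close> or of \<open>F k\<close>, this
      value is estimated from two sides with the Lipschitz constants at the respective
      scale.\<close>
    define g where "g = conv (mollifier (t k)) (F (Suc k)) x"
    have g: "g = conv (mollifier (t (Suc k))) (F k) x"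
      unfolding g_def F_def by (rule conv_commute[OF mt mt f])
    have "norm (g - F (Suc k) x) \<le> L * (2 + real k) * t k" unfolding g_def
    proof (rule conv_near[OF t0 Fi])
      fix y assume y: "norm (x - y) < t k"
      have "\<bar>F (Suc k) y - F (Suc k) x\<bar> \<le> L * (1 + real (Suc k)) * norm (y - x)"
        using y tR[of k] by (intro lip in1[OF x] x1) auto
      also have "\<dots> \<le> L * (2 + real k) * t k" using y L by (intro mult_mono) (auto simp: norm_minus_commute)
      finally show "norm (F (Suc k) y - F (Suc k) x) \<le> L * (2 + real k) * t k" by simp
    qed
    moreover have "norm (g - F k x) \<le> L * (2 + real k) * t k" unfolding g
    proof (rule conv_near[OF t0 Fi])
      fix y assume y: "norm (x - y) < t (Suc k)"
      have yk: "norm (x - y) < t k" using y t0[of k] by (simp add: tS)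
      have "\<bar>F k y - F k x\<bar> \<le> L * (1 + real k) * norm (y - x)"
        using yk tR[of k] by (intro lip in1[OF x] x1) auto
      also have "\<dots> \<le> L * (2 + real k) * t k" using yk L by (intro mult_mono) (auto simp: norm_minus_commute)
      finally show "norm (F k y - F k x) \<le> L * (2 + real k) * t k" by simp
    qed
    ultimately show ?thesis by (simp add: algebra_simps abs_le_iff)
  qed
  \<comment> \<open>A discrete antiderivative: its decrements are \<open>(2 + real k) * t k\<close>,
    the size of the k-th increment up to the factor 2 L. The tail sums then telescope.\<close>
  define b where "b k = (2 * real k + 6) * t k" for k
  have b0: "0 \<le> b k" for k using t0[of k] by (simp add: b_def)
  have bS: "b k - b (Suc k) = (2 + real k) * t k" for k by (simp add: b_def tS algebra_simps)
  have tele: "\<bar>F (k + m) x - F k x\<bar> \<le> 2 * L * (b k - b (k + m))" if x: "x \<in> ball x0 r0" for k m x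
  proof (induction m)
    case (Suc m)
    have "\<bar>F (k + Suc m) x - F (k + m) x\<bar> \<le> 2 * L * (b (k + m) - b (Suc (k + m)))"
      using step[OF x, of "k + m"] bS[of "k + m"] by (simp add: mult.assoc)
    with Suc show ?case by (simp add: algebra_simps)
  qed simp
  have b_lim: "b \<longlonglongrightarrow> 0"
  proof -
    have "(\<lambda>k. real k * (1/2) ^ k) \<longlonglongrightarrow> (0::real)" by (rule powser_times_n_limit_0) simp
    then have "(\<lambda>k. 2 * R * (real k * (1/2) ^ k) + 6 * R * (1/2) ^ k) \<longlonglongrightarrow> 2 * R * 0 + 6 * R * 0"
      by (intro tendsto_intros LIMSEQ_realpow_zero) auto
    moreover have "b = (\<lambda>k. 2 * R * (real k * (1/2) ^ k) + 6 * R * (1/2) ^ k)" by (auto simp: b_def t_def fun_eq_iff algebra_simps)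
    ultimately show ?thesis by simp
  qed
  have conv: "convergent (\<lambda>k. F k x)" if x: "x \<in> ball x0 r0" for x
  proof (rule Cauchy_convergent, rule metric_CauchyI)
    fix e :: real assume e: "0 < e"
    have "\<forall>\<^sub>F k in sequentially. b k < e / (4 * L)" using e L by (intro order_tendstoD(2)[OF b_lim]) auto
    then obtain M where M: "b M < e / (4 * L)" by (auto simp: eventually_sequentially)
    have near: "\<bar>F k x - F M x\<bar> < e / 2" if "k \<ge> M" for k
    proof -
      have "\<bar>F (M + (k - M)) x - F M x\<bar> \<le> 2 * L * (b M - b (M + (k - M)))" by (rule tele[OF x])
      also have "\<dots> \<le> 2 * L * b M" using b0[of "M + (k - M)"] L(1) by (intro mult_left_mono) auto
      also have "\<dots> < e / 2" using M L by (simp add: field_simps)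
      finally show ?thesis using that by simp
    qed
    show "\<exists>M. \<forall>m\<ge>M. \<forall>n\<ge>M. dist (F m x) (F n x) < e"
    proof (intro exI[of _ M] allI impI)
      fix m n assume "m \<ge> M" "n \<ge> M"
      then show "dist (F m x) (F n x) < e" using near[of m] near[of n] unfolding dist_real_def by linarith
    qed
  qed
  define W where "W x = lim (\<lambda>k. F k x)" for x
  have W: "(\<lambda>k. F k x) \<longlonglongrightarrow> W x" if "x \<in> ball x0 r0" for x
    using conv[OF that] by (simp add: W_def convergent_LIMSEQ_iff)
  have Wb: "\<bar>W x - F k x\<bar> \<le> 2 * L * b k" if x: "x \<in> ball x0 r0" for x k
  proof (rule LIMSEQ_le_const2)
    show "(\<lambda>m. \<bar>F (m + k) x - F k x\<bar>) \<longlonglongrightarrow> \<bar>W x - F k x\<bar>"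
      by (intro tendsto_intros LIMSEQ_ignore_initial_segment W x)
    have "\<bar>F (m + k) x - F k x\<bar> \<le> 2 * L * b k" for m
    proof -
      have "\<bar>F (k + m) x - F k x\<bar> \<le> 2 * L * (b k - b (k + m))" by (rule tele[OF x])
      also have "\<dots> \<le> 2 * L * b k" using b0[of "k + m"] L(1) by (intro mult_left_mono) auto
      finally show ?thesis by (simp add: add.commute)
    qed
    then show "\<exists>N. \<forall>m\<ge>N. \<bar>F (m + k) x - F k x\<bar> \<le> 2 * L * b k" by blast
  qed
  have main: "\<bar>W x - W y\<bar> \<le> 4 * L * b k + L * (1 + real k) * norm (x - y)" if "x \<in> ball x0 r0" "y \<in> ball x0 r0" for x y k
  proof -
    have "x \<in> ball x0 (\<rho> - R)" "y \<in> ball x0 (\<rho> - R)" using in1[of x x] in1[of y y] that R by auto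
    then have "\<bar>F k x - F k y\<bar> \<le> L * (1 + real k) * norm (x - y)" by (rule lip)
    then show ?thesis using Wb[OF that(1), of k] Wb[OF that(2), of k] by linarith
  qed
  show ?thesis
  \<comment> \<open>The factor 100 is generous: the case d >= R needs 25, the dyadic case 17 k + 49
    against 1 + ln (2 r0 / d).\<close>
  proof (rule that[of "100 * L" W])
    show "0 < 100 * L" using L by simp
    show "(\<lambda>k. conv (mollifier (R * (1/2) ^ k)) f x) \<longlonglongrightarrow> W x" if "x \<in> ball x0 r0" for x
      using W[OF that] by (simp add: F_def t_def)
    fix x y assume xy: "x \<in> ball x0 r0" "y \<in> ball x0 r0"
    define d where "d = norm (x - y)"
    have d2: "d < 2 * r0" using xy dist_triangle2[of x y x0] by (simp add: d_def dist_norm[symmetric] dist_commute)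
    consider "d = 0" | "d \<ge> R" "d > 0" | "0 < d" "d < R" by (force simp: d_def)
    then have "\<bar>W x - W y\<bar> \<le> 100 * L * d * (1 + ln (2 * r0 / d))"
    proof cases
      case 1 then show ?thesis by (simp add: d_def)
    next
      case 2
      \<comment> \<open>At distances of at least R the coarsest scale suffices, since
        \<open>b 0\<close> is itself a multiple of R and hence at most a multiple of d.\<close>
      have "\<bar>W x - W y\<bar> \<le> 4 * L * b 0 + L * (1 + real 0) * d" unfolding d_def by (rule main[OF xy])
      also have "b 0 = 6 * R" by (simp add: b_def t_def)
      also have "4 * L * (6 * R) + L * (1 + real 0) * d \<le> 100 * L * d"
      proof -
        have "L * R \<le> L * d" using 2(1) L(1) by (intro mult_left_mono) auto
        moreover have "0 < L * d" using L(1) 2(2) by simp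
        ultimately show ?thesis by (simp only: algebra_simps of_nat_0)
      qed
      also have "\<dots> \<le> 100 * L * d * (1 + ln (2 * r0 / d))"
      proof -
        have "0 \<le> ln (2 * r0 / d)" using d2 2 by simp
        then have "100 * L * d * 1 \<le> 100 * L * d * (1 + ln (2 * r0 / d))" using L 2 by (intro mult_left_mono) auto
        then show ?thesis by simp
      qed
      finally show ?thesis .
    next
      case 3
      \<comment> \<open>At this scale the approximation error and the Lipschitz term are both of
        size (1 + k) d.\<close>
      obtain k where k: "R * (1/2) ^ k / 2 < d" "d \<le> R * (1/2) ^ k" using dyadic_scale[OF 3] by blast
      have "\<bar>W x - W y\<bar> \<le> 4 * L * b k + L * (1 + real k) * d" unfolding d_def by (rule main[OF xy])
      also have "4 * L * b k \<le> 4 * L * ((2 * real k + 6) * (2 * d))"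
        unfolding b_def t_def using k L by (intro mult_left_mono) auto
      also have "4 * L * ((2 * real k + 6) * (2 * d)) + L * (1 + real k) * d = L * d * (17 * real k + 49)"
        by (simp add: algebra_simps)
      also have "\<dots> \<le> L * d * (100 * (1 + ln (2 * r0 / d)))"
      proof (intro mult_left_mono)
        have "2 ^ k \<le> R / d" using k(2) 3 by (simp add: field_simps power_one_over)
        also have "\<dots> \<le> 2 * r0 / d" using R 3 by (intro divide_right_mono) auto
        finally have "ln (2 ^ k) \<le> ln (2 * r0 / d)" using 3 r0 by (subst ln_le_cancel_iff) auto
        then have "real k * ln 2 \<le> ln (2 * r0 / d)" by (simp add: ln_realpow)
        \<comment> \<open>With ln 2 >= 1/2 the number of scales is at most twice the
          logarithm.\<close>
        moreover have "real k * (1/2) \<le> real k * ln 2" using ln2_ge_two_thirds by (intro mult_left_mono) auto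
        ultimately have "real k * (1/2) \<le> ln (2 * r0 / d)" by (rule order_trans[rotated])
        moreover have "0 \<le> real k" by simp
        moreover have "17 * a + 49 \<le> 100 * (1 + b)" if "a * (1/2) \<le> b" "0 \<le> a" for a b :: real
          using that by argo
        ultimately show "17 * real k + 49 \<le> 100 * (1 + ln (2 * r0 / d))" by blast
      qed (use L 3 in auto)
      finally show ?thesis by (simp add: mult_ac)
    qed
    then show "\<bar>W x - W y\<bar> \<le> 100 * L * norm (x - y) * (1 + ln (2 * r0 / norm (x - y)))" by (simp add: d_def)
  qed
qed

end

section \<open>Weak gradients\<close>

text \<open>The bridge between the two settings: the definitions integrate over
  \<open>lebesgue_on S\<close>, the estimates use Borel functions and \<open>lborel\<close>.
  Agreement almost everywhere on \<open>S\<close> is enough for values, integrability and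
  measurability.\<close>

lemma lebesgue_on_transfer:
  fixes h h' :: "'a::euclidean_space \<Rightarrow> 'b::euclidean_space"
  assumes S [measurable]: "S \<in> sets borel" and h' [measurable]: "h' \<in> borel_measurable borel"
    and eq: "AE x in lborel. x \<in> S \<longrightarrow> h x = h' x"
  shows "integral\<^sup>L (lebesgue_on S) h = (LBINT x. indicator S x *\<^sub>R h' x)"
    and "integrable (lebesgue_on S) h \<longleftrightarrow> integrable lborel (restr S h')"
    and "h \<in> borel_measurable (lebesgue_on S)"
proof -
  have SL: "S \<inter> space lebesgue \<in> sets lebesgue" using S by (simp add: sets_completionI_sets)
  have m': "restr S h' \<in> borel_measurable lborel" by measurable
  have m'L: "restr S h' \<in> borel_measurable lebesgue" by (rule measurable_completion[OF m'])
  have ae: "AE x in lebesgue. indicator S x *\<^sub>R h' x = indicator S x *\<^sub>R h x"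
    by (rule AE_completion) (use eq in \<open>eventually_elim, auto simp: indicator_def\<close>)
  have mL: "restr S h \<in> borel_measurable lebesgue"
    by (rule borel_measurable_AE[OF m'L ae])
  have ae2: "AE x in lebesgue. indicator S x *\<^sub>R h x = indicator S x *\<^sub>R h' x" using ae by eventually_elim (rule sym)
  show "h \<in> borel_measurable (lebesgue_on S)"
    using mL borel_measurable_restrict_space_iff[OF SL, of h] by simp
  show "integral\<^sup>L (lebesgue_on S) h = (LBINT x. indicator S x *\<^sub>R h' x)"
    unfolding integral_restrict_space[OF SL] integral_cong_AE[OF mL m'L ae2] by (rule integral_completion[OF m'])
  show "integrable (lebesgue_on S) h \<longleftrightarrow> integrable lborel (restr S h')"
    unfolding integrable_restrict_space[OF SL] integrable_cong_AE[OF mL m'L ae2] by (rule integrable_completion[OF m'])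
qed

text \<open>Real functions measurable for the completed measure have Borel versions; vector values
  are treated component by component, with finitely many null sets.\<close>

lemma borel_version:
  fixes h :: "'a::euclidean_space \<Rightarrow> 'b::euclidean_space"
  assumes S: "S \<in> sets borel" and h: "h \<in> borel_measurable (lebesgue_on S)"
  obtains h' where "h' \<in> borel_measurable borel" "AE x in lborel. x \<in> S \<longrightarrow> h x = h' x"
proof -
  have SL: "S \<inter> space lebesgue \<in> sets lebesgue" using S by (simp add: sets_completionI_sets)
  have mL: "restr S h \<in> borel_measurable lebesgue"
    using h borel_measurable_restrict_space_iff[OF SL, of h] by simp
  have "\<exists>k. k \<in> borel_measurable lborel \<and> (AE x in lborel. (indicator S x *\<^sub>R h x) \<bullet> i = k x)" for i
  proof -
    have "(\<lambda>x. (indicator S x *\<^sub>R h x) \<bullet> i) \<in> borel_measurable (completion lborel)" using mL by measurable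
    from completion_ex_borel_measurable_real[OF this] show ?thesis by blast
  qed
  then obtain k where k: "\<And>i. k i \<in> borel_measurable lborel" "\<And>i. AE x in lborel. (indicator S x *\<^sub>R h x) \<bullet> i = k i x"
    by metis
  show ?thesis
  proof (rule that[of "\<lambda>x. \<Sum>i\<in>Basis. k i x *\<^sub>R i"])
    show "(\<lambda>x. \<Sum>i\<in>Basis. k i x *\<^sub>R i) \<in> borel_measurable borel" using k(1) by simp
    have "AE x in lborel. \<forall>i\<in>(Basis::'b set). (indicator S x *\<^sub>R h x) \<bullet> i = k i x"
      using k(2) by (intro AE_finite_allI) auto
    then show "AE x in lborel. x \<in> S \<longrightarrow> h x = (\<Sum>i\<in>Basis. k i x *\<^sub>R i)"
    proof eventually_elim
      case (elim x)
      show ?case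
      proof
        assume "x \<in> S"
        then have "k i x = h x \<bullet> i" if "i \<in> Basis" for i using elim that by simp
        then have "(\<Sum>i\<in>Basis. k i x *\<^sub>R i) = (\<Sum>i\<in>Basis. (h x \<bullet> i) *\<^sub>R i)" by (intro sum.cong) auto
        then show "h x = (\<Sum>i\<in>Basis. k i x *\<^sub>R i)" by (simp only: euclidean_representation)
      qed
    qed
  qed
qed

lemma has_weak_gradientI:
  assumes f: "integrable lborel f" and G: "integrable lborel G" and w: "weakly_diff S f G" and S: "open S"
    and v: "AE x in lborel. x \<in> S \<longrightarrow> v x = f x" and g: "AE x in lborel. x \<in> S \<longrightarrow> g x = G x"
  shows "has_weak_gradient S v g"
  unfolding has_weak_gradient_def
proof (intro conjI allI impI ballI)
  have [measurable]: "f \<in> borel_measurable borel" "G \<in> borel_measurable borel" using f G by auto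
  have SB: "S \<in> sets borel" using S by simp
  show "L1_loc S v" unfolding L1_loc_def
  proof safe
    fix K assume K: "compact K" "K \<subseteq> S"
    have "AE x in lborel. x \<in> K \<longrightarrow> v x = f x" using v by eventually_elim (use K in auto)
    from lebesgue_on_transfer(2)[OF _ _ this] show "integrable (lebesgue_on K) v"
      using K integrable_mult_indicator[OF _ f, of K] by (simp add: compact_imp_closed)
  qed
  show "L1_loc S g" unfolding L1_loc_def
  proof safe
    fix K assume K: "compact K" "K \<subseteq> S"
    have "AE x in lborel. x \<in> K \<longrightarrow> g x = G x" using g by eventually_elim (use K in auto)
    from lebesgue_on_transfer(2)[OF _ _ this] show "integrable (lebesgue_on K) g"
      using K integrable_mult_indicator[OF _ G, of K] by (simp add: compact_imp_closed)
  qed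
  fix \<phi> and i :: 'a assume t: "test_function S \<phi>" and i: "i \<in> Basis"
  have [measurable]: "\<phi> \<in> borel_measurable borel" "pd i \<phi> \<in> borel_measurable borel"
    using t test_pd[OF t i] test_borel by blast+
  have a1: "AE x in lborel. x \<in> S \<longrightarrow> v x * frechet_derivative \<phi> (at x) i = f x * pd i \<phi> x"
    using v by eventually_elim (auto simp: pd_def)
  have a2: "AE x in lborel. x \<in> S \<longrightarrow> g x \<bullet> i * \<phi> x = G x \<bullet> i * \<phi> x"
    using g by eventually_elim auto
  have "(\<integral>x. v x * frechet_derivative \<phi> (at x) i \<partial>lebesgue_on S) = (LBINT x. indicator S x *\<^sub>R (f x * pd i \<phi> x))"
    by (rule lebesgue_on_transfer(1)[OF SB _ a1]) measurable
  also have "\<dots> = (LBINT x. f x * pd i \<phi> x)"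
    by (intro Bochner_Integration.integral_cong refl)
      (use test_zero[OF test_pd[OF t i]] in \<open>auto simp: indicator_def\<close>)
  also have "\<dots> = - (LBINT x. (G x \<bullet> i) * \<phi> x)" using w t i by (simp add: weakly_diff_def)
  also have "(LBINT x. (G x \<bullet> i) * \<phi> x) = (LBINT x. indicator S x *\<^sub>R (G x \<bullet> i * \<phi> x))"
    by (intro Bochner_Integration.integral_cong refl)
      (use test_zero[OF t] in \<open>auto simp: indicator_def\<close>)
  also have "\<dots> = (\<integral>x. (g x \<bullet> i) * \<phi> x \<partial>lebesgue_on S)"
    by (rule lebesgue_on_transfer(1)[OF SB _ a2, symmetric]) measurable
  finally show "(\<integral>x. v x * frechet_derivative \<phi> (at x) i \<partial>lebesgue_on S) = - (\<integral>x. (g x \<bullet> i) * \<phi> x \<partial>lebesgue_on S)" .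
qed

section \<open>Uniqueness of the weak gradient\<close>

lemma AE_ball_exhaust:
  fixes x :: "'a::euclidean_space"
  assumes "\<And>t. 0 < t \<Longrightarrow> t < r \<Longrightarrow> AE y in lborel. y \<in> ball x t \<longrightarrow> P y"
  shows "AE y in lborel. y \<in> ball x r \<longrightarrow> P y"
proof -
  have "AE y in lborel. \<forall>n::nat. y \<in> ball x (r - inverse (real (Suc n))) \<longrightarrow> P y"
  proof (subst AE_all_countable, rule allI)
    fix n show "AE y in lborel. y \<in> ball x (r - inverse (real (Suc n))) \<longrightarrow> P y"
    proof (cases "0 < r - inverse (real (Suc n))")
      case True
      have "r - inverse (real (Suc n)) < r" by simp
      from assms[OF True this] show ?thesis .
    next
      case False
      then have e: "ball x (r - inverse (real (Suc n))) = {}" by (simp only: ball_eq_empty not_less)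
      show ?thesis unfolding e by simp
    qed
  qed
  then show ?thesis
  proof eventually_elim
    case (elim y)
    show ?case
    proof
      assume y: "y \<in> ball x r"
      then obtain n where "inverse (real (Suc n)) < r - dist x y" using reals_Archimedean[of "r - dist x y"] by auto
      then have "y \<in> ball x (r - inverse (real (Suc n)))" by simp
      then show "P y" using elim by blast
    qed
  qed
qed

text \<open>The fundamental lemma of the calculus of variations. On a smaller ball the
  mollifications of h at small scales are integrals of h against test functions, hence zero, while
  they converge to h in the mean.\<close>

lemma AE_zero_if_orthogonal:
  fixes h :: "'a::euclidean_space \<Rightarrow> real"
  assumes h: "integrable lborel h" and R: "\<And>y. y \<notin> cball x r \<Longrightarrow> h y = 0"
    and orth: "\<And>\<phi>. test_function (ball x r) \<phi> \<Longrightarrow> (LBINT y. h y * \<phi> y) = 0"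
  shows "AE y in lborel. y \<in> ball x r \<longrightarrow> h y = 0"
proof (rule AE_ball_exhaust)
  fix t assume t: "0 < t" "t < r"
  define s where "s k = (r - t) * inverse (real (Suc k)) / 2" for k
  have s: "0 < s k" for k using t by (simp add: s_def)
  have s1: "s k < r - t" for k
  proof -
    have "inverse (real (Suc k)) \<le> 1" by (simp add: field_simps)
    then have "(r - t) * inverse (real (Suc k)) \<le> (r - t) * 1" using t by (intro mult_left_mono) auto
    then have "s k \<le> (r - t) * 1 / 2" unfolding s_def by (rule divide_right_mono) simp
    also have "\<dots> < r - t" using t by simp
    finally show ?thesis .
  qed
  have s0: "s \<longlonglongrightarrow> 0"
    using tendsto_mult[OF tendsto_const[of "(r - t)/2"] LIMSEQ_inverse_real_of_nat] by (simp add: s_def[abs_def])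
  have R': "h y = 0" if "y \<notin> cball 0 (norm x + r)" for y
    using that norm_triangle_ineq2[of y x] by (intro R) (auto simp: dist_norm norm_minus_commute)
  have lim: "(\<lambda>k. LBINT y. \<bar>conv (mollifier (s k)) h y - h y\<bar>) \<longlonglongrightarrow> 0"
    and ci: "\<And>k. integrable lborel (\<lambda>y. \<bar>conv (mollifier (s k)) h y - h y\<bar>)"
    using conv_Lp_tendsto[of h 1 "norm x + r" s] h R' s s0 by auto
  have hi: "integrable lborel (\<lambda>y. indicator (ball x t) y * \<bar>h y\<bar>)"
    using integrable_mult_indicator[OF _ integrable_abs[OF h], of "ball x t"] by simp
  have le: "(LBINT y. indicator (ball x t) y * \<bar>h y\<bar>) \<le> (LBINT y. \<bar>conv (mollifier (s k)) h y - h y\<bar>)" for k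
  proof (intro integral_mono hi ci)
    fix y show "indicator (ball x t) y * \<bar>h y\<bar> \<le> \<bar>conv (mollifier (s k)) h y - h y\<bar>"
    proof (cases "y \<in> ball x t")
      case True
      have sub: "cball y (s k) \<subseteq> ball x r"
      proof
        fix z assume "z \<in> cball y (s k)"
        then show "z \<in> ball x r" using True s1[of k] dist_triangle[of x z y] by auto
      qed
      have "conv (mollifier (s k)) h y = (LBINT z. h z * mollifier (s k) (y - z))"
        by (simp add: conv_def mult.commute)
      also have "\<dots> = 0"
        by (rule orth[OF test_reflect(1)[OF mollifier_C_infinity mollifier_zero[OF s] sub]])
      finally show ?thesis by (simp add: indicator_def)
    qed simp
  qed
  have "(LBINT y. indicator (ball x t) y * \<bar>h y\<bar>) \<le> 0"
    by (rule LIMSEQ_le_const[OF lim]) (use le in blast)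
  moreover have "0 \<le> (LBINT y. indicator (ball x t) y * \<bar>h y\<bar>)" by (intro integral_nonneg_AE) auto
  ultimately have "AE y in lborel. indicator (ball x t) y * \<bar>h y\<bar> = 0"
    using integral_nonneg_eq_0_iff_AE[OF hi] by simp
  then show "AE y in lborel. y \<in> ball x t \<longrightarrow> h y = 0" by eventually_elim (auto simp: indicator_def)
qed

text \<open>Needed because \<open>weak_gradient\<close> is an arbitrary choice: energies can be
  computed from a known gradient only if any two agree almost everywhere. Local integrability
  controls closed subballs only, hence the exhaustion.\<close>

lemma weak_gradient_unique:
  fixes v :: "'a::euclidean_space \<Rightarrow> real"
  assumes g: "has_weak_gradient (ball x r) v g" and g': "has_weak_gradient (ball x r) v g'"
  shows "AE y in lborel. y \<in> ball x r \<longrightarrow> g y = g' y"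
proof (rule AE_ball_exhaust)
  fix t assume t: "0 < t" "t < r"
  have sub: "cball x t \<subseteq> ball x r" using t by auto
  have gi: "integrable (lebesgue_on (cball x t)) g" "integrable (lebesgue_on (cball x t)) g'"
    using g g' sub by (auto simp: has_weak_gradient_def L1_loc_def)
  have cb: "cball x t \<in> sets borel" by simp
  have main: "AE y in lborel. y \<in> ball x t \<longrightarrow> (g y - g' y) \<bullet> i = 0" if i: "i \<in> Basis" for i
  proof -
    have di: "integrable (lebesgue_on (cball x t)) (\<lambda>y. (g y - g' y) \<bullet> i)"
      using gi by (intro integrable_inner_left Bochner_Integration.integrable_diff)
    then have "(\<lambda>y. (g y - g' y) \<bullet> i) \<in> borel_measurable (lebesgue_on (cball x t))" by simp
    then obtain h where h [measurable]: "h \<in> borel_measurable borel"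
      and he: "AE y in lborel. y \<in> cball x t \<longrightarrow> (g y - g' y) \<bullet> i = h y"
      using borel_version[OF cb] by blast
    define h0 where "h0 y = indicator (cball x t) y *\<^sub>R h y" for y
    have h0i: "integrable lborel h0"
      using lebesgue_on_transfer(2)[OF cb h he] di by (simp add: h0_def[abs_def])
    have "AE y in lborel. y \<in> ball x t \<longrightarrow> h0 y = 0"
    proof (rule AE_zero_if_orthogonal[OF h0i])
      show "h0 y = 0" if "y \<notin> cball x t" for y using that by (simp add: h0_def)
      fix \<phi> assume \<phi>: "test_function (ball x t) \<phi>"
      have \<phi>': "test_function (ball x r) \<phi>" by (rule test_mono[OF \<phi>]) (use t in auto)
      have [measurable]: "\<phi> \<in> borel_measurable borel" using test_borel[OF \<phi>] .
      obtain B where B: "B > 0" "\<And>x. \<bar>\<phi> x\<bar> \<le> B" using test_bounded[OF \<phi>] by blast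
      have *: "integrable (lebesgue_on (cball x t)) (\<lambda>y. k y \<bullet> i * \<phi> y) \<and>
         integral\<^sup>L (lebesgue_on (ball x r)) (\<lambda>y. k y \<bullet> i * \<phi> y) = integral\<^sup>L (lebesgue_on (cball x t)) (\<lambda>y. k y \<bullet> i * \<phi> y)"
        if k: "integrable (lebesgue_on (cball x t)) k" for k :: "'a \<Rightarrow> 'a"
      proof -
        have \<phi>L: "\<phi> \<in> borel_measurable (lebesgue_on (cball x t))"
          by (intro measurable_restrict_space1 measurable_completion) simp
        have "integrable (lebesgue_on (cball x t)) (\<lambda>y. B *\<^sub>R (k y \<bullet> i))" using k by (intro integrable_scaleR_right integrable_inner_left)
        then have int: "integrable (lebesgue_on (cball x t)) (\<lambda>y. k y \<bullet> i * \<phi> y)"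
        proof (rule Bochner_Integration.integrable_bound)
          show "(\<lambda>y. k y \<bullet> i * \<phi> y) \<in> borel_measurable (lebesgue_on (cball x t))"
            using k \<phi>L by (intro borel_measurable_times borel_measurable_inner borel_measurable_const) auto
        qed (use B in \<open>auto simp: abs_mult mult.commute[of B] intro!: mult_left_mono\<close>)
        have s1: "ball x r \<inter> space lebesgue \<in> sets lebesgue" "cball x t \<inter> space lebesgue \<in> sets lebesgue"
          by (auto simp: sets_completionI_sets)
        have "indicator (ball x r) y *\<^sub>R (k y \<bullet> i * \<phi> y) = indicator (cball x t) y *\<^sub>R (k y \<bullet> i * \<phi> y)" for y
          using test_zero[OF \<phi>, of y] t(2) by (cases "y \<in> ball x t") (auto simp: indicator_def)
        then have "(\<lambda>y. indicator (ball x r) y *\<^sub>R (k y \<bullet> i * \<phi> y)) = (\<lambda>y. indicator (cball x t) y *\<^sub>R (k y \<bullet> i * \<phi> y))" by (rule ext)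
        then show ?thesis using int unfolding integral_restrict_space[OF s1(1)] integral_restrict_space[OF s1(2)] by simp
      qed
      have "integral\<^sup>L (lebesgue_on (ball x r)) (\<lambda>y. g y \<bullet> i * \<phi> y) = integral\<^sup>L (lebesgue_on (ball x r)) (\<lambda>y. g' y \<bullet> i * \<phi> y)"
      proof -
        let ?L = "\<integral>x. v x * frechet_derivative \<phi> (at x) i \<partial>lebesgue_on (ball x r)"
        have "?L = - integral\<^sup>L (lebesgue_on (ball x r)) (\<lambda>y. g y \<bullet> i * \<phi> y)"
          "?L = - integral\<^sup>L (lebesgue_on (ball x r)) (\<lambda>y. g' y \<bullet> i * \<phi> y)"
          using g g' \<phi>' i unfolding has_weak_gradient_def by blast+
        then show ?thesis by linarith
      qed
      then have "(\<integral>y. g y \<bullet> i * \<phi> y - g' y \<bullet> i * \<phi> y \<partial>lebesgue_on (cball x t)) = 0"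
        using *[OF gi(1)] *[OF gi(2)] by (simp add: Bochner_Integration.integral_diff)
      moreover have "(\<integral>y. g y \<bullet> i * \<phi> y - g' y \<bullet> i * \<phi> y \<partial>lebesgue_on (cball x t)) = (LBINT y. indicator (cball x t) y *\<^sub>R (h y * \<phi> y))"
      proof (rule lebesgue_on_transfer(1)[OF cb])
        show "AE y in lborel. y \<in> cball x t \<longrightarrow> g y \<bullet> i * \<phi> y - g' y \<bullet> i * \<phi> y = h y * \<phi> y"
          using he by eventually_elim (auto simp: inner_diff_left left_diff_distrib[symmetric])
      qed measurable
      ultimately show "(LBINT y. h0 y * \<phi> y) = 0" by (simp add: h0_def mult.assoc)
    qed
    with he show ?thesis
    proof eventually_elim
      case (elim y)
      then show ?case by (auto simp: h0_def)
    qed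
  qed
  have "AE y in lborel. \<forall>i\<in>Basis. y \<in> ball x t \<longrightarrow> (g y - g' y) \<bullet> i = 0"
    using main by (intro AE_finite_allI) auto
  then show "AE y in lborel. y \<in> ball x t \<longrightarrow> g y = g' y"
  proof eventually_elim
    case (elim y)
    show ?case
    proof
      assume "y \<in> ball x t"
      then show "g y = g' y" using elim by (intro euclidean_eqI[of "g y"]) (auto simp: inner_diff_left)
    qed
  qed
qed

lemma weak_gradient_eq:
  assumes "has_weak_gradient (ball x r) v g"
  shows "AE y in lborel. y \<in> ball x r \<longrightarrow> weak_gradient (ball x r) v y = g y"
proof -
  have "has_weak_gradient (ball x r) v (weak_gradient (ball x r) v)"
    unfolding weak_gradient_def by (rule someI[of "has_weak_gradient (ball x r) v", OF assms])
  then show ?thesis by (rule weak_gradient_unique[OF _ assms])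
qed

section \<open>Traces on almost every sphere\<close>

lemma nn_integral_inverse_power_finite:
  fixes a :: real
  assumes "0 < a" "0 < n"
  shows "(\<integral>\<^sup>+l. ennreal (1 / l ^ Suc n) * indicator {a..} l \<partial>lborel) < \<infinity>"
proof -
  have "(\<integral>\<^sup>+l. ennreal (1 / l ^ Suc n) * indicator {a..} l \<partial>lborel) = ennreal (0 - (- (1 / (real n * a ^ n))))"
  proof (rule nn_integral_FTC_atLeast[where F="\<lambda>l. - (1 / (real n * l ^ n))"])
    show "DERIV (\<lambda>l. - (1 / (real n * l ^ n))) l :> 1 / l ^ Suc n" if "a \<le> l" for l
    proof -
      have l: "l \<noteq> 0" using that assms by simp
      have "DERIV (\<lambda>l. inverse (l ^ n)) l :> - (inverse (l ^ n) * (real n * l ^ (n - Suc 0)) * inverse (l ^ n))"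
        using DERIV_inverse_fun[OF DERIV_pow[of n l UNIV]] l by (simp add: mult_ac)
      from DERIV_cmult[OF this, of "- (1 / real n)"]
      have "DERIV (\<lambda>l. - (1 / real n) * inverse (l ^ n)) l :> - (1 / real n) * - (inverse (l ^ n) * (real n * l ^ (n - Suc 0)) * inverse (l ^ n))" .
      moreover have "- (1 / real n) * - (inverse (l ^ n) * (real n * l ^ (n - Suc 0)) * inverse (l ^ n)) = 1 / l ^ Suc n"
        using l assms(2) by (cases n) (simp_all add: field_simps del: of_nat_Suc)
      moreover have "(\<lambda>l. - (1 / real n) * inverse (l ^ n)) = (\<lambda>l. - (1 / (real n * l ^ n)))" by (auto simp: fun_eq_iff field_simps)
      ultimately show ?thesis by simp
    qed
    have "((\<lambda>l. inverse (l ^ n)) \<longlongrightarrow> (0::real)) at_top"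
      using assms(2) by (intro tendsto_inverse_0_at_top filterlim_pow_at_top filterlim_ident)
    from tendsto_mult[OF tendsto_const[of "- (1 / real n)"] this]
    show "((\<lambda>l. - (1 / (real n * l ^ n))) \<longlongrightarrow> 0) at_top" by (simp add: field_simps)
  qed (use assms in auto)
  then show ?thesis by simp
qed

text \<open>The substitution \<open>t = l |y|\<close> in the inner integral turns spherical integrals into integrals over
  dilated balls.\<close>

lemma polar_bound:
  fixes w :: "'a::euclidean_space \<Rightarrow> ennreal"
  assumes w [measurable]: "w \<in> borel_measurable borel" and R: "0 < R"
  shows "(\<integral>\<^sup>+t. \<integral>\<^sup>+y. indicator {R/2<..<R} t * (indicator (ball 0 1) y * w (x + t *\<^sub>R sgn y)) \<partial>lborel \<partial>lborel)
    \<le> (ennreal R * (\<integral>\<^sup>+l. ennreal (1 / l ^ Suc DIM('a)) * indicator {R/2..} l \<partial>lborel)) * (\<integral>\<^sup>+z. w z \<partial>lborel)"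
proof -
  have b [measurable]: "ball (0::'a) 1 \<in> sets borel" "{R/2<..<R} \<in> sets borel" "{R/2..} \<in> sets borel" by auto
  let ?n = "DIM('a)"
  have "(\<integral>\<^sup>+t. \<integral>\<^sup>+y. indicator {R/2<..<R} t * (indicator (ball 0 1) y * w (x + t *\<^sub>R sgn y)) \<partial>lborel \<partial>lborel)
    = (\<integral>\<^sup>+y. \<integral>\<^sup>+t. indicator {R/2<..<R} t * (indicator (ball 0 1) y * w (x + t *\<^sub>R sgn y)) \<partial>lborel \<partial>lborel)"
    by (rule lborel_pair.Fubini'[symmetric]) measurable
  also have "\<dots> \<le> (\<integral>\<^sup>+y. \<integral>\<^sup>+l. (ennreal R * (ennreal (1 / l) * indicator {R/2..} l)) * w (x + l *\<^sub>R y) \<partial>lborel \<partial>lborel)"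
  proof (rule nn_integral_mono_AE)
    \<comment> \<open>The substitution divides by |y|, so the centre is removed.\<close>
    have "AE y in lborel. y \<noteq> (0::'a)" using AE_lborel_singleton[of "0::'a"] .
    then show "AE y in lborel. (\<integral>\<^sup>+t. indicator {R/2<..<R} t * (indicator (ball 0 1) y * w (x + t *\<^sub>R sgn y)) \<partial>lborel)
      \<le> (\<integral>\<^sup>+l. (ennreal R * (ennreal (1 / l) * indicator {R/2..} l)) * w (x + l *\<^sub>R y) \<partial>lborel)"
    proof eventually_elim
      case (elim y)
      have y: "0 < norm y" using elim by simp
      have "(\<integral>\<^sup>+t. indicator {R/2<..<R} t * (indicator (ball 0 1) y * w (x + t *\<^sub>R sgn y)) \<partial>lborel)
        = ennreal \<bar>norm y\<bar> * (\<integral>\<^sup>+l. indicator {R/2<..<R} (0 + norm y * l) * (indicator (ball 0 1) y * w (x + (0 + norm y * l) *\<^sub>R sgn y)) \<partial>lborel)"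
        using y by (intro nn_integral_real_affine) auto
      also have "\<dots> = (\<integral>\<^sup>+l. ennreal (norm y) * (indicator {R/2<..<R} (0 + norm y * l) * (indicator (ball 0 1) y * w (x + (0 + norm y * l) *\<^sub>R sgn y))) \<partial>lborel)"
        by (subst nn_integral_cmult) auto
      also have "\<dots> \<le> (\<integral>\<^sup>+l. (ennreal R * (ennreal (1 / l) * indicator {R/2..} l)) * w (x + l *\<^sub>R y) \<partial>lborel)"
      proof (rule nn_integral_mono)
        fix l :: real
        have e: "(0 + norm y * l) *\<^sub>R sgn y = l *\<^sub>R y" using y by (simp add: sgn_div_norm)
        show "ennreal (norm y) * (indicator {R/2<..<R} (0 + norm y * l) * (indicator (ball 0 1) y * w (x + (0 + norm y * l) *\<^sub>R sgn y)))
          \<le> (ennreal R * (ennreal (1 / l) * indicator {R/2..} l)) * w (x + l *\<^sub>R y)"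
        \<comment> \<open>Since l |y| lies between R/2 and R and |y| < 1, it follows that l > R/2
          and that the Jacobian |y| is at most R / l. The bound no longer restricts y, so y may
          range over the whole space.\<close>
        proof (cases "norm y < 1 \<and> R/2 < norm y * l \<and> norm y * l < R")
          case True
          have l0: "0 < l" using True R y by (smt (verit) mult_nonneg_nonpos divide_pos_pos)
          have "norm y * l \<le> 1 * l" using True l0 by (intro mult_right_mono) auto
          then have l: "R/2 \<le> l" using True by linarith
          have "norm y \<le> R * (1 / l)" using True l0 by (simp add: field_simps)
          then have "ennreal (norm y) \<le> ennreal R * ennreal (1 / l)"
            using R l0 by (subst ennreal_mult[symmetric]) (auto intro: ennreal_leI)
          then show ?thesis unfolding e using True l by (auto simp: indicator_def intro: mult_right_mono)
        next
          case False
          then show ?thesis by (auto simp: indicator_def)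
        qed
      qed
      finally show ?case .
    qed
  qed
  also have "\<dots> = (\<integral>\<^sup>+l. \<integral>\<^sup>+y. (ennreal R * (ennreal (1 / l) * indicator {R/2..} l)) * w (x + l *\<^sub>R y) \<partial>lborel \<partial>lborel)"
    by (rule lborel_pair.Fubini') measurable
  \<comment> \<open>Undoing the dilation by l costs l^-n, and with the factor 1/l the weight becomes
    l^-(n+1), which is integrable over l >= R/2.\<close>
  also have "\<dots> = (\<integral>\<^sup>+l. (ennreal R * (\<integral>\<^sup>+z. w z \<partial>lborel)) * (ennreal (1 / l ^ Suc ?n) * indicator {R/2..} l) \<partial>lborel)"
  proof (rule nn_integral_cong)
    fix l :: real
    show "(\<integral>\<^sup>+y. (ennreal R * (ennreal (1 / l) * indicator {R/2..} l)) * w (x + l *\<^sub>R y) \<partial>lborel)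
      = (ennreal R * (\<integral>\<^sup>+z. w z \<partial>lborel)) * (ennreal (1 / l ^ Suc ?n) * indicator {R/2..} l)"
    proof (cases "R/2 \<le> l")
      case True
      then have l: "0 < l" using R by simp
      have "(\<integral>\<^sup>+z. w z \<partial>lborel) = ennreal (\<bar>l\<bar> ^ ?n) * (\<integral>\<^sup>+y. w (x + l *\<^sub>R y) \<partial>lborel)"
        using l by (intro lborel_nn_integral_affine) auto
      then have "ennreal (1 / l ^ Suc ?n) * (\<integral>\<^sup>+z. w z \<partial>lborel) = (ennreal (1 / l ^ Suc ?n) * ennreal (l ^ ?n)) * (\<integral>\<^sup>+y. w (x + l *\<^sub>R y) \<partial>lborel)"
        using l by (simp add: mult.assoc)
      also have "ennreal (1 / l ^ Suc ?n) * ennreal (l ^ ?n) = ennreal (1 / l)"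
        using l by (subst ennreal_mult[symmetric]) auto
      finally have e: "ennreal (1 / l) * (\<integral>\<^sup>+y. w (x + l *\<^sub>R y) \<partial>lborel) = ennreal (1 / l ^ Suc ?n) * (\<integral>\<^sup>+z. w z \<partial>lborel)" by simp
      have "(\<integral>\<^sup>+y. (ennreal R * (ennreal (1 / l) * indicator {R/2..} l)) * w (x + l *\<^sub>R y) \<partial>lborel)
        = ennreal R * (ennreal (1 / l) * (\<integral>\<^sup>+y. w (x + l *\<^sub>R y) \<partial>lborel))"
        using True by (subst nn_integral_cmult) (auto simp: mult.assoc)
      then show ?thesis unfolding e using True by (simp add: mult_ac)
    qed simp
  qed
  also have "\<dots> = (ennreal R * (\<integral>\<^sup>+z. w z \<partial>lborel)) * (\<integral>\<^sup>+l. ennreal (1 / l ^ Suc ?n) * indicator {R/2..} l \<partial>lborel)"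
    by (rule nn_integral_cmult) measurable
  finally show ?thesis by (simp add: mult_ac)
qed

text \<open>\<open>C\<close> does not depend on \<open>w\<close>; convergence in the mean on the
  space therefore yields convergence on spheres, in the mean over their radii.\<close>

lemma polar_bound_integrable:
  fixes x :: "'a::euclidean_space"
  assumes R: "0 < R"
  obtains C where "0 \<le> C" "\<And>w :: 'a \<Rightarrow> real. integrable lborel w \<Longrightarrow> (\<And>z. 0 \<le> w z) \<Longrightarrow>
     integrable (lborel \<Otimes>\<^sub>M lborel) (\<lambda>(t, y). indicator {R/2<..<R} t * (indicator (ball 0 1) y * w (x + t *\<^sub>R sgn y))) \<and>
     (LBINT t. (LBINT y. indicator {R/2<..<R} t * (indicator (ball 0 1) y * w (x + t *\<^sub>R sgn y)))) \<le> C * (LBINT z. w z)"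
proof -
  define K where "K = ennreal R * (\<integral>\<^sup>+l. ennreal (1 / l ^ Suc DIM('a)) * indicator {R/2..} l \<partial>lborel)"
  have "K < \<infinity>" unfolding K_def using nn_integral_inverse_power_finite[of "R/2" "DIM('a)"] R
    by (auto simp: ennreal_mult_less_top)
  then obtain C where C: "0 \<le> C" "K = ennreal C" by (cases K) auto
  show ?thesis
  proof (rule that[OF C(1)])
    fix w :: "'a \<Rightarrow> real" assume w: "integrable lborel w" and w0: "\<And>z. 0 \<le> w z"
    have wm [measurable]: "w \<in> borel_measurable borel" using w by auto
    have b [measurable]: "ball (0::'a) 1 \<in> sets borel" "{R/2<..<R} \<in> sets borel" by auto
    let ?U = "\<lambda>(t, y). indicator {R/2<..<R} t * (indicator (ball 0 1) y * w (x + t *\<^sub>R sgn y))"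
    have Um [measurable]: "?U \<in> borel_measurable (lborel \<Otimes>\<^sub>M lborel)" by measurable
    have U0: "0 \<le> ?U z" for z using w0 by (auto simp: case_prod_beta' indicator_def)
    have eq: "ennreal (?U (t, y)) = indicator {R/2<..<R} t * (indicator (ball 0 1) y * ennreal (w (x + t *\<^sub>R sgn y)))" for t y
      by (auto simp: indicator_def)
    have "(\<integral>\<^sup>+z. ennreal (?U z) \<partial>(lborel \<Otimes>\<^sub>M lborel)) = (\<integral>\<^sup>+t. \<integral>\<^sup>+y. ennreal (?U (t, y)) \<partial>lborel \<partial>lborel)"
      by (rule lborel.nn_integral_fst[symmetric]) measurable
    also have "\<dots> \<le> K * (\<integral>\<^sup>+z. ennreal (w z) \<partial>lborel)"
      unfolding eq K_def by (rule polar_bound[OF _ R]) measurable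
    also have "\<dots> = ennreal (C * (LBINT z. w z))"
      using nn_integral_eq_integral[OF w] w0 C by (simp add: ennreal_mult integral_nonneg_AE)
    finally have le: "(\<integral>\<^sup>+z. ennreal (?U z) \<partial>(lborel \<Otimes>\<^sub>M lborel)) \<le> ennreal (C * (LBINT z. w z))" .
    have int: "integrable (lborel \<Otimes>\<^sub>M lborel) ?U"
    proof (rule integrableI_nonneg)
      show "(\<integral>\<^sup>+z. ennreal (?U z) \<partial>(lborel \<Otimes>\<^sub>M lborel)) < \<infinity>" using le by (rule order_le_less_trans) simp
    qed (use U0 in auto)
    have "(LBINT t. (LBINT y. indicator {R/2<..<R} t * (indicator (ball 0 1) y * w (x + t *\<^sub>R sgn y)))) = integral\<^sup>L (lborel \<Otimes>\<^sub>M lborel) ?U"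
      using lborel_pair.integral_fst[OF int] by simp
    also have "ennreal (integral\<^sup>L (lborel \<Otimes>\<^sub>M lborel) ?U) \<le> ennreal (C * (LBINT z. w z))"
      using nn_integral_eq_integral[OF int AE_I2[OF U0]] le by simp
    then have "integral\<^sup>L (lborel \<Otimes>\<^sub>M lborel) ?U \<le> C * (LBINT z. w z)"
      using C(1) w0 by (subst (asm) ennreal_le_iff) (auto intro!: mult_nonneg_nonneg integral_nonneg_AE)
    finally show "integrable (lborel \<Otimes>\<^sub>M lborel) ?U \<and>
     (LBINT t. (LBINT y. indicator {R/2<..<R} t * (indicator (ball 0 1) y * w (x + t *\<^sub>R sgn y)))) \<le> C * (LBINT z. w z)"
      using int by blast
  qed
qed

text \<open>Rescaling to the unit ball leaves the radius only in the factor and in the point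
  \<open>x + r *\<^sub>R sgn y\<close>. That is the integrand of \<open>polar_bound\<close>, so
  radii can be integrated over.\<close>

lemma sphere_measure_nn_integral:
  fixes h :: "'a::euclidean_space \<Rightarrow> ennreal"
  assumes h [measurable]: "h \<in> borel_measurable borel" and r: "0 < r"
  shows "(\<integral>\<^sup>+y. h y \<partial>sphere_measure x r) = ennreal (real DIM('a) / r * r ^ DIM('a)) * (\<integral>\<^sup>+y. indicator (ball 0 1) y * h (x + r *\<^sub>R sgn y) \<partial>lborel)"
proof -
  have b [measurable]: "ball (0::'a) 1 \<in> sets borel" "ball x r \<in> sets borel" by auto
  have m: "(\<lambda>y. x + r *\<^sub>R sgn (y - x)) \<in> restrict_space lborel (ball x r) \<rightarrow>\<^sub>M borel"
    by (intro measurable_restrict_space1) measurable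
  have "(\<integral>\<^sup>+y. h y \<partial>sphere_measure x r) = ennreal (real DIM('a) / r) * (\<integral>\<^sup>+y. h (x + r *\<^sub>R sgn (y - x)) \<partial>restrict_space lborel (ball x r))"
    unfolding sphere_measure_def by (subst nn_integral_scale_measure) (auto simp: nn_integral_distr[OF m])
  also have "(\<integral>\<^sup>+y. h (x + r *\<^sub>R sgn (y - x)) \<partial>restrict_space lborel (ball x r)) = (\<integral>\<^sup>+y. h (x + r *\<^sub>R sgn (y - x)) * indicator (ball x r) y \<partial>lborel)"
    by (rule nn_integral_restrict_space) simp
  also have "\<dots> = ennreal (\<bar>r\<bar> ^ DIM('a)) * (\<integral>\<^sup>+y. h (x + r *\<^sub>R sgn (x + r *\<^sub>R y - x)) * indicator (ball x r) (x + r *\<^sub>R y) \<partial>lborel)"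
    using r by (intro lborel_nn_integral_affine) auto
  also have "(\<integral>\<^sup>+y. h (x + r *\<^sub>R sgn (x + r *\<^sub>R y - x)) * indicator (ball x r) (x + r *\<^sub>R y) \<partial>lborel) = (\<integral>\<^sup>+y. indicator (ball 0 1) y * h (x + r *\<^sub>R sgn y) \<partial>lborel)"
    using r by (intro nn_integral_cong) (auto simp: indicator_def dist_norm sgn_scaleR)
  also have "\<bar>r\<bar> = r" using r by simp
  finally have 1: "(\<integral>\<^sup>+y. h y \<partial>sphere_measure x r) = ennreal (real DIM('a) / r) * (ennreal (r ^ DIM('a)) * (\<integral>\<^sup>+y. indicator (ball 0 1) y * h (x + r *\<^sub>R sgn y) \<partial>lborel))" .
  have 2: "ennreal (real DIM('a) / r * r ^ DIM('a)) = ennreal (real DIM('a) / r) * ennreal (r ^ DIM('a))"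
    using r by (intro ennreal_mult) auto
  show ?thesis unfolding 1 2 by (simp only: mult.assoc)
qed

lemma sphere_measure_integrable:
  fixes h :: "'a::euclidean_space \<Rightarrow> real"
  assumes h [measurable]: "h \<in> borel_measurable borel" and r: "0 < r"
    and i: "integrable lborel (\<lambda>y. indicator (ball 0 1) y * \<bar>h (x + r *\<^sub>R sgn y)\<bar>)"
  shows "integrable (sphere_measure x r) h"
proof (rule integrableI_bounded)
  show "h \<in> borel_measurable (sphere_measure x r)" by (simp add: sphere_measure_def)
  have "(\<integral>\<^sup>+y. ennreal (norm (h y)) \<partial>sphere_measure x r) = ennreal (real DIM('a) / r * r ^ DIM('a)) * (\<integral>\<^sup>+y. indicator (ball 0 1) y * ennreal (norm (h (x + r *\<^sub>R sgn y))) \<partial>lborel)"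
    by (rule sphere_measure_nn_integral[OF _ r]) measurable
  also have "(\<integral>\<^sup>+y. indicator (ball 0 1) y * ennreal (norm (h (x + r *\<^sub>R sgn y))) \<partial>lborel) = (\<integral>\<^sup>+y. ennreal (norm (indicator (ball 0 1) y * \<bar>h (x + r *\<^sub>R sgn y)\<bar>)) \<partial>lborel)"
    by (intro nn_integral_cong) (auto simp: indicator_def)
  finally show "(\<integral>\<^sup>+y. ennreal (norm (h y)) \<partial>sphere_measure x r) < \<infinity>"
    using i by (auto simp: integrable_iff_bounded ennreal_mult_less_top)
qed

lemma sphere_measure_integral:
  fixes h :: "'a::euclidean_space \<Rightarrow> real"
  assumes h [measurable]: "h \<in> borel_measurable borel" and r: "0 < r" and h0: "\<And>y. 0 \<le> h y"
  shows "(\<integral>y. h y \<partial>sphere_measure x r) = (real DIM('a) / r * r ^ DIM('a)) * (LBINT y. indicator (ball 0 1) y * h (x + r *\<^sub>R sgn y))"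
proof -
  have b [measurable]: "ball (0::'a) 1 \<in> sets borel" by auto
  have "(\<integral>y. h y \<partial>sphere_measure x r) = enn2real (\<integral>\<^sup>+y. ennreal (h y) \<partial>sphere_measure x r)"
    using h0 by (intro integral_eq_nn_integral) (auto simp: sphere_measure_def)
  also have "(\<integral>\<^sup>+y. ennreal (h y) \<partial>sphere_measure x r) = ennreal (real DIM('a) / r * r ^ DIM('a)) * (\<integral>\<^sup>+y. indicator (ball 0 1) y * ennreal (h (x + r *\<^sub>R sgn y)) \<partial>lborel)"
    by (rule sphere_measure_nn_integral[OF _ r]) measurable
  also have "(\<integral>\<^sup>+y. indicator (ball 0 1) y * ennreal (h (x + r *\<^sub>R sgn y)) \<partial>lborel) = (\<integral>\<^sup>+y. ennreal (indicator (ball 0 1) y * h (x + r *\<^sub>R sgn y)) \<partial>lborel)"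
    by (intro nn_integral_cong) (auto simp: indicator_def)
  also have "enn2real (ennreal (real DIM('a) / r * r ^ DIM('a)) * \<dots>) = (real DIM('a) / r * r ^ DIM('a)) * enn2real (\<integral>\<^sup>+y. ennreal (indicator (ball 0 1) y * h (x + r *\<^sub>R sgn y)) \<partial>lborel)"
    using r by (simp add: enn2real_mult)
  also have "enn2real (\<integral>\<^sup>+y. ennreal (indicator (ball 0 1) y * h (x + r *\<^sub>R sgn y)) \<partial>lborel) = (LBINT y. indicator (ball 0 1) y * h (x + r *\<^sub>R sgn y))"
    using h0 by (intro integral_eq_nn_integral[symmetric]) auto
  finally show ?thesis .
qed

lemma conv_test:
  fixes f :: "'a::euclidean_space \<Rightarrow> real"
  assumes s: "0 < s" and f: "integrable lborel f" and z: "\<And>y. y \<notin> cball a \<rho> \<Longrightarrow> f y = 0"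
  shows "test_function UNIV (conv (mollifier s) f)"
  by (rule test_functionI[OF conv_C_infinity[OF mollifier_test[OF s] f], of "cball a (\<rho> + s)"])
    (use conv_zero_outside[OF s z] in auto)

text \<open>The spherical distances of the mollifications to f, integrated over the radii, tend to
  0, so a subsequence converges on almost every sphere and f restricted to the sphere is the trace.
  The null set of radii must not depend on psi, hence the quantifier inside; adding psi changes no
  boundary value.\<close>

lemma trace_AE:
  fixes u f :: "'a::euclidean_space \<Rightarrow> real"
  assumes f: "integrable lborel f" and G: "integrable lborel G" "sqint G" and w: "weakly_diff (ball x0 \<rho>) f G"
    and fz: "\<And>y. y \<notin> cball x0 \<rho> \<Longrightarrow> f y = 0" and Gz: "\<And>y. y \<notin> cball x0 \<rho> \<Longrightarrow> G y = 0"
    and uf: "AE y in lborel. y \<in> ball x0 \<rho> \<longrightarrow> u y = f y"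
    and R: "0 < R" "ball x R \<subseteq> ball x0 \<rho>"
  shows "AE r in lborel. R/2 < r \<and> r < R \<longrightarrow> (\<forall>\<psi>. test_function (ball x r) \<psi> \<longrightarrow> has_trace x r (\<lambda>y. u y + \<psi> y) f)"
proof -
  have [measurable]: "f \<in> borel_measurable borel" "G \<in> borel_measurable borel" using f G by auto
  define s where "s k = inverse (real (Suc k))" for k
  have s: "0 < s k" for k by (simp add: s_def)
  have s0: "s \<longlonglongrightarrow> 0" unfolding s_def by (rule LIMSEQ_inverse_real_of_nat)
  define \<phi> where "\<phi> k = conv (mollifier (s k)) f" for k
  have \<phi>t: "test_function UNIV (\<phi> k)" for k unfolding \<phi>_def by (rule conv_test[OF s f fz])
  have \<phi>C: "C_infinity (\<phi> k)" for k by (rule test_C_infinity[OF \<phi>t])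
  have \<phi>i: "integrable lborel (\<phi> k)" for k by (rule test_integrable[OF \<phi>t])
  have \<phi>m [measurable]: "\<phi> k \<in> borel_measurable borel" for k using \<phi>i[of k] by auto
  have out: "y \<notin> cball x0 \<rho>" if "y \<notin> cball 0 (norm x0 + \<rho>)" for y
    using that norm_triangle_ineq2[of y x0] by (auto simp: dist_norm norm_minus_commute)
  have W: "(\<lambda>k. LBINT z. \<bar>\<phi> k z - f z\<bar>) \<longlonglongrightarrow> 0" "\<And>k. integrable lborel (\<lambda>z. \<bar>\<phi> k z - f z\<bar>)"
    using conv_Lp_tendsto[of f 1 "norm x0 + \<rho>" s] f fz[OF out] s s0 by (auto simp: \<phi>_def)
  have N: "(\<lambda>k. nrm (\<lambda>z. conv (mollifier (s k)) G z - G z)) \<longlonglongrightarrow> 0"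
    by (rule nrm_conv_tendsto[OF G Gz[OF out] s s0])
  obtain C where C: "0 \<le> C" "\<And>w :: 'a \<Rightarrow> real. integrable lborel w \<Longrightarrow> (\<And>z. 0 \<le> w z) \<Longrightarrow>
     integrable (lborel \<Otimes>\<^sub>M lborel) (\<lambda>(t, y). indicator {R/2<..<R} t * (indicator (ball 0 1) y * w (x + t *\<^sub>R sgn y))) \<and>
     (LBINT t. (LBINT y. indicator {R/2<..<R} t * (indicator (ball 0 1) y * w (x + t *\<^sub>R sgn y)))) \<le> C * (LBINT z. w z)"
    using polar_bound_integrable[OF R(1), of x] by blast
  \<comment> \<open>Up to a factor depending on t, the L1 distance of the k-th mollification to f on
    the sphere of radius t about x.\<close>
  define v where "v k t = (LBINT y. indicator {R/2<..<R} t * (indicator (ball 0 1) y * \<bar>\<phi> k (x + t *\<^sub>R sgn y) - f (x + t *\<^sub>R sgn y)\<bar>))" for k t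
  note Ck = C(2)[OF W(2) abs_ge_zero]
  have vi: "integrable lborel (v k)" for k
    unfolding v_def[abs_def] by (rule lborel_pair.integrable_fst[OF conjunct1[OF Ck]])
  have v0: "0 \<le> v k t" for k t unfolding v_def by (intro integral_nonneg_AE) auto
  have vle: "(LBINT t. v k t) \<le> C * (LBINT z. \<bar>\<phi> k z - f z\<bar>)" for k
    unfolding v_def[abs_def] by (rule conjunct2[OF Ck])
  have "(\<lambda>k. LBINT t. norm (v k t)) \<longlonglongrightarrow> 0"
  proof (rule tendsto_sandwich[OF _ _ tendsto_const])
    show "(\<lambda>k. C * (LBINT z. \<bar>\<phi> k z - f z\<bar>)) \<longlonglongrightarrow> 0" using tendsto_mult[OF tendsto_const[of C] W(1)] by simp
    show "\<forall>\<^sub>F k in sequentially. (LBINT t. norm (v k t)) \<le> C * (LBINT z. \<bar>\<phi> k z - f z\<bar>)"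
      using vle v0 by (intro always_eventually allI) simp
  qed (use v0 in \<open>auto intro!: always_eventually integral_nonneg_AE\<close>)
  from tendsto_L1_AE_subseq[OF vi this] obtain \<sigma> where \<sigma>: "strict_mono \<sigma>" "AE t in lborel. (\<lambda>k. v (\<sigma> k) t) \<longlonglongrightarrow> 0"
    by blast
  have sub: "filterlim \<sigma> sequentially sequentially" using \<sigma>(1) by (rule filterlim_subseq)
  have fi: "AE t in lborel. integrable lborel (\<lambda>y. indicator {R/2<..<R} t * (indicator (ball 0 1) y * \<bar>f (x + t *\<^sub>R sgn y)\<bar>))"
    using lborel_pair.AE_integrable_fst[OF conjunct1[OF C(2)[OF integrable_abs[OF f]]]] by simp
  show ?thesis using \<sigma>(2) fi
  proof eventually_elim
    case (elim r)
    show ?case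
    proof (intro impI allI)
      fix \<psi> assume r: "R/2 < r \<and> r < R" and \<psi>: "test_function (ball x r) \<psi>"
      have r0: "0 < r" using r R by linarith
      have Br: "ball x r \<subseteq> ball x0 \<rho>" using R(2) r by (meson order_trans subset_ball less_imp_le)
      have \<psi>C: "C_infinity \<psi>" using \<psi> by (rule test_C_infinity)
      have [measurable]: "\<psi> \<in> borel_measurable borel" by (rule test_borel[OF \<psi>])
      have ind: "indicator {R/2<..<R} r = (1::real)" using r by simp
      have bB: "ball x r \<in> sets borel" by simp
      have ur: "AE y in lborel. y \<in> ball x r \<longrightarrow> u y = f y" using uf by eventually_elim (use Br in blast)
      show "has_trace x r (\<lambda>y. u y + \<psi> y) f" unfolding has_trace_def
      proof (intro conjI exI[of _ "\<lambda>k y. \<phi> (\<sigma> k) y + \<psi> y"] allI)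
        show "integrable (sphere_measure x r) f"
          using elim(2) unfolding ind by (intro sphere_measure_integrable r0) auto
        show "C_infinity (\<lambda>y. \<phi> (\<sigma> k) y + \<psi> y)" for k by (rule C_infinity_add[OF \<phi>C \<psi>C])
        have eq1: "(\<integral>y. \<bar>\<phi> (\<sigma> k) y + \<psi> y - (u y + \<psi> y)\<bar> \<partial>lebesgue_on (ball x r)) = (LBINT y. indicator (ball x r) y *\<^sub>R \<bar>\<phi> (\<sigma> k) y - f y\<bar>)" for k
          by (rule lebesgue_on_transfer(1)[OF bB]) (use ur in \<open>measurable, eventually_elim, auto\<close>)
        have le1: "(LBINT y. indicator (ball x r) y *\<^sub>R \<bar>\<phi> (\<sigma> k) y - f y\<bar>) \<le> (LBINT y. \<bar>\<phi> (\<sigma> k) y - f y\<bar>)" for k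
          by (intro integral_mono W(2) integrable_mult_indicator) (auto simp: indicator_def)
        show "(\<lambda>k. \<integral>y. \<bar>\<phi> (\<sigma> k) y + \<psi> y - (u y + \<psi> y)\<bar> \<partial>lebesgue_on (ball x r)) \<longlonglongrightarrow> 0"
          unfolding eq1
        proof (rule tendsto_sandwich[OF _ _ tendsto_const])
          show "(\<lambda>k. LBINT y. \<bar>\<phi> (\<sigma> k) y - f y\<bar>) \<longlonglongrightarrow> 0" by (rule filterlim_compose[OF W(1) sub])
        qed (use le1 in \<open>auto intro!: always_eventually integral_nonneg_AE\<close>)
        have wg: "AE y in lborel. y \<in> ball x r \<longrightarrow> weak_gradient (ball x r) (\<lambda>z. \<phi> k z + \<psi> z - (u z + \<psi> z)) y = grad (\<phi> k) y - G y" for k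
        proof -
          have "(\<lambda>z. \<phi> k z + \<psi> z - (u z + \<psi> z)) = (\<lambda>z. \<phi> k z - u z)" by auto
          moreover have "has_weak_gradient (ball x r) (\<lambda>z. \<phi> k z - u z) (\<lambda>z. grad (\<phi> k) z - G z)"
          proof (rule has_weak_gradientI[of "\<lambda>z. \<phi> k z - f z" "\<lambda>z. grad (\<phi> k) z - G z"])
            show "weakly_diff (ball x r) (\<lambda>z. \<phi> k z - f z) (\<lambda>z. grad (\<phi> k) z - G z)"
              using weakly_diff_lincomb[OF weakly_diff_smooth[OF \<phi>C] weakly_diff_mono[OF w Br] \<phi>i sqint_grad(2)[OF \<phi>t] f G(1), of k "-1"]
              by simp
            show "AE z in lborel. z \<in> ball x r \<longrightarrow> \<phi> k z - u z = \<phi> k z - f z" using ur by eventually_elim simp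
          qed (use \<phi>i f G sqint_grad(2)[OF \<phi>t] in auto)
          ultimately show ?thesis using weak_gradient_eq by simp
        qed
        define Q where "Q k = (\<integral>y. (norm (weak_gradient (ball x r) (\<lambda>z. \<phi> k z + \<psi> z - (u z + \<psi> z)) y))\<^sup>2 \<partial>lebesgue_on (ball x r))" for k
        have gm [measurable]: "grad (\<phi> k) \<in> borel_measurable borel" for k by (rule C_infinity_grad_borel[OF \<phi>C])
        have Q: "Q k = (LBINT y. indicator (ball x r) y *\<^sub>R (norm (grad (\<phi> k) y - G y))\<^sup>2)" for k
          unfolding Q_def by (rule lebesgue_on_transfer(1)[OF bB]) (use wg[of k] in \<open>measurable, eventually_elim, auto\<close>)
        \<comment> \<open>Only eventually in k: the gradient of the mollification is the mollified
          gradient once the scale is below R - r.\<close>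
        have ev: "\<forall>\<^sub>F k in sequentially. Q k \<le> (nrm (\<lambda>z. conv (mollifier (s k)) G z - G z))\<^sup>2"
        proof -
          have "\<forall>\<^sub>F k in sequentially. s k < R - r" using r by (intro order_tendstoD(2)[OF s0]) auto
          then show ?thesis
          proof eventually_elim
            case (elim k)
            have cG: "sqint (\<lambda>z. conv (mollifier (s k)) G z - G z)" by (intro sqint_diff G nrm_conv_le(1)[OF s])
            have "grad (\<phi> k) y = conv (mollifier (s k)) G y" if y: "y \<in> ball x r" for y
              unfolding \<phi>_def
            proof (rule grad_conv[OF mollifier_C_infinity mollifier_zero[OF s] _ f G(1) w])
              show "cball y (s k) \<subseteq> ball x0 \<rho>"
              proof
                fix z assume "z \<in> cball y (s k)"
                then have "z \<in> ball x R" using y elim dist_triangle[of x z y] by auto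
                then show "z \<in> ball x0 \<rho>" using R(2) by blast
              qed
            qed
            then have "(\<lambda>y. indicator (ball x r) y *\<^sub>R (norm (grad (\<phi> k) y - G y))\<^sup>2)
               = (\<lambda>y. indicator (ball x r) y *\<^sub>R (norm (conv (mollifier (s k)) G y - G y))\<^sup>2)"
              by (auto simp: fun_eq_iff indicator_def)
            then have "Q k = (LBINT y. indicator (ball x r) y *\<^sub>R (norm (conv (mollifier (s k)) G y - G y))\<^sup>2)"
              unfolding Q by (rule arg_cong)
            also have "\<dots> \<le> (nrm (\<lambda>z. conv (mollifier (s k)) G z - G z))\<^sup>2"
              unfolding nrm_sq
            proof (rule integral_mono[OF integrable_mult_indicator[OF _ sqint_integrable[OF cG]] sqint_integrable[OF cG]])
              show "indicator (ball x r) y *\<^sub>R (norm (conv (mollifier (s k)) G y - G y))\<^sup>2 \<le> (norm (conv (mollifier (s k)) G y - G y))\<^sup>2" for y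
                by (cases "y \<in> ball x r") simp_all
            qed simp
            finally show "Q k \<le> (nrm (\<lambda>z. conv (mollifier (s k)) G z - G z))\<^sup>2" .
          qed
        qed
        have "Q \<longlonglongrightarrow> 0"
        proof (rule tendsto_sandwich[OF _ ev tendsto_const])
          show "(\<lambda>k. (nrm (\<lambda>z. conv (mollifier (s k)) G z - G z))\<^sup>2) \<longlonglongrightarrow> 0" using tendsto_power[OF N, of 2] by simp
        qed (auto intro!: always_eventually integral_nonneg_AE simp: Q_def)
        from filterlim_compose[OF this sub]
        show "(\<lambda>k. \<integral>y. (norm (weak_gradient (ball x r) (\<lambda>z. \<phi> (\<sigma> k) z + \<psi> z - (u z + \<psi> z)) y))\<^sup>2 \<partial>lebesgue_on (ball x r)) \<longlonglongrightarrow> 0"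
          by (simp add: Q_def)
        have "(\<integral>y. \<bar>\<phi> (\<sigma> k) y + \<psi> y - f y\<bar> \<partial>sphere_measure x r) = (real DIM('a) / r * r ^ DIM('a)) * v (\<sigma> k) r" for k
        proof -
          have b [measurable]: "ball (0::'a) 1 \<in> sets borel" by auto
          have "(LBINT y. indicator (ball 0 1) y * \<bar>\<phi> (\<sigma> k) (x + r *\<^sub>R sgn y) + \<psi> (x + r *\<^sub>R sgn y) - f (x + r *\<^sub>R sgn y)\<bar>)
            = (LBINT y. indicator (ball 0 1) y * \<bar>\<phi> (\<sigma> k) (x + r *\<^sub>R sgn y) - f (x + r *\<^sub>R sgn y)\<bar>)"
          proof (rule integral_cong_AE)
            \<comment> \<open>At y = 0 the vector \<open>sgn y\<close> is 0 and the point is the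
              centre, where psi need not vanish.\<close>
            have "AE y in lborel. y \<noteq> (0::'a)" using AE_lborel_singleton[of "0::'a"] .
            then show "AE y in lborel. indicator (ball 0 1) y * \<bar>\<phi> (\<sigma> k) (x + r *\<^sub>R sgn y) + \<psi> (x + r *\<^sub>R sgn y) - f (x + r *\<^sub>R sgn y)\<bar>
              = indicator (ball 0 1) y * \<bar>\<phi> (\<sigma> k) (x + r *\<^sub>R sgn y) - f (x + r *\<^sub>R sgn y)\<bar>"
            proof eventually_elim
              case (elim y)
              have "x + r *\<^sub>R sgn y \<notin> ball x r" using elim r0 by (simp add: dist_norm norm_sgn)
              then show ?case using test_zero[OF \<psi>] by simp
            qed
          qed measurable
          then show ?thesis unfolding v_def ind using r0 by (subst sphere_measure_integral) auto
        qed
        then show "(\<lambda>k. \<integral>y. \<bar>\<phi> (\<sigma> k) y + \<psi> y - f y\<bar> \<partial>sphere_measure x r) \<longlonglongrightarrow> 0"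
          using tendsto_mult[OF tendsto_const[of "real DIM('a) / r * r ^ DIM('a)"] elim(1)] by simp
      qed
    qed
  qed
qed

section \<open>Almost minimizers\<close>

lemma q_term:
  fixes q v :: "'a::euclidean_space \<Rightarrow> real"
  assumes q: "q \<in> borel_measurable (lebesgue_on \<Omega>)" "AE y in lebesgue_on \<Omega>. \<bar>q y\<bar> \<le> M" and \<Omega>: "open \<Omega>"
    and B: "ball x r \<subseteq> \<Omega>" and v: "v \<in> borel_measurable (lebesgue_on (ball x r))" and A: "A \<in> sets borel"
  shows "integrable (lebesgue_on (ball x r)) (\<lambda>y. (q y)\<^sup>2 * indicator {z. v z \<in> A} y)"
    and "0 \<le> (\<integral>y. (q y)\<^sup>2 * indicator {z. v z \<in> A} y \<partial>lebesgue_on (ball x r))"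
    and "(\<integral>y. (q y)\<^sup>2 * indicator {z. v z \<in> A} y \<partial>lebesgue_on (ball x r)) \<le> M\<^sup>2 * measure lborel (ball x r)"
proof -
  let ?L = "lebesgue_on (ball x r)"
  have q': "q \<in> borel_measurable ?L" by (rule measurable_restrict_mono[OF q(1) B])
  have iv: "(\<lambda>y. indicator A (v y) :: real) \<in> borel_measurable ?L"
    by (rule measurable_compose[OF v]) (use A in simp)
  have meas: "(\<lambda>y. (q y)\<^sup>2 * indicator {z. v z \<in> A} y) \<in> borel_measurable ?L"
  proof -
    have "(\<lambda>y. (q y)\<^sup>2 * indicator A (v y)) \<in> borel_measurable ?L"
      by (intro borel_measurable_times borel_measurable_power q' iv)
    then show ?thesis by (simp add: indicator_def)
  qed
  have s: "\<Omega> \<inter> space lebesgue \<in> sets lebesgue" "ball x r \<inter> space lebesgue \<in> sets lebesgue"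
    using \<Omega> by (auto simp: sets_completionI_sets)
  have "AE y in lebesgue. y \<in> \<Omega> \<longrightarrow> \<bar>q y\<bar> \<le> M" using q(2) by (subst (asm) AE_restrict_space_iff[OF s(1)])
  then have "AE y in lebesgue. y \<in> ball x r \<longrightarrow> \<bar>q y\<bar> \<le> M" by eventually_elim (use B in blast)
  then have "AE y in ?L. \<bar>q y\<bar> \<le> M" by (subst AE_restrict_space_iff[OF s(2)])
  then have bd: "AE y in ?L. norm ((q y)\<^sup>2 * indicator {z. v z \<in> A} y) \<le> M\<^sup>2"
  proof eventually_elim
    case (elim y)
    have "(q y)\<^sup>2 \<le> M\<^sup>2" using power_mono[OF elim abs_ge_zero, of 2] by simp
    then show ?case by (auto simp: indicator_def)
  qed
  have ic: "integrable ?L (\<lambda>y. M\<^sup>2)" and mc: "(\<integral>y. M\<^sup>2 \<partial>?L) = M\<^sup>2 * measure lborel (ball x r)"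
  proof -
    have t: "AE y in lborel. y \<in> ball x r \<longrightarrow> M\<^sup>2 = M\<^sup>2" by simp
    have i: "integrable lborel (\<lambda>y::'a. indicator (ball x r) y *\<^sub>R M\<^sup>2)"
      using integrable_indicator_ball[of "\<lambda>_. M\<^sup>2" x r] by simp
    show "integrable ?L (\<lambda>y. M\<^sup>2)" using lebesgue_on_transfer(2)[OF _ _ t] i by simp
    show "(\<integral>y. M\<^sup>2 \<partial>?L) = M\<^sup>2 * measure lborel (ball x r)" using lebesgue_on_transfer(1)[OF _ _ t] by simp
  qed
  show int: "integrable ?L (\<lambda>y. (q y)\<^sup>2 * indicator {z. v z \<in> A} y)"
    by (rule Bochner_Integration.integrable_bound[OF ic meas]) (use bd in \<open>eventually_elim, auto\<close>)
  show "0 \<le> (\<integral>y. (q y)\<^sup>2 * indicator {z. v z \<in> A} y \<partial>?L)" by (intro integral_nonneg_AE) auto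
  have "(\<integral>y. (q y)\<^sup>2 * indicator {z. v z \<in> A} y \<partial>?L) \<le> (\<integral>y. M\<^sup>2 \<partial>?L)"
    by (rule integral_mono_AE[OF int ic]) (use bd in \<open>eventually_elim, auto\<close>)
  then show "(\<integral>y. (q y)\<^sup>2 * indicator {z. v z \<in> A} y \<partial>?L) \<le> M\<^sup>2 * measure lborel (ball x r)" by (simp only: mc)
qed

text \<open>The zero-order terms are nonnegative and at most \<open>M\<^sup>2\<close> times the
  volume of the ball, one for each sign. The factor 2 is kept for \<open>J_plus\<close> so that both
  functionals lead to the same inequality.\<close>

lemma J_bounds:
  fixes qp qm v :: "'a::euclidean_space \<Rightarrow> real"
  assumes qp: "qp \<in> borel_measurable (lebesgue_on \<Omega>)" "AE y in lebesgue_on \<Omega>. \<bar>qp y\<bar> \<le> M"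
    and qm: "qm \<in> borel_measurable (lebesgue_on \<Omega>)" "AE y in lebesgue_on \<Omega>. \<bar>qm y\<bar> \<le> M" and \<Omega>: "open \<Omega>"
    and B: "ball x r \<subseteq> \<Omega>" and v: "v \<in> borel_measurable (lebesgue_on (ball x r))"
    and g: "has_weak_gradient (ball x r) v H" and H: "sqint H"
  shows "(nrm (restr (ball x r) H))\<^sup>2 \<le> J qp qm x r v"
    and "J qp qm x r v \<le> (nrm (restr (ball x r) H))\<^sup>2 + 2 * M\<^sup>2 * measure lborel (ball x r)"
    and "(nrm (restr (ball x r) H))\<^sup>2 \<le> J_plus qp x r v"
    and "J_plus qp x r v \<le> (nrm (restr (ball x r) H))\<^sup>2 + 2 * M\<^sup>2 * measure lborel (ball x r)"
proof -
  let ?L = "lebesgue_on (ball x r)"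
  have bB: "ball x r \<in> sets borel" by simp
  have [measurable]: "H \<in> borel_measurable borel" by (rule sqint_borel[OF H])
  have wg: "AE y in lborel. y \<in> ball x r \<longrightarrow> (norm (weak_gradient (ball x r) v y))\<^sup>2 = (norm (H y))\<^sup>2"
    using weak_gradient_eq[OF g] by eventually_elim simp
  have e: "(norm (indicator (ball x r) y *\<^sub>R H y))\<^sup>2 = indicator (ball x r) y *\<^sub>R (norm (H y))\<^sup>2" for y
    by (simp add: indicator_def)
  have 1: "integrable ?L (\<lambda>y. (norm (weak_gradient (ball x r) v y))\<^sup>2)"
    using lebesgue_on_transfer(2)[OF bB _ wg] integrable_mult_indicator[OF _ sqint_integrable[OF H], of "ball x r"] by simp
  have 2: "(\<integral>y. (norm (weak_gradient (ball x r) v y))\<^sup>2 \<partial>?L) = (nrm (restr (ball x r) H))\<^sup>2"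
    unfolding nrm_sq e by (rule lebesgue_on_transfer(1)[OF bB _ wg]) measurable
  have A1: "{0<..} \<in> sets (borel :: real measure)" and A2: "{..<0} \<in> sets (borel :: real measure)" by simp_all
  note p = q_term[OF qp \<Omega> B v, of "{0<..}", unfolded greaterThan_iff]
  note m = q_term[OF qm \<Omega> B v, of "{..<0}", unfolded lessThan_iff]
  have J: "J qp qm x r v = (nrm (restr (ball x r) H))\<^sup>2
     + (\<integral>y. (qp y)\<^sup>2 * indicator {z. 0 < v z} y \<partial>?L) + (\<integral>y. (qm y)\<^sup>2 * indicator {z. v z < 0} y \<partial>?L)"
    unfolding J_def 2[symmetric] using 1 p(1)[OF A1] m(1)[OF A2] by simp
  have Jp: "J_plus qp x r v = (nrm (restr (ball x r) H))\<^sup>2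
     + (\<integral>y. (qp y)\<^sup>2 * indicator {z. 0 < v z} y \<partial>?L)"
    unfolding J_plus_def 2[symmetric] using 1 p(1)[OF A1] by simp
  have pos: "0 \<le> M\<^sup>2 * measure lborel (ball x r)" by simp
  show "(nrm (restr (ball x r) H))\<^sup>2 \<le> J qp qm x r v"
    "(nrm (restr (ball x r) H))\<^sup>2 \<le> J_plus qp x r v"
    "J qp qm x r v \<le> (nrm (restr (ball x r) H))\<^sup>2 + 2 * M\<^sup>2 * measure lborel (ball x r)"
    "J_plus qp x r v \<le> (nrm (restr (ball x r) H))\<^sup>2 + 2 * M\<^sup>2 * measure lborel (ball x r)"
    unfolding J Jp using p(2,3)[OF A1] m(2,3)[OF A2] pos by - linarith+
qed

lemma AE_obtain_in_interval:
  fixes a b :: real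
  assumes "AE t in lborel. P t" "a < b"
  obtains t where "a < t" "t < b" "P t"
proof -
  have "\<exists>t. a < t \<and> t < b \<and> P t"
  proof (rule ccontr)
    assume c: "\<not> ?thesis"
    have "AE t in lborel. t \<notin> {a<..<b}" using assms(1) by eventually_elim (use c in auto)
    then have "{a<..<b} \<in> null_sets lborel" by (subst (asm) AE_iff_null_sets[symmetric]) auto
    then have "emeasure lborel {a<..<b} = 0" by auto
    then show False using assms(2) by simp
  qed
  then show ?thesis using that by blast
qed

text \<open>Provides the radii below R for which a test function of \<open>ball x R\<close> is still
  a test function of the smaller ball.\<close>

lemma compact_subset_smaller_ball:
  fixes x :: "'a::euclidean_space"
  assumes K: "compact K" "K \<subseteq> ball x R" and R: "0 < R"
  obtains t where "R/2 \<le> t" "t < R" "K \<subseteq> ball x t"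
proof (cases "K = {}")
  case True then show ?thesis using that[of "R/2"] R by simp
next
  case False
  have "continuous_on K (dist x)" by (intro continuous_intros)
  from continuous_attains_sup[OF K(1) False this] obtain z where z: "z \<in> K" "\<And>y. y \<in> K \<Longrightarrow> dist x y \<le> dist x z" by blast
  have zR: "dist x z < R" using z K by auto
  define t where "t = max (R/2) ((dist x z + R) / 2)"
  have "K \<subseteq> ball x t"
  proof
    fix y assume "y \<in> K"
    then have "dist x y \<le> dist x z" by (rule z(2))
    also have "\<dots> < (dist x z + R) / 2" using zR by simp
    also have "\<dots> \<le> t" by (simp add: t_def)
    finally show "y \<in> ball x t" by simp
  qed
  then show ?thesis using that[of t] zR R by (auto simp: t_def)
qed

text \<open>\<open>f\<close> and \<open>G\<close> are Borel versions of \<open>u\<close> and \<open>\<nabla>u\<close>, cut off outside a closed ball so that they can be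
  convolved on the whole space.\<close>

locale local_representative =
  fixes \<Omega> :: "'a::euclidean_space set" and qp qm u f :: "'a \<Rightarrow> real" and G :: "'a \<Rightarrow> 'a" and x0 :: 'a and \<rho> \<kappa> \<alpha> M :: real
  assumes \<Omega>: "open \<Omega>" and B: "ball x0 \<rho> \<subseteq> \<Omega>"
    and qp: "qp \<in> borel_measurable (lebesgue_on \<Omega>)" "AE y in lebesgue_on \<Omega>. \<bar>qp y\<bar> \<le> M"
    and qm: "qm \<in> borel_measurable (lebesgue_on \<Omega>)" "AE y in lebesgue_on \<Omega>. \<bar>qm y\<bar> \<le> M"
    and \<kappa>: "0 < \<kappa>" and \<alpha>: "0 < \<alpha>"
    and am: "almost_minimizer \<Omega> qp qm \<kappa> \<alpha> u \<or> almost_minimizer_plus \<Omega> qp \<kappa> \<alpha> u"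
    and f: "integrable lborel f" and G: "integrable lborel G" "sqint G" and w: "weakly_diff (ball x0 \<rho>) f G"
    and fz: "\<And>y. y \<notin> cball x0 \<rho> \<Longrightarrow> f y = 0" and Gz: "\<And>y. y \<notin> cball x0 \<rho> \<Longrightarrow> G y = 0"
    and uf: "AE y in lborel. y \<in> ball x0 \<rho> \<longrightarrow> u y = f y"
begin

text \<open>Inserts u + psi into the definition. The hypothesis on traces, applied to the zero
  function and to psi, gives u and u + psi the common trace f. The closed ball is required inside
  \<open>\<Omega>\<close> for the sake of \<open>J_plus\<close>.\<close>

lemma energy_at_good_radius:
  assumes r: "0 < r" "ball x r \<subseteq> ball x0 \<rho>" "cball x r \<subseteq> \<Omega>" and \<psi>: "test_function (ball x r) \<psi>"
    and tr: "\<And>\<psi>. test_function (ball x r) \<psi> \<Longrightarrow> has_trace x r (\<lambda>y. u y + \<psi> y) f"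
  shows "(nrm (restr (ball x r) G))\<^sup>2 \<le> (1 + \<kappa> * r powr \<alpha>) *
    ((nrm (\<lambda>y. indicator (ball x r) y *\<^sub>R (G y + grad \<psi> y)))\<^sup>2 + 2 * M\<^sup>2 * measure lborel (ball x r))"
proof -
  have [measurable]: "f \<in> borel_measurable borel" "G \<in> borel_measurable borel" using f G by auto
  have [measurable]: "\<psi> \<in> borel_measurable borel" by (rule test_borel[OF \<psi>])
  have [measurable]: "grad \<psi> \<in> borel_measurable borel" by (rule C_infinity_grad_borel[OF test_C_infinity[OF \<psi>]])
  have bB: "ball x r \<in> sets borel" by simp
  have sub: "ball x r \<subseteq> \<Omega>" using r(2) B by blast
  have ur: "AE y in lborel. y \<in> ball x r \<longrightarrow> u y = f y" using uf by eventually_elim (use r in blast)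
  have vr: "AE y in lborel. y \<in> ball x r \<longrightarrow> u y + \<psi> y = f y + \<psi> y" using ur by eventually_elim simp
  have wr: "weakly_diff (ball x r) f G" by (rule weakly_diff_mono[OF w r(2)])
  define H where "H y = G y + grad \<psi> y" for y
  have H: "sqint H" "integrable lborel H" unfolding H_def[abs_def] using sqint_add[OF G(2) sqint_grad(1)[OF \<psi>]] G(1) sqint_grad(2)[OF \<psi>] by auto
  have fp: "integrable lborel (\<lambda>y. f y + \<psi> y)" using f test_integrable[OF \<psi>] by auto
  have gu: "has_weak_gradient (ball x r) u G" by (rule has_weak_gradientI[OF f G(1) wr open_ball ur]) simp
  have gv: "has_weak_gradient (ball x r) (\<lambda>y. u y + \<psi> y) H"
    by (rule has_weak_gradientI[OF fp H(2) _ open_ball vr])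
      (use weakly_diff_add_test[OF wr f G(1) \<psi>] in \<open>simp_all add: H_def[abs_def]\<close>)
  have um: "u \<in> borel_measurable (lebesgue_on (ball x r))" by (rule lebesgue_on_transfer(3)[OF bB _ ur]) measurable
  have vm: "(\<lambda>y. u y + \<psi> y) \<in> borel_measurable (lebesgue_on (ball x r))" by (rule lebesgue_on_transfer(3)[OF bB _ vr]) measurable
  have comp: "competitor x r u (\<lambda>y. u y + \<psi> y)" unfolding competitor_def
  proof (intro conjI)
    show "L1 (ball x r) (\<lambda>y. u y + \<psi> y)" unfolding L1_def
      using lebesgue_on_transfer(2)[OF bB _ vr] integrable_mult_indicator[OF _ fp, of "ball x r"] by simp
    have t: "AE y in lborel. y \<in> ball x r \<longrightarrow> H y = H y" "AE y in lborel. y \<in> ball x r \<longrightarrow> (norm (H y))\<^sup>2 = (norm (H y))\<^sup>2" by simp_all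
    have Hm [measurable]: "H \<in> borel_measurable borel" by (rule sqint_borel[OF H(1)])
    have "L2 (ball x r) H" unfolding L2_def
      using lebesgue_on_transfer(3)[OF bB Hm t(1)] lebesgue_on_transfer(2)[OF bB _ t(2)]
        integrable_mult_indicator[OF _ sqint_integrable[OF H(1)], of "ball x r"] by simp
    with gv show "gradient_in_L2 (ball x r) (\<lambda>y. u y + \<psi> y)" unfolding gradient_in_L2_def by blast
    have "has_trace x r u f" using tr[OF test_0] by simp
    with tr[OF \<psi>] show "equal_traces x r u (\<lambda>y. u y + \<psi> y)" unfolding equal_traces_def by blast
  qed
  note Ju = J_bounds[OF qp qm \<Omega> sub um gu G(2)]
  note Jv = J_bounds[OF qp qm \<Omega> sub vm gv H(1)]
  have c: "0 \<le> 1 + \<kappa> * r powr \<alpha>" using \<kappa> by simp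
  from am show ?thesis
  proof
    assume "almost_minimizer \<Omega> qp qm \<kappa> \<alpha> u"
    then have "J qp qm x r u \<le> (1 + \<kappa> * r powr \<alpha>) * J qp qm x r (\<lambda>y. u y + \<psi> y)"
      using r sub comp unfolding almost_minimizer_def by blast
    with Ju(1) mult_left_mono[OF Jv(2) c] show ?thesis by (simp only: H_def)
  next
    assume "almost_minimizer_plus \<Omega> qp \<kappa> \<alpha> u"
    then have "J_plus qp x r u \<le> (1 + \<kappa> * r powr \<alpha>) * J_plus qp x r (\<lambda>y. u y + \<psi> y)"
      using r comp unfolding almost_minimizer_plus_def by blast
    with Ju(3) mult_left_mono[OF Jv(4) c] show ?thesis by (simp only: H_def)
  qed
qed

text \<open>For good radii r just below R the inequality is first enlarged to the right-hand side at
  R, which dominates the one at r. Only the energy of G on the left then has to pass to the limit.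
  Working with r < R also keeps the closed ball inside \<open>\<Omega>\<close>.\<close>

lemma energy_comparison:
  assumes R: "0 < R" "ball x R \<subseteq> ball x0 \<rho>" and \<psi>: "test_function (ball x R) \<psi>"
  shows "(nrm (restr (ball x R) G))\<^sup>2 \<le> (1 + \<kappa> * R powr \<alpha>) *
    ((nrm (\<lambda>y. indicator (ball x R) y *\<^sub>R G y + grad \<psi> y))\<^sup>2 + 2 * M\<^sup>2 * (unit_ball_vol (real DIM('a)) * R ^ DIM('a)))"
    (is "_ \<le> ?rhs")
proof -
  obtain K where K: "C_infinity \<psi>" "compact K" "K \<subseteq> ball x R" "\<And>x. x \<notin> K \<Longrightarrow> \<psi> x = 0"
    using test_functionE[OF \<psi>] by blast
  obtain t where t: "R/2 \<le> t" "t < R" "K \<subseteq> ball x t" by (rule compact_subset_smaller_ball[OF K(2,3) R(1)])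
  note tr = trace_AE[OF f G w fz Gz uf R]
  have bound: "(nrm (restr (ball x r) G))\<^sup>2 \<le> ?rhs"
    if r: "t < r" "r < R" and T: "\<And>\<psi>. test_function (ball x r) \<psi> \<Longrightarrow> has_trace x r (\<lambda>y. u y + \<psi> y) f" for r
  proof -
    have r0: "0 < r" using r t R by linarith
    have s1: "ball x r \<subseteq> ball x0 \<rho>" using R(2) r by (meson order_trans subset_ball less_imp_le)
    have "cball x r \<subseteq> ball x R" using r by auto
    then have s2: "cball x r \<subseteq> \<Omega>" using R(2) B by blast
    have "K \<subseteq> ball x r" using t(3) r by auto
    then have \<psi>r: "test_function (ball x r) \<psi>" using K by (intro test_functionI[of _ K]) auto
    let ?F = "\<lambda>y. indicator (ball x R) y *\<^sub>R G y + grad \<psi> y"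
    have Fs: "sqint ?F" by (intro sqint_add sqint_indicator G sqint_grad(1)[OF \<psi>]) simp
    have Hm: "(\<lambda>y. indicator (ball x r) y *\<^sub>R (G y + grad \<psi> y)) \<in> borel_measurable borel"
      by (rule sqint_borel[OF sqint_indicator[OF sqint_add[OF G(2) sqint_grad(1)[OF \<psi>]]]]) simp
    have n: "nrm (\<lambda>y. indicator (ball x r) y *\<^sub>R (G y + grad \<psi> y)) \<le> nrm ?F"
      by (rule nrm_mono(2)[OF Fs Hm]) (use r in \<open>auto simp: indicator_def\<close>)
    have "measure lborel (ball x r) = unit_ball_vol (real DIM('a)) * r ^ DIM('a)"
      using r0 by (simp add: content_ball)
    also have "\<dots> \<le> unit_ball_vol (real DIM('a)) * R ^ DIM('a)"
      using r r0 by (intro mult_left_mono power_mono) auto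
    finally have m: "measure lborel (ball x r) \<le> unit_ball_vol (real DIM('a)) * R ^ DIM('a)" .
    have "(nrm (restr (ball x r) G))\<^sup>2 \<le> (1 + \<kappa> * r powr \<alpha>) *
      ((nrm (\<lambda>y. indicator (ball x r) y *\<^sub>R (G y + grad \<psi> y)))\<^sup>2 + 2 * M\<^sup>2 * measure lborel (ball x r))"
      by (rule energy_at_good_radius[OF r0 s1 s2 \<psi>r T])
    also have "\<dots> \<le> ?rhs"
      using n m r r0 \<kappa> \<alpha> by (intro mult_mono add_mono power_mono mult_left_mono powr_mono2) auto
    finally show ?thesis .
  qed
  \<comment> \<open>Good radii have full measure, so one lies within 1 / (j + 1) of R and beyond the
    support of psi.\<close>
  have "\<exists>r. max t (R - inverse (real (Suc j))) < r \<and> r < R \<and> (nrm (restr (ball x r) G))\<^sup>2 \<le> ?rhs" for j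
  proof -
    have "max t (R - inverse (real (Suc j))) < R" using t by simp
    from AE_obtain_in_interval[OF tr this] obtain r where r: "max t (R - inverse (real (Suc j))) < r" "r < R"
      "R/2 < r \<and> r < R \<longrightarrow> (\<forall>\<psi>. test_function (ball x r) \<psi> \<longrightarrow> has_trace x r (\<lambda>y. u y + \<psi> y) f)" by blast
    have "t < r" "R/2 < r" using r(1) t by auto
    then show ?thesis using r bound[of r] by blast
  qed
  then have "\<forall>j. \<exists>r. max t (R - inverse (real (Suc j))) < r \<and> r < R \<and> (nrm (restr (ball x r) G))\<^sup>2 \<le> ?rhs" ..
  from choice[OF this] obtain r where
    "\<forall>j. max t (R - inverse (real (Suc j))) < r j \<and> r j < R \<and> (nrm (restr (ball x (r j)) G))\<^sup>2 \<le> ?rhs" ..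
  then have r: "\<And>j. max t (R - inverse (real (Suc j))) < r j" "\<And>j. r j < R"
     "\<And>j. (nrm (restr (ball x (r j)) G))\<^sup>2 \<le> ?rhs" by blast+
  have e: "(norm (indicator (ball x t) y *\<^sub>R G y))\<^sup>2 = indicator (ball x t) y * (norm (G y))\<^sup>2" for y t
    by (simp add: indicator_def)
  have [measurable]: "G \<in> borel_measurable borel" using G by auto
  have "(\<lambda>j. LBINT y. indicator (ball x (r j)) y * (norm (G y))\<^sup>2) \<longlonglongrightarrow> (LBINT y. indicator (ball x R) y * (norm (G y))\<^sup>2)"
  proof (rule integral_dominated_convergence[OF _ _ sqint_integrable[OF G(2)]])
    show "AE y in lborel. (\<lambda>j. indicator (ball x (r j)) y * (norm (G y))\<^sup>2) \<longlonglongrightarrow> indicator (ball x R) y * (norm (G y))\<^sup>2"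
    proof (rule AE_I2, rule tendsto_eventually)
      fix y
      show "\<forall>\<^sub>F j in sequentially. indicator (ball x (r j)) y * (norm (G y))\<^sup>2 = indicator (ball x R) y * (norm (G y))\<^sup>2"
      proof (cases "y \<in> ball x R")
        case True
        have "\<forall>\<^sub>F j in sequentially. inverse (real (Suc j)) < R - dist x y"
          using True by (intro order_tendstoD(2)[OF LIMSEQ_inverse_real_of_nat]) auto
        then show ?thesis
        proof eventually_elim
          case (elim j)
          have "dist x y < r j" using elim r(1)[of j] by linarith
          then show ?case using True by simp
        qed
      next
        case False
        then have "y \<notin> ball x (r j)" for j using r(2)[of j] by auto
        then show ?thesis using False by simp
      qed
    qed
    show "(\<lambda>y. indicator (ball x R) y * (norm (G y))\<^sup>2) \<in> borel_measurable lborel"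
      "(\<lambda>y. indicator (ball x (r j)) y * (norm (G y))\<^sup>2) \<in> borel_measurable lborel" for j
      by (intro borel_measurable_times borel_measurable_indicator borel_measurable_integrable[OF sqint_integrable[OF G(2)]]; simp)+
  qed (auto simp: indicator_def)
  then have "(\<lambda>j. (nrm (restr (ball x (r j)) G))\<^sup>2) \<longlonglongrightarrow> (nrm (restr (ball x R) G))\<^sup>2"
    unfolding nrm_sq e .
  then show ?thesis by (rule LIMSEQ_le_const2) (use r(3) in blast)
qed

text \<open>Radii of balls inside \<open>ball x0 \<rho>\<close> are at most \<rho>, which makes the
  coefficient of \<open>r ^ DIM('a)\<close> the same for all of them.\<close>

sublocale almost_min_energy x0 \<rho> f G \<kappa> \<alpha> "(1 + \<kappa> * \<rho> powr \<alpha>) * (2 * M\<^sup>2 * unit_ball_vol (real DIM('a)))"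
proof
  fix x r and \<psi> :: "'a \<Rightarrow> real" assume r: "0 < r" "ball x r \<subseteq> ball x0 \<rho>" and \<psi>: "test_function (ball x r) \<psi>"
  have "r \<le> \<rho>" using r zero_le_dist[of x x0] unfolding ball_subset_ball_iff by linarith
  then have p: "r powr \<alpha> \<le> \<rho> powr \<alpha>" using r \<alpha> by (intro powr_mono2) auto
  define V where "V = 2 * M\<^sup>2 * unit_ball_vol (real DIM('a))"
  have V: "0 \<le> V" by (simp add: V_def)
  have "(nrm (restr (ball x r) G))\<^sup>2 \<le> (1 + \<kappa> * r powr \<alpha>) * ((nrm (\<lambda>y. indicator (ball x r) y *\<^sub>R G y + grad \<psi> y))\<^sup>2 + V * r ^ DIM('a))"
    using energy_comparison[OF r \<psi>] by (simp add: V_def mult.assoc)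
  also have "\<dots> = (1 + \<kappa> * r powr \<alpha>) * (nrm (\<lambda>y. indicator (ball x r) y *\<^sub>R G y + grad \<psi> y))\<^sup>2 + (1 + \<kappa> * r powr \<alpha>) * V * r ^ DIM('a)"
    by (simp only: distrib_left mult.assoc)
  also have "(1 + \<kappa> * r powr \<alpha>) * V * r ^ DIM('a) \<le> (1 + \<kappa> * \<rho> powr \<alpha>) * V * r ^ DIM('a)"
    using p \<kappa> r V by (intro mult_right_mono) auto
  finally show "(nrm (restr (ball x r) G))\<^sup>2 \<le> (1 + \<kappa> * r powr \<alpha>) * (nrm (\<lambda>y. indicator (ball x r) y *\<^sub>R G y + grad \<psi> y))\<^sup>2
    + (1 + \<kappa> * \<rho> powr \<alpha>) * (2 * M\<^sup>2 * unit_ball_vol (real DIM('a))) * r ^ DIM('a)" by (simp add: V_def)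
qed (use f G w \<kappa> \<alpha> in auto)

end

text \<open>The strict inequality between the radii is essential: u is integrable on compact subsets
  of \<open>\<Omega>\<close>, in particular on \<open>cball x0 \<rho>\<close>.\<close>

lemma local_representative_exists:
  fixes u :: "'a::euclidean_space \<Rightarrow> real"
  assumes u: "K_loc \<Omega> u" and b: "0 < r" "ball x0 r \<subseteq> \<Omega>" and \<rho>: "\<rho> < r"
  obtains f G where "integrable lborel f" "integrable lborel G" "sqint G" "weakly_diff (ball x0 \<rho>) f G"
    "\<And>y. y \<notin> cball x0 \<rho> \<Longrightarrow> f y = 0" "\<And>y. y \<notin> cball x0 \<rho> \<Longrightarrow> G y = 0"
    "AE y in lborel. y \<in> ball x0 \<rho> \<longrightarrow> u y = f y"
proof -
  have cB [measurable]: "cball x0 \<rho> \<in> sets borel" and bB: "ball x0 r \<in> sets borel" by simp_all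
  have sub: "cball x0 \<rho> \<subseteq> ball x0 r" using \<rho> by auto
  then have ui: "integrable (lebesgue_on (cball x0 \<rho>)) u" using u b unfolding K_loc_def L1_loc_def by (meson compact_cball order_trans)
  obtain g where g: "has_weak_gradient (ball x0 r) u g" "L2 (ball x0 r) g"
    using u b unfolding K_loc_def gradient_in_L2_def by blast
  obtain f' where f' [measurable]: "f' \<in> borel_measurable borel" and fe: "AE y in lborel. y \<in> cball x0 \<rho> \<longrightarrow> u y = f' y"
    using borel_version[OF cB borel_measurable_integrable[OF ui]] by blast
  have "g \<in> borel_measurable (lebesgue_on (ball x0 r))" using g(2) by (simp add: L2_def)
  then obtain g' where g' [measurable]: "g' \<in> borel_measurable borel" and ge: "AE y in lborel. y \<in> ball x0 r \<longrightarrow> g y = g' y"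
    using borel_version[OF bB] by blast
  define f where "f y = indicator (cball x0 \<rho>) y *\<^sub>R f' y" for y
  define G where "G y = indicator (cball x0 \<rho>) y *\<^sub>R g' y" for y
  have fi: "integrable lborel f" using lebesgue_on_transfer(2)[OF cB f' fe] ui by (simp add: f_def[abs_def])
  have gsq: "integrable lborel (\<lambda>y. indicator (ball x0 r) y *\<^sub>R (norm (g' y))\<^sup>2)"
  proof -
    have "AE y in lborel. y \<in> ball x0 r \<longrightarrow> (norm (g y))\<^sup>2 = (norm (g' y))\<^sup>2" using ge by eventually_elim simp
    from lebesgue_on_transfer(2)[OF bB _ this] show ?thesis using g(2) by (simp add: L2_def)
  qed
  have Gm [measurable]: "G \<in> borel_measurable borel" unfolding G_def[abs_def] by measurable
  have "integrable lborel (\<lambda>y. (norm (G y))\<^sup>2)"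
    by (rule Bochner_Integration.integrable_bound[OF gsq]) (use \<rho> in \<open>auto simp: G_def indicator_def\<close>)
  then have Gs: "sqint G" by (simp add: sqint_def)
  have ci: "integrable lborel (\<lambda>y::'a. indicator (cball x0 \<rho>) y :: real)"
    using emeasure_lborel_cball_finite[of x0 \<rho>] by (intro integrable_real_indicator) auto
  \<comment> \<open>On a set of finite measure square integrability gives integrability, through |G|
    <= 1 + |G|^2.\<close>
  have Gi: "integrable lborel G"
  proof (rule Bochner_Integration.integrable_bound)
    show "integrable lborel (\<lambda>y. indicator (cball x0 \<rho>) y + (norm (G y))\<^sup>2)" using ci sqint_integrable[OF Gs] by auto
    have "norm (G y) \<le> indicator (cball x0 \<rho>) y + (norm (G y))\<^sup>2" for y
    proof (cases "y \<in> cball x0 \<rho>")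
      case True
      have "0 \<le> (norm (G y) - 1)\<^sup>2" by simp
      then have "2 * norm (G y) \<le> 1 + (norm (G y))\<^sup>2" by (simp add: power2_diff)
      moreover have "0 \<le> norm (G y)" by simp
      moreover have "0 \<le> (norm (G y))\<^sup>2" by simp
      ultimately have "norm (G y) \<le> 1 + (norm (G y))\<^sup>2" by linarith
      then show ?thesis using True by simp
    qed (simp add: G_def)
    then show "AE y in lborel. norm (G y) \<le> norm (indicator (cball x0 \<rho>) y + (norm (G y))\<^sup>2)"
      by (intro AE_I2) (smt (verit) norm_ge_zero real_norm_def)
  qed measurable
  have wd: "weakly_diff (ball x0 \<rho>) f G" unfolding weakly_diff_def
  proof (intro allI impI ballI)
    fix \<phi> and i :: 'a assume t: "test_function (ball x0 \<rho>) \<phi>" and i: "i \<in> Basis"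
    have t': "test_function (ball x0 r) \<phi>" by (rule test_mono[OF t]) (use \<rho> in auto)
    have [measurable]: "\<phi> \<in> borel_measurable borel" "pd i \<phi> \<in> borel_measurable borel"
      using t test_pd[OF t i] test_borel by blast+
    have z: "\<phi> y = 0" "pd i \<phi> y = 0" if "y \<notin> cball x0 \<rho>" for y
      using that test_zero[OF t, of y] test_zero[OF test_pd[OF t i], of y] by auto
    have a1: "AE y in lborel. y \<in> ball x0 r \<longrightarrow> u y * frechet_derivative \<phi> (at y) i = f y * pd i \<phi> y"
      using fe
    proof eventually_elim
      case (elim y) then show ?case using z(2)[of y] by (cases "y \<in> cball x0 \<rho>") (auto simp: f_def pd_def)
    qed
    have a2: "AE y in lborel. y \<in> ball x0 r \<longrightarrow> g y \<bullet> i * \<phi> y = G y \<bullet> i * \<phi> y"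
      using ge
    proof eventually_elim
      case (elim y) then show ?case using z(1)[of y] by (cases "y \<in> cball x0 \<rho>") (auto simp: G_def)
    qed
    have fm [measurable]: "f \<in> borel_measurable borel" using fi by auto
    have "(LBINT y. f y * pd i \<phi> y) = (LBINT y. indicator (ball x0 r) y *\<^sub>R (f y * pd i \<phi> y))"
      by (intro Bochner_Integration.integral_cong refl) (use sub in \<open>auto simp: f_def indicator_def\<close>)
    also have "\<dots> = (\<integral>y. u y * frechet_derivative \<phi> (at y) i \<partial>lebesgue_on (ball x0 r))"
      by (rule lebesgue_on_transfer(1)[OF bB _ a1, symmetric]) measurable
    also have "\<dots> = - (\<integral>y. (g y \<bullet> i) * \<phi> y \<partial>lebesgue_on (ball x0 r))"
      using g(1) t' i unfolding has_weak_gradient_def by blast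
    also have "(\<integral>y. (g y \<bullet> i) * \<phi> y \<partial>lebesgue_on (ball x0 r)) = (LBINT y. indicator (ball x0 r) y *\<^sub>R (G y \<bullet> i * \<phi> y))"
      by (rule lebesgue_on_transfer(1)[OF bB _ a2]) measurable
    also have "\<dots> = (LBINT y. (G y \<bullet> i) * \<phi> y)"
      by (intro Bochner_Integration.integral_cong refl) (use sub in \<open>auto simp: G_def indicator_def\<close>)
    finally show "(LBINT y. f y * pd i \<phi> y) = - (LBINT y. (G y \<bullet> i) * \<phi> y)" .
  qed
  have "AE y in lborel. y \<in> ball x0 \<rho> \<longrightarrow> u y = f y" using fe by eventually_elim (auto simp: f_def)
  then show ?thesis using that[OF fi Gi Gs wd] by (simp add: f_def G_def)
qed

text \<open>Defined without reference to a ball, so that the local estimates need no gluing.\<close>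

definition mollified_limit :: "('a::euclidean_space \<Rightarrow> real) \<Rightarrow> 'a \<Rightarrow> real" where
  "mollified_limit u x = lim (\<lambda>k. \<integral>y. mollifier ((1/2) ^ k) (x - y) * u y \<partial>lebesgue_on UNIV)"

text \<open>The radius 15/8 r0 stays below 2 r0, so that the closed ball lies in the given open one,
  and exceeds r0 by 7/8 r0, room for two steps R < 7/16 r0.\<close>

lemma (in local_representative) mollified_limit_log_lipschitz:
  assumes r0: "0 < r0" "\<rho> = 15/8 * r0"
  obtains C where "0 < C" "\<And>x y. x \<in> ball x0 r0 \<Longrightarrow> y \<in> ball x0 r0 \<Longrightarrow>
      \<bar>mollified_limit u x - mollified_limit u y\<bar> \<le> C * norm (x - y) * (1 + ln (2 * r0 / norm (x - y)))"
    "AE y in lborel. y \<in> ball x0 r0 \<longrightarrow> mollified_limit u y = u y"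
proof -
  \<comment> \<open>Taking R to be a power of 1/2 makes the scales R 2^-k a tail of the dyadic
    sequence in \<open>mollified_limit\<close>, whatever the ball.\<close>
  obtain m where m: "(1/2) ^ m < 7/16 * r0" using real_arch_pow_inv[of "7/16 * r0" "1/2"] r0 by auto
  define R :: real where "R = (1/2) ^ m"
  have R: "0 < R" "R \<le> 2 * r0" "r0 + 2 * R \<le> \<rho>" using m r0 by (auto simp: R_def)
  obtain C W where W: "0 < C" "\<And>x. x \<in> ball x0 r0 \<Longrightarrow> (\<lambda>k. conv (mollifier (R * (1/2) ^ k)) f x) \<longlonglongrightarrow> W x"
    "\<And>x y. x \<in> ball x0 r0 \<Longrightarrow> y \<in> ball x0 r0 \<Longrightarrow> \<bar>W x - W y\<bar> \<le> C * norm (x - y) * (1 + ln (2 * r0 / norm (x - y)))"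
  proof (rule log_lipschitz[OF r0(1) R])
    fix W C
    assume a: "0 < C" "\<And>x. x \<in> ball x0 r0 \<Longrightarrow> (\<lambda>k. conv (mollifier (R * (1/2) ^ k)) f x) \<longlonglongrightarrow> W x"
      "\<And>x y. x \<in> ball x0 r0 \<Longrightarrow> y \<in> ball x0 r0 \<Longrightarrow> \<bar>W x - W y\<bar> \<le> C * norm (x - y) * (1 + ln (2 * r0 / norm (x - y)))"
    show thesis by (rule that[OF a])
  qed
  define s where "s k = R * (1/2) ^ k" for k
  have s: "0 < s k" for k using R by (simp add: s_def)
  have sR: "s k \<le> R" for k using R by (simp add: s_def mult_left_le power_le_one)
  have s0: "s \<longlonglongrightarrow> 0"
    using tendsto_mult[OF tendsto_const[of R] LIMSEQ_realpow_zero[of "1/2"]] by (simp add: s_def[abs_def])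
  have [measurable]: "f \<in> borel_measurable borel" using f by auto
  have Wl: "mollified_limit u x = W x" if x: "x \<in> ball x0 r0" for x
  proof -
    have eq: "(\<integral>y. mollifier ((1/2) ^ (k + m)) (x - y) * u y \<partial>lebesgue_on UNIV) = conv (mollifier (s k)) f x" for k
    proof -
      have sk: "(1/2) ^ (k + m) = s k" by (simp add: s_def R_def power_add)
      have "AE y in lborel. y \<in> UNIV \<longrightarrow> mollifier (s k) (x - y) * u y = mollifier (s k) (x - y) * f y"
        using uf
      proof eventually_elim
        case (elim y)
        show ?case
        proof (cases "y \<in> ball x0 \<rho>")
          case False
          have "s k \<le> norm (x - y)"
            using False x sR[of k] R dist_triangle[of x0 y x] by (auto simp: dist_norm[of x y, symmetric])
          then show ?thesis by (simp add: mollifier_zero[OF s])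
        qed (use elim in simp)
      qed
      moreover have "(\<lambda>y. mollifier (s k) (x - y) * f y) \<in> borel_measurable borel"
        using borel_measurable_integrable[OF conv_integrable[OF mollifier_test[OF s] f]] by simp
      ultimately show ?thesis
        using lebesgue_on_transfer(1)[of UNIV "\<lambda>y. mollifier (s k) (x - y) * f y" "\<lambda>y. mollifier (s k) (x - y) * u y"]
        unfolding sk conv_def by simp
    qed
    have "(\<lambda>k. \<integral>y. mollifier ((1/2) ^ (k + m)) (x - y) * u y \<partial>lebesgue_on UNIV) \<longlonglongrightarrow> W x"
      unfolding eq using W(2)[OF x] by (simp add: s_def)
    then have "(\<lambda>k. \<integral>y. mollifier ((1/2) ^ k) (x - y) * u y \<partial>lebesgue_on UNIV) \<longlonglongrightarrow> W x"
      by (rule LIMSEQ_offset)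
    then show ?thesis unfolding mollified_limit_def by (rule limI)
  qed
  have out: "f y = 0" if "y \<notin> cball 0 (norm x0 + \<rho>)" for y
    using that norm_triangle_ineq2[of y x0] by (intro fz) (auto simp: dist_norm norm_minus_commute)
  \<comment> \<open>Convergence in the mean gives a subsequence converging to f almost everywhere;
    this identifies the limit \<open>W\<close> with u.\<close>
  have lim: "(\<lambda>k. LBINT y. norm (conv (mollifier (s k)) f y - f y)) \<longlonglongrightarrow> 0"
    using conv_Lp_tendsto(2)[of f 1 "norm x0 + \<rho>" s] f out s s0 by simp
  have ci: "integrable lborel (\<lambda>y. conv (mollifier (s k)) f y - f y)" for k
    using conv_integral(1)[OF f mollifier_integrable[OF s]] f by auto
  from tendsto_L1_AE_subseq[OF ci lim] obtain \<sigma> where \<sigma>: "strict_mono \<sigma>"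
    "AE y in lborel. (\<lambda>k. conv (mollifier (s (\<sigma> k))) f y - f y) \<longlonglongrightarrow> 0" by blast
  have "AE y in lborel. y \<in> ball x0 r0 \<longrightarrow> mollified_limit u y = u y"
    using \<sigma>(2) uf
  proof eventually_elim
    case (elim y)
    show ?case
    proof
      assume y: "y \<in> ball x0 r0"
      have "(\<lambda>k. conv (mollifier (s (\<sigma> k))) f y) \<longlonglongrightarrow> f y"
        using tendsto_add[OF elim(1) tendsto_const[of "f y"]] by simp
      moreover have "(\<lambda>k. conv (mollifier (s (\<sigma> k))) f y) \<longlonglongrightarrow> W y"
        using filterlim_compose[OF W(2)[OF y] filterlim_subseq[OF \<sigma>(1)]] by (simp add: s_def)
      ultimately have "f y = W y" by (rule LIMSEQ_unique)
      moreover have "y \<in> ball x0 \<rho>" using y r0 by auto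
      ultimately show "mollified_limit u y = u y" using Wl[OF y] elim(2) by simp
    qed
  qed
  then show ?thesis using that[OF W(1)] W(3) Wl by simp
qed

text \<open>Since ln s = 2 ln (sqrt s) <= 2 sqrt s, the product d ln (2 r0 / d) is at most 2 sqrt (2
  r0 d), which tends to 0 with d.\<close>

lemma log_modulus_imp_isCont:
  fixes w :: "'a::euclidean_space \<Rightarrow> real"
  assumes C: "0 < C" and r0: "0 < r0"
    and le: "\<And>x y. x \<in> ball x0 r0 \<Longrightarrow> y \<in> ball x0 r0 \<Longrightarrow> \<bar>w x - w y\<bar> \<le> C * norm (x - y) * (1 + ln (2 * r0 / norm (x - y)))"
    and x: "x \<in> ball x0 r0"
  shows "isCont w x"
proof -
  have bd: "\<bar>w y - w x\<bar> \<le> C * norm (y - x) + 2 * C * sqrt (2 * r0 * norm (y - x))" if y: "y \<in> ball x0 r0" for y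
  proof (cases "y = x")
    case False
    define d where "d = norm (y - x)"
    have d: "0 < d" using False by (simp add: d_def)
    have q: "0 < 2 * r0 / d" using d r0 by simp
    have "ln (2 * r0 / d) = 2 * ln (sqrt (2 * r0 / d))" using q by (simp add: ln_sqrt)
    also have "\<dots> \<le> 2 * sqrt (2 * r0 / d)" using ln_le_minus_one[of "sqrt (2 * r0 / d)"] q by simp
    finally have "d * ln (2 * r0 / d) \<le> d * (2 * sqrt (2 * r0 / d))" using d by (intro mult_left_mono) auto
    also have "d * (2 * sqrt (2 * r0 / d)) = 2 * sqrt (2 * r0 * d)"
    proof -
      have "sqrt (2 * r0 * d) = sqrt (d\<^sup>2 * (2 * r0 / d))" using d by (simp add: power2_eq_square)
      also have "\<dots> = d * sqrt (2 * r0 / d)" using d by (simp only: real_sqrt_mult real_sqrt_abs abs_of_pos)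
      finally show ?thesis by simp
    qed
    finally have "C * (d * ln (2 * r0 / d)) \<le> C * (2 * sqrt (2 * r0 * d))" using C by (intro mult_left_mono) auto
    moreover have "\<bar>w y - w x\<bar> \<le> C * d * (1 + ln (2 * r0 / d))" unfolding d_def by (rule le[OF y x])
    ultimately show ?thesis unfolding d_def[symmetric] by (simp add: algebra_simps)
  qed simp
  have "((\<lambda>y. w y - w x) \<longlongrightarrow> 0) (at x)"
  proof (rule Lim_null_comparison)
    have "\<forall>\<^sub>F y in at x. y \<in> ball x0 r0" using x by (intro eventually_at_in_open') auto
    then show "\<forall>\<^sub>F y in at x. norm (w y - w x) \<le> C * norm (y - x) + 2 * C * sqrt (2 * r0 * norm (y - x))"
      by eventually_elim (use bd in simp)
    have "((\<lambda>y. C * norm (y - x) + 2 * C * sqrt (2 * r0 * norm (y - x))) \<longlongrightarrow> C * norm (x - x) + 2 * C * sqrt (2 * r0 * norm (x - x))) (at x)"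
      by (intro tendsto_intros)
    then show "((\<lambda>y. C * norm (y - x) + 2 * C * sqrt (2 * r0 * norm (y - x))) \<longlongrightarrow> 0) (at x)" by simp
  qed
  then show ?thesis unfolding isCont_def by (simp add: LIM_zero_iff)
qed

text \<open>The Lindelof property reduces the local null sets to countably many.\<close>

lemma AE_open_cover:
  fixes \<Omega> :: "'a::euclidean_space set"
  assumes "\<And>x. x \<in> \<Omega> \<Longrightarrow> \<exists>e>0. AE y in lborel. y \<in> ball x e \<longrightarrow> P y"
  shows "AE y in lborel. y \<in> \<Omega> \<longrightarrow> P y"
proof -
  define F where "F = {ball x e | x e. x \<in> \<Omega> \<and> 0 < e \<and> (AE y in lborel. y \<in> ball x e \<longrightarrow> P y)}"
  have F1: "AE y in lborel. y \<in> S \<longrightarrow> P y" if "S \<in> F" for S using that unfolding F_def by blast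
  have "\<And>S. S \<in> F \<Longrightarrow> open S" by (auto simp: F_def)
  then obtain F' where F': "F' \<subseteq> F" "countable F'" "\<Union>F' = \<Union>F" by (rule Lindelof)
  have "AE y in lborel. \<forall>S\<in>F'. y \<in> S \<longrightarrow> P y"
    using F1 F'(1) by (subst AE_ball_countable[OF F'(2)]) blast
  then show ?thesis
  proof eventually_elim
    case (elim y)
    show ?case
    proof
      assume y: "y \<in> \<Omega>"
      then obtain e where "0 < e" "AE z in lborel. z \<in> ball y e \<longrightarrow> P z" using assms by blast
      then have "ball y e \<in> F" "y \<in> ball y e" using y by (auto simp: F_def)
      then have "y \<in> \<Union>F'" unfolding F'(3) by blast
      then show "P y" using elim by blast
    qed
  qed
qed

theorem theorem2p1:
  fixes \<Omega> :: "(real ^ 'n) set"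
    and qp qm u :: "real ^ 'n \<Rightarrow> real"
    and \<kappa> \<alpha> :: real
  assumes "CARD('n) \<ge> 2"
    and "open \<Omega>"
    and "L_infinity \<Omega> qp" and "L_infinity \<Omega> qm"
    and "0 < \<kappa>" and "0 < \<alpha>" and "\<alpha> \<le> 1"
    and "almost_minimizer \<Omega> qp qm \<kappa> \<alpha> u \<or> almost_minimizer_plus \<Omega> qp \<kappa> \<alpha> u"
  shows "\<exists>w. (AE x in lebesgue_on \<Omega>. w x = u x) \<and> continuous_on \<Omega> w \<and>
    (\<forall>x0 r0. 0 < r0 \<and> ball x0 (2 * r0) \<subseteq> \<Omega> \<longrightarrow>
      (\<exists>C>0. \<forall>x\<in>ball x0 r0. \<forall>y\<in>ball x0 r0.
         \<bar>w x - w y\<bar> \<le> C * norm (x - y) * (1 + ln (2 * r0 / norm (x - y)))))"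
proof -
  have K: "K_loc \<Omega> u" using assms(8) by (auto simp: almost_minimizer_def almost_minimizer_plus_def K_loc_plus_def)
  obtain M1 where qp: "qp \<in> borel_measurable (lebesgue_on \<Omega>)" "AE x in lebesgue_on \<Omega>. \<bar>qp x\<bar> \<le> M1"
    using assms(3) by (auto simp: L_infinity_def)
  obtain M2 where qm: "qm \<in> borel_measurable (lebesgue_on \<Omega>)" "AE x in lebesgue_on \<Omega>. \<bar>qm x\<bar> \<le> M2"
    using assms(4) by (auto simp: L_infinity_def)
  have M: "AE x in lebesgue_on \<Omega>. \<bar>qp x\<bar> \<le> max M1 M2" using qp(2) by eventually_elim auto
  have M': "AE x in lebesgue_on \<Omega>. \<bar>qm x\<bar> \<le> max M1 M2" using qm(2) by eventually_elim auto
  let ?w = "mollified_limit u"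
  \<comment> \<open>The function \<open>?w\<close> is fixed before the ball, while C comes out of
    the local representative and so depends on the ball.\<close>
  have loc: "\<exists>C>0. (\<forall>x\<in>ball x0 r0. \<forall>y\<in>ball x0 r0. \<bar>?w x - ?w y\<bar> \<le> C * norm (x - y) * (1 + ln (2 * r0 / norm (x - y))))
      \<and> (AE y in lborel. y \<in> ball x0 r0 \<longrightarrow> ?w y = u y)"
    if r0: "0 < r0" "ball x0 (2 * r0) \<subseteq> \<Omega>" for x0 r0
  proof -
    have "0 < 2 * r0" "15/8 * r0 < 2 * r0" using r0 by auto
    then obtain f G where fG: "integrable lborel f" "integrable lborel G" "sqint G" "weakly_diff (ball x0 (15/8 * r0)) f G"
      "\<And>y. y \<notin> cball x0 (15/8 * r0) \<Longrightarrow> f y = 0" "\<And>y. y \<notin> cball x0 (15/8 * r0) \<Longrightarrow> G y = 0"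
      "AE y in lborel. y \<in> ball x0 (15/8 * r0) \<longrightarrow> u y = f y"
      using local_representative_exists[OF K _ r0(2), of "15/8 * r0"] by blast
    have "ball x0 (15/8 * r0) \<subseteq> \<Omega>" using r0 subset_ball[of "15/8 * r0" "2 * r0" x0] by auto
    then interpret local_representative \<Omega> qp qm u f G x0 "15/8 * r0" \<kappa> \<alpha> "max M1 M2"
      using assms qp(1) qm(1) M M' fG by unfold_locales auto
    show ?thesis by (rule mollified_limit_log_lipschitz[OF r0(1) refl]) blast
  qed
  have ex: "\<exists>e>0. ball x (2 * e) \<subseteq> \<Omega>" if x: "x \<in> \<Omega>" for x
  proof -
    obtain e where "0 < e" "ball x e \<subseteq> \<Omega>" using assms(2) x by (meson open_contains_ball)
    then show ?thesis by (intro exI[of _ "e/2"]) auto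
  qed
  have s: "\<Omega> \<inter> space lebesgue \<in> sets lebesgue" using assms(2) by (simp add: sets_completionI_sets)
  have "AE x in lborel. x \<in> \<Omega> \<longrightarrow> ?w x = u x"
    by (rule AE_open_cover) (use ex loc in meson)
  then have "AE x in lebesgue_on \<Omega>. ?w x = u x"
    unfolding AE_restrict_space_iff[OF s] by (rule AE_completion)
  moreover have "continuous_on \<Omega> ?w"
  proof (rule continuous_at_imp_continuous_on, rule ballI)
    fix x assume "x \<in> \<Omega>"
    then obtain e where e: "0 < e" "ball x (2 * e) \<subseteq> \<Omega>" using ex by blast
    obtain C where C: "0 < C" "\<forall>a\<in>ball x e. \<forall>b\<in>ball x e. \<bar>?w a - ?w b\<bar> \<le> C * norm (a - b) * (1 + ln (2 * e / norm (a - b)))"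
      using loc[OF e] by blast
    show "isCont ?w x" by (rule log_modulus_imp_isCont[OF C(1) e(1), of x]) (use C(2) e in auto)
  qed
  moreover have "\<forall>x0 r0. 0 < r0 \<and> ball x0 (2 * r0) \<subseteq> \<Omega> \<longrightarrow>
      (\<exists>C>0. \<forall>x\<in>ball x0 r0. \<forall>y\<in>ball x0 r0. \<bar>?w x - ?w y\<bar> \<le> C * norm (x - y) * (1 + ln (2 * r0 / norm (x - y))))"
    using loc by blast
  ultimately show ?thesis by blast
qed

end
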